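(* Assume there are positive constants $L_1,L_2,L_3$ such that for all $s,t\in[0,T]$ and all $x,y,x_1,x_2,y_1,y_2\in\mathbb R$: $|b(t,x,y)-b(s,x,y)|+|\sigma(t,x,y)-\sigma(s,x,y)|\le L_1|t-s|$, $|b(t,x_1,y_1)-b(t,x_2,y_2)|+|\sigma(t,x_1,y_1)-\sigma(t,x_2,y_2)|\le L_2(|x_1-x_2|+|y_1-y_2|)$, $|b(t,x,y)|+|\sigma(t,x,y)|\le L_3(1+|x|+|y|)$. Assume also that $K(t,s,x)$ is differentiable in $x$ and there are positive constants $K_1,K_2,K_3$ such that for all $t,u\in[0,T]$, $s,v\in[-r,0]$, $x,y\in\mathbb R$: $|K(t,s,x)-K(u,v,x)|\le K_1(|t-u|+|s-v|)$, $|K(t,s,x)-K(t,s,y)|\le K_2|x-y|$, $|K(t,s,x)|\le K_3(1+|x|)$. Then for any $\varepsilon>0$ and $0<\rho<H$ there exist $h_0>0$ and $\Omega_{\varepsilon,h_0,\rho}\subset\Omega$ such that $\mathbb P(\Omega_{\varepsilon,h_0,\rho})>1-\varepsilon$ and for each $\omega\in\Omega_{\varepsilon,h_0,\rho}$ and $h<h_0$ there is a constant $C(\omega)>0$ with $$|X(t)|<C(\omega)\quad\text{for all }t\in[0,T],$$ and for $0\le s<t\le T$, $$|X(t)-X(s)|\le C(\omega)(t-s)^{H-\rho}.$$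
   Context: Let $(\Omega,\mathcal F,\{\mathcal F_t\}_{t\ge0},\mathbb P)$ be a complete filtered probability space satisfying the usual conditions, $r>0$, $T>0$, $H\in(1/2,1)$, and $B^H$ a fractional Brownian motion with Hurst parameter $H$. The functions $b,\sigma:[0,T]\times\mathbb R\times\mathbb R\to\mathbb R$ and $K:[0,T]\times[-r,0]\times\mathbb R\to\mathbb R$ are continuous. The initial condition $\phi:[-r,0]\to\mathbb R$ is $(H-\rho)$-Hölder continuous for every $0<\rho<H$, i.e. $|\phi(t)-\phi(s)|\le L|t-s|^{H-\rho}$ with a positive constant $L$. Stochastic integrals with respect to $B^H$ are pathwise generalized Lebesgue–Stieltjes integrals (in the sense of Zähle; for integrands Hölder of order $\nu$ with $\nu+H>1$ they exist and coincide with Young/Riemann–Stieltjes integrals). $X$ is a solution (with a.s. Hölder trajectories of some order $>1-H$, so that the integral exists) of $X(t)=X(0)+\int_0^t b(s,X(s),Y(s))\,ds+\int_0^t\sigma(s,X(s),Y(s))\,dB^H(s)$ for $t\in[0,T]$, $X(t)=\phi(t)$ for $t\in[-r,0]$, where $Y(t)=\int_{-r}^0K(t,s,X(t+s))\,ds$, $t\in[0,T]$. (The parameter $h$ is the step size of a discretization; $X$ does not depend on it.) *)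

theory Defs
  imports "HOL-Probability.Probability"
begin

locale usual_filtered_prob_space = prob_space M + complete_measure M
  for M :: "'a measure" +
  fixes F :: "real \<Rightarrow> 'a measure"
  assumes subalgebra_F: "\<And>t. 0 \<le> t \<Longrightarrow> subalgebra M (F t)"
    and F_mono: "\<And>s t. 0 \<le> s \<Longrightarrow> s \<le> t \<Longrightarrow> sets (F s) \<subseteq> sets (F t)"
    and F_right_continuous: "\<And>t. 0 \<le> t \<Longrightarrow> sets (F t) = (\<Inter>u\<in>{t<..}. sets (F u))"
    and null_sets_F: "null_sets M \<subseteq> sets (F 0)"

text \<open>Normal laws include the degenerate (constant) ones.\<close>

definition normal_rv :: "'a measure \<Rightarrow> ('a \<Rightarrow> real) \<Rightarrow> bool" where
  "normal_rv M Z \<longleftrightarrow>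
     (\<exists>\<mu> s. 0 < s \<and> distributed M lborel Z (normal_density \<mu> s)) \<or>
     (\<exists>\<mu>. Z \<in> borel_measurable M \<and> (AE \<omega> in M. Z \<omega> = \<mu>))"

text \<open>Joint normality of the finite-dimensional distributions is expressed by normality of all
  finite linear combinations. As pathwise integrals are taken, a fractional Brownian motion is
  understood to be a version with almost surely continuous paths.\<close>

definition gaussian_process :: "'a measure \<Rightarrow> real set \<Rightarrow> (real \<Rightarrow> 'a \<Rightarrow> real) \<Rightarrow> bool" where
  "gaussian_process M I Z \<longleftrightarrow>
     (\<forall>J c. finite J \<and> J \<subseteq> I \<longrightarrow> normal_rv M (\<lambda>\<omega>. \<Sum>t\<in>J. c t * Z t \<omega>))"

definition fractional_brownian_motion ::
  "'a measure \<Rightarrow> real \<Rightarrow> (real \<Rightarrow> 'a \<Rightarrow> real) \<Rightarrow> bool" where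
  "fractional_brownian_motion M H B \<longleftrightarrow>
     (\<forall>t\<ge>0. B t \<in> borel_measurable M) \<and>
     gaussian_process M {0..} B \<and>
     (\<forall>t\<ge>0. prob_space.expectation M (B t) = 0) \<and>
     (\<forall>s\<ge>0. \<forall>t\<ge>0. prob_space.expectation M (\<lambda>\<omega>. B s \<omega> * B t \<omega>) =
        (s powr (2 * H) + t powr (2 * H) - \<bar>t - s\<bar> powr (2 * H)) / 2) \<and>
     (AE \<omega> in M. continuous_on {0..} (\<lambda>t. B t \<omega>))"

text \<open>Fractional derivatives of order \<open>\<alpha> \<in> (0,1)\<close> in Weyl form on an interval with
  left end point \<open>a\<close>, respectively right end point \<open>b\<close>. The right-sided derivative is usually
  written with an additional complex factor \<open>(-1)\<^sup>\<alpha>\<close>, which is left out here.\<close>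

definition weyl_deriv_left :: "real \<Rightarrow> real \<Rightarrow> (real \<Rightarrow> real) \<Rightarrow> real \<Rightarrow> real" where
  "weyl_deriv_left \<alpha> a f x =
     (f x / (x - a) powr \<alpha> +
      \<alpha> * (LBINT y:{a<..<x}. (f x - f y) / (x - y) powr (1 + \<alpha>))) / Gamma (1 - \<alpha>)"

definition weyl_deriv_right :: "real \<Rightarrow> real \<Rightarrow> (real \<Rightarrow> real) \<Rightarrow> real \<Rightarrow> real" where
  "weyl_deriv_right \<alpha> b g x =
     (g x / (b - x) powr \<alpha> +
      \<alpha> * (LBINT y:{x<..<b}. (g x - g y) / (y - x) powr (1 + \<alpha>))) / Gamma (1 - \<alpha>)"

text \<open>Admissibility of the order \<open>\<alpha>\<close> for integrating \<open>f\<close> against \<open>g\<close> over \<open>[a,b]\<close>: the integrals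
  defining the left derivative of \<open>f\<close> converge absolutely with a result in \<open>L\<^sub>1\<close>, and the right
  derivative of order \<open>1 - \<alpha>\<close> of \<open>g - g b\<close> exists and is bounded.\<close>

definition gls_admissible ::
  "real \<Rightarrow> (real \<Rightarrow> real) \<Rightarrow> (real \<Rightarrow> real) \<Rightarrow> real \<Rightarrow> real \<Rightarrow> bool" where
  "gls_admissible \<alpha> f g a b \<longleftrightarrow>
     0 < \<alpha> \<and> \<alpha> < 1 \<and>
     set_integrable lborel {a<..<b} (\<lambda>x. f x / (x - a) powr \<alpha>) \<and>
     set_integrable (lborel \<Otimes>\<^sub>M lborel) {(x, y). a < y \<and> y < x \<and> x < b}
       (\<lambda>(x, y). (f x - f y) / (x - y) powr (1 + \<alpha>)) \<and>
     (\<forall>x\<in>{a<..<b}. set_integrable lborel {x<..<b} (\<lambda>y. (g x - g y) / (y - x) powr (2 - \<alpha>))) \<and>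
     bounded (weyl_deriv_right (1 - \<alpha>) b (\<lambda>x. g x - g b) ` {a<..<b})"

text \<open>The generalized Lebesgue--Stieltjes integral
  \<open>(-1)\<^sup>\<alpha> \<integral> D\<^sup>\<alpha> f (x) D\<^bsup>1 - \<alpha>\<^esup> (g - g b) (x) dx\<close>. The factor \<open>(-1)\<^sup>\<alpha>\<close> and the omitted
  factor \<open>(-1)\<^bsup>1 - \<alpha>\<^esup>\<close> of the right derivative combine to the real sign \<open>-1\<close>.
  The value does not depend on the admissible \<open>\<alpha>\<close>.\<close>

definition has_gls_integral ::
  "(real \<Rightarrow> real) \<Rightarrow> (real \<Rightarrow> real) \<Rightarrow> real \<Rightarrow> real \<Rightarrow> real \<Rightarrow> bool" where
  "has_gls_integral f g a b I \<longleftrightarrow>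
     (\<exists>\<alpha>. gls_admissible \<alpha> f g a b \<and>
       I = - (LBINT x:{a<..<b}. weyl_deriv_left \<alpha> a f x *
                weyl_deriv_right (1 - \<alpha>) b (\<lambda>u. g u - g b) x))"

definition holder_on :: "real set \<Rightarrow> real \<Rightarrow> (real \<Rightarrow> real) \<Rightarrow> bool" where
  "holder_on S \<nu> f \<longleftrightarrow> (\<exists>L>0. \<forall>s\<in>S. \<forall>t\<in>S. \<bar>f t - f s\<bar> \<le> L * \<bar>t - s\<bar> powr \<nu>)"

definition delay_term ::
  "(real \<Rightarrow> real \<Rightarrow> real \<Rightarrow> real) \<Rightarrow> real \<Rightarrow> (real \<Rightarrow> real) \<Rightarrow> real \<Rightarrow> real" where
  "delay_term K r x t = (LBINT s:{-r..0}. K t s (x (t + s)))"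

definition delay_sde_solution ::
  "'a measure \<Rightarrow> real \<Rightarrow> (real \<Rightarrow> 'a \<Rightarrow> real) \<Rightarrow>
   (real \<Rightarrow> real \<Rightarrow> real \<Rightarrow> real) \<Rightarrow> (real \<Rightarrow> real \<Rightarrow> real \<Rightarrow> real) \<Rightarrow>
   (real \<Rightarrow> real \<Rightarrow> real \<Rightarrow> real) \<Rightarrow> real \<Rightarrow> real \<Rightarrow> (real \<Rightarrow> real) \<Rightarrow> (real \<Rightarrow> 'a \<Rightarrow> real) \<Rightarrow> bool" where
  "delay_sde_solution M H B b \<sigma> K r T \<phi> X \<longleftrightarrow>
     (\<forall>t\<in>{-r..T}. X t \<in> borel_measurable M) \<and>
     (AE \<omega> in M. \<exists>\<nu>>1 - H. holder_on {0..T} \<nu> (\<lambda>t. X t \<omega>)) \<and>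
     (AE \<omega> in M. \<forall>t\<in>{-r..0}. X t \<omega> = \<phi> t) \<and>
     (AE \<omega> in M. \<forall>t\<in>{0..T}. \<exists>I.
        has_gls_integral (\<lambda>s. \<sigma> s (X s \<omega>) (delay_term K r (\<lambda>u. X u \<omega>) s)) (\<lambda>s. B s \<omega>) 0 t I \<and>
        X t \<omega> = X 0 \<omega> + (LBINT s:{0..t}. b s (X s \<omega>) (delay_term K r (\<lambda>u. X u \<omega>) s)) + I)"

end

theory Submission
  imports Defs
begin

text \<open>The constant \<open>C\<close> may depend on \<open>\<omega>\<close>, so it is enough that almost every path of \<open>X\<close> is Hoelder
continuous of order \<open>H - \<rho>\<close> on \<open>[0,T]\<close>: the event \<open>\<Omega>'\<close> is the complement of a null set, and
the bound on \<open>\<bar>X t\<bar>\<close> is the increment bound with \<open>s = 0\<close>.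

Fix a path. It is Hoelder continuous of some order above \<open>1 - H\<close>, and so is the initial segment;
the Lipschitz conditions pass such an order \<open>\<nu> > 1 - H\<close> on to the delay term and to the integrands
\<open>s \<mapsto> b s (X s) (Y s)\<close> and \<open>\<gamma> s = \<sigma> s (X s) (Y s)\<close>. The drift integral is then Lipschitz in \<open>t\<close>, and
everything rests on the increments of the generalized Lebesgue--Stieltjes integral \<open>J t\<close> of \<open>\<gamma>\<close>
against \<open>B\<close> over \<open>[0,t]\<close>. Its definition shows neither additivity in \<open>t\<close> nor a bound for increments,
and the order \<open>\<alpha>\<close> of the fractional derivatives in it may change with \<open>t\<close>. Both defects disappear in
the representation (\<open>gls_integral_eq_lim\<close>)

  \<open>J t = lim\<^sub>n \<integral>\<^sub>0\<^sup>t \<gamma> s * n * (B (s + 1/n) - B s) ds\<close>,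

with \<open>B\<close> continued past \<open>T\<close> as a constant. The right-hand side is additive and free of \<open>\<alpha>\<close>. The
factor of \<open>\<gamma> s\<close> is the derivative of the Steklov average \<open>B\<^sub>n s = n * \<integral>\<^sub>s\<^bsup>s + 1/n\<^esup> B u du\<close>.
For the smooth integrator \<open>B\<^sub>n\<close> the representation is exact: the right derivative of order \<open>1 - \<alpha>\<close> is an Abel integral of the ordinary derivative
(\<open>weyl_deriv_right_differentiable\<close>), Fubini moves this Abel integral to the other factor, and there
it inverts the left derivative of \<open>\<gamma>\<close> (\<open>abel_left_deriv_eq\<close>). Letting \<open>n\<close> tend to infinity needs a
Hoelder order of \<open>B\<close>, uniform in the averages \<open>B\<^sub>n\<close>, that exceeds \<open>1 - \<alpha>\<close>; as the paths of \<open>B\<close> have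
every order below \<open>H\<close> (\<open>fbm_paths_holder\<close>, by Kolmogorov's moment criterion), it suffices that
\<open>\<alpha> > 1 - H\<close>. This holds almost surely: admissibility of \<open>\<alpha>\<close> makes the difference quotient
\<open>(B x - B y) / (y - x) powr (2 - \<alpha>)\<close> integrable in \<open>y\<close> for each \<open>x\<close>, whereas already the exponent
\<open>1 + H\<close> almost surely destroys integrability at every rational \<open>x\<close>
(\<open>fbm_difference_quotient_not_integrable\<close>).

Finally, the Young--Loeve estimate (\<open>young_loeve_bound\<close>), applied to the integrators \<open>B\<^sub>n\<close>, bounds
the increments of the approximating integrals by a multiple of \<open>(t - s) powr \<kappa>\<close>. The multiple depends
on \<open>T\<close>, on a bound for \<open>\<gamma>\<close> and on Hoelder constants, none of which changes with \<open>n\<close>,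
and \<open>\<kappa>\<close> is any order below \<open>H\<close> with \<open>\<nu> + \<kappa> > 1\<close>.
So \<open>J\<close> is Hoelder continuous of every order below \<open>H\<close>, and with it the path of \<open>X\<close>.\<close>

section \<open>Integrals of power kernels\<close>

lemma continuous_on_Icc_bounded:
  fixes h :: "real \<Rightarrow> real"
  assumes "continuous_on {a..b} h"
  obtains Q where "0 \<le> Q" "\<And>y. y \<in> {a..b} \<Longrightarrow> \<bar>h y\<bar> \<le> Q"
proof -
  have "compact (h ` {a..b})"
    using assms by (intro compact_continuous_image) auto
  then obtain Q where "\<And>y. y \<in> {a..b} \<Longrightarrow> \<bar>h y\<bar> \<le> Q"
    by (metis compact_imp_bounded bounded_real imageI)
  then have "0 \<le> \<bar>Q\<bar>" "\<And>y. y \<in> {a..b} \<Longrightarrow> \<bar>h y\<bar> \<le> \<bar>Q\<bar>" by force+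
  then show thesis by (rule that)
qed

text \<open>Power kernels are singular at an end point of the interval, where the primitive is continuous but
not differentiable; hence a form of the fundamental theorem that asks for derivatives in the
interior only.\<close>

lemma has_bochner_integral_FTC_Ioo:
  fixes P p :: "real \<Rightarrow> real"
  assumes "a \<le> b" "continuous_on {a..b} P"
    and deriv: "\<And>x. x \<in> {a<..<b} \<Longrightarrow> (P has_real_derivative p x) (at x)"
    and nonneg: "\<And>x. x \<in> {a<..<b} \<Longrightarrow> 0 \<le> p x"
    and [measurable]: "p \<in> borel_measurable borel"
  shows "has_bochner_integral lborel (\<lambda>x. indicator {a<..<b} x * p x) (P b - P a)"
proof -
  have "(p has_integral (P b - P a)) {a..b}"
    using assms(1,2) deriv
    by (intro fundamental_theorem_of_calculus_interior)
       (auto simp: has_real_derivative_iff_has_vector_derivative)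
  then have int: "(p has_integral (P b - P a)) {a<..<b}"
    by (simp add: has_integral_Icc_iff_Ioo)
  have "P b - P a \<ge> 0"
    using has_integral_nonneg[OF int] nonneg by auto
  moreover have "integral\<^sup>N lborel (\<lambda>x. indicator {a<..<b} x * p x) = P b - P a"
    using nn_integral_has_integral_lebesgue[OF _ int] nonneg by auto
  ultimately show ?thesis
    using nonneg by (intro has_bochner_integral_nn_integral) (auto simp: indicator_def)
qed

lemma powr_kernel_from_left:
  fixes x c \<gamma> :: real
  assumes "0 < \<gamma>" "x \<le> c"
  shows "has_bochner_integral lborel
           (\<lambda>y. indicator {x<..<c} y * (y - x) powr (\<gamma> - 1)) ((c - x) powr \<gamma> / \<gamma>)"
proof -
  have "has_bochner_integral lborel (\<lambda>y. indicator {x<..<c} y * (y - x) powr (\<gamma> - 1))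
     ((c - x) powr \<gamma> / \<gamma> - (x - x) powr \<gamma> / \<gamma>)"
    using assms
    by (intro has_bochner_integral_FTC_Ioo continuous_intros continuous_on_powr')
       (auto intro!: derivative_eq_intros simp: field_simps)
  then show ?thesis by simp
qed

lemma powr_kernel_from_right:
  fixes a y \<gamma> :: real
  assumes "0 < \<gamma>" "a \<le> y"
  shows "has_bochner_integral lborel
           (\<lambda>x. indicator {a<..<y} x * (y - x) powr (\<gamma> - 1)) ((y - a) powr \<gamma> / \<gamma>)"
proof -
  have "has_bochner_integral lborel (\<lambda>x. indicator {a<..<y} x * (y - x) powr (\<gamma> - 1))
     (- ((y - y) powr \<gamma> / \<gamma>) - (- ((y - a) powr \<gamma> / \<gamma>)))"
    using assms
    by (intro has_bochner_integral_FTC_Ioo continuous_intros continuous_on_powr')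
       (auto intro!: derivative_eq_intros simp: field_simps)
  then show ?thesis by simp
qed

lemma shifted_kernel_from_left:
  fixes y c \<alpha> e :: real
  assumes "0 < \<alpha>" "y \<le> c" "0 < e"
  shows "has_bochner_integral lborel
           (\<lambda>x. indicator {y<..<c} x * (\<alpha> * (x - y + e) powr (- \<alpha> - 1)))
           (e powr - \<alpha> - (c - y + e) powr - \<alpha>)"
proof -
  have "has_bochner_integral lborel (\<lambda>x. indicator {y<..<c} x * (\<alpha> * (x - y + e) powr (- \<alpha> - 1)))
     (- ((c - y + e) powr - \<alpha>) - (- ((y - y + e) powr - \<alpha>)))"
    using assms
    by (intro has_bochner_integral_FTC_Ioo continuous_intros)
       (auto intro!: derivative_eq_intros simp: field_simps)
  then show ?thesis by simp
qed

lemma shifted_kernel_from_right: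
  fixes x a \<alpha> e :: real
  assumes "0 < \<alpha>" "a \<le> x" "0 < e"
  shows "has_bochner_integral lborel
           (\<lambda>y. indicator {a<..<x} y * (\<alpha> * (x - y + e) powr (- \<alpha> - 1)))
           (e powr - \<alpha> - (x - a + e) powr - \<alpha>)"
proof -
  have "has_bochner_integral lborel (\<lambda>y. indicator {a<..<x} y * (\<alpha> * (x - y + e) powr (- \<alpha> - 1)))
     ((x - x + e) powr - \<alpha> - (x - a + e) powr - \<alpha>)"
    using assms
    by (intro has_bochner_integral_FTC_Ioo continuous_intros)
       (auto intro!: derivative_eq_intros simp: field_simps)
  then show ?thesis by simp
qed

lemma beta_kernel:
  fixes y c \<alpha> :: real
  assumes "0 < \<alpha>" "\<alpha> < 1" "y < c"
  shows "has_bochner_integral lborel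
           (\<lambda>u. indicator {y<..<c} u * ((c - u) powr (\<alpha> - 1) * (u - y) powr - \<alpha>))
           (Gamma \<alpha> * Gamma (1 - \<alpha>))"
proof -
  let ?f = "\<lambda>s::real. indicator {0<..<1} s * (s powr - \<alpha> * (1 - s) powr (\<alpha> - 1))"
  have "((\<lambda>s. s powr ((1 - \<alpha>) - 1) * (1 - s) powr (\<alpha> - 1)) has_integral Beta (1 - \<alpha>) \<alpha>) {0<..<1}"
    using has_integral_Beta_real[of "1 - \<alpha>" \<alpha>] assms by (simp add: has_integral_Icc_iff_Ioo)
  moreover have B: "Beta (1 - \<alpha>) \<alpha> = Gamma \<alpha> * Gamma (1 - \<alpha>)"
    by (simp add: Beta_def)
  ultimately have int: "((\<lambda>s. s powr - \<alpha> * (1 - s) powr (\<alpha> - 1)) has_integral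
      Gamma \<alpha> * Gamma (1 - \<alpha>)) {0<..<1}"
    by simp
  have "has_bochner_integral lborel ?f (Gamma \<alpha> * Gamma (1 - \<alpha>))"
    using nn_integral_has_integral_lebesgue[OF _ int] Gamma_real_pos[of \<alpha>] Gamma_real_pos[of "1 - \<alpha>"] assms
    by (intro has_bochner_integral_nn_integral) (auto simp: indicator_def)
  then have f: "integrable lborel ?f" "integral\<^sup>L lborel ?f = Gamma \<alpha> * Gamma (1 - \<alpha>)"
    by (auto simp: has_bochner_integral_iff)
  define d where "d = c - y"
  have d: "0 < d" using assms by (simp add: d_def)
  have eq: "?f (- y / d + (1 / d) * u) =
      d * (indicator {y<..<c} u * ((c - u) powr (\<alpha> - 1) * (u - y) powr - \<alpha>))" for u
  proof (cases "y < u \<and> u < c")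
    case True
    have "- y / d + (1 / d) * u = (u - y) / d" by (simp add: diff_divide_distrib)
    moreover have "1 - (u - y) / d = (c - u) / d"
      using d by (simp add: diff_divide_eq_iff field_simps) (simp add: d_def)
    moreover have "0 < (u - y) / d" "(u - y) / d < 1"
      using True d by (auto simp: d_def)
    moreover have "d powr \<alpha> * d powr (1 - \<alpha>) = d"
      using d by (simp flip: powr_add)
    ultimately show ?thesis using True d
      by (simp add: powr_divide powr_minus powr_diff field_simps)
  next
    case False
    then have "\<not> (0 < (u - y) / d \<and> (u - y) / d < 1)"
      using d by (auto simp: zero_less_divide_iff d_def)
    moreover have "- y / d + (1 / d) * u = (u - y) / d" by (simp add: diff_divide_distrib)
    ultimately show ?thesis using False by auto
  qed
  from lborel_integrable_real_affine[OF f(1), of "1 / d" "- y / d"]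
  have "integrable lborel (\<lambda>u. indicator {y<..<c} u * ((c - u) powr (\<alpha> - 1) * (u - y) powr - \<alpha>))"
    using d unfolding eq by simp
  moreover have "(\<integral>u. indicator {y<..<c} u * ((c - u) powr (\<alpha> - 1) * (u - y) powr - \<alpha>) \<partial>lborel)
      = Gamma \<alpha> * Gamma (1 - \<alpha>)"
    using lborel_integral_real_affine[of "1 / d" ?f "- y / d"] d f(2) unfolding eq by simp
  ultimately show ?thesis by (simp add: has_bochner_integral_iff)
qed

text \<open>The Tonelli criterion behind every exchange of integrals below: an integrable function times a
kernel of uniformly bounded mass.\<close>

lemma integrable_pair_bounded_kernel:
  fixes p :: "real \<Rightarrow> real" and \<kappa> :: "real \<Rightarrow> real \<Rightarrow> real"
  assumes p: "integrable lborel p"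
    and [measurable]: "case_prod \<kappa> \<in> borel_measurable (lborel \<Otimes>\<^sub>M lborel)"
    and \<kappa>: "\<And>x. integrable lborel (\<kappa> x)"
    and C: "\<And>x. (\<integral>y. \<bar>\<kappa> x y\<bar> \<partial>lborel) \<le> C"
  shows "integrable (lborel \<Otimes>\<^sub>M lborel) (\<lambda>(x, y). p x * \<kappa> x y)"
proof (rule lborel_pair.Fubini_integrable)
  have [measurable]: "p \<in> borel_measurable lborel" using p by simp
  show "(\<lambda>(x, y). p x * \<kappa> x y) \<in> borel_measurable (lborel \<Otimes>\<^sub>M lborel)" by measurable
  show "AE x in lborel. integrable lborel (\<lambda>y. case (x, y) of (x, y) \<Rightarrow> p x * \<kappa> x y)"
    using \<kappa> by auto
  show "integrable lborel (\<lambda>x. \<integral>y. norm (case (x, y) of (x, y) \<Rightarrow> p x * \<kappa> x y) \<partial>lborel)"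
  proof (rule Bochner_Integration.integrable_bound)
    show "integrable lborel (\<lambda>x. C * p x)" using p by simp
    show "(\<lambda>x. \<integral>y. norm (case (x, y) of (x, y) \<Rightarrow> p x * \<kappa> x y) \<partial>lborel) \<in> borel_measurable lborel"
      by measurable
    have "norm (\<integral>y. norm (p x * \<kappa> x y) \<partial>lborel) \<le> norm (C * p x)" for x
    proof -
      have "(\<integral>y. norm (p x * \<kappa> x y) \<partial>lborel) = \<bar>p x\<bar> * (\<integral>y. \<bar>\<kappa> x y\<bar> \<partial>lborel)"
        by (simp add: abs_mult)
      moreover have "0 \<le> (\<integral>y. \<bar>\<kappa> x y\<bar> \<partial>lborel)" by simp
      ultimately show ?thesis using C[of x]
        by (auto simp: abs_mult mult.commute[of _ "\<bar>p x\<bar>"] intro!: mult_left_mono)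
    qed
    then show "AE x in lborel. norm (\<integral>y. norm (case (x, y) of (x, y) \<Rightarrow> p x * \<kappa> x y) \<partial>lborel) \<le> norm (C * p x)"
      by simp
  qed
qed

text \<open>For the difference \<open>w\<close> of the two functions, the finite measures with densities \<open>w\<^sup>+\<close> and \<open>w\<^sup>-\<close>
agree on all half-lines and are therefore equal.\<close>

lemma AE_eq_of_interval_integrals:
  fixes u v :: "real \<Rightarrow> real"
  assumes u: "integrable lborel u" and v: "integrable lborel v"
    and eq: "\<And>c. (\<integral>x. indicator {c<..} x * u x \<partial>lborel) = (\<integral>x. indicator {c<..} x * v x \<partial>lborel)"
  shows "AE x in lborel. u x = v x"
proof -
  define w where "w x = u x - v x" for x
  have w: "integrable lborel w" unfolding w_def using u v by simp
  then have [measurable]: "w \<in> borel_measurable lborel" by simp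
  have fin: "(\<integral>\<^sup>+x. ennreal (s * w x) * indicator A x \<partial>lborel) < \<infinity>" if "\<bar>s\<bar> = 1" for s A
  proof -
    have "(\<integral>\<^sup>+x. ennreal (s * w x) * indicator A x \<partial>lborel) \<le> (\<integral>\<^sup>+x. ennreal (norm (w x)) \<partial>lborel)"
      using that by (intro nn_integral_mono) (auto simp: indicator_def abs_if split: if_splits intro!: ennreal_leI)
    also have "\<dots> < \<infinity>" using w by (simp add: integrable_iff_bounded)
    finally show ?thesis .
  qed
  have half: "(\<integral>\<^sup>+x. ennreal (w x) * indicator {c<..} x \<partial>lborel)
      = (\<integral>\<^sup>+x. ennreal (- w x) * indicator {c<..} x \<partial>lborel)" for c
  proof -
    let ?g = "\<lambda>x. indicator {c<..} x * w x"
    have int: "integrable lborel (\<lambda>x. indicator {c<..} x * u x)" "integrable lborel (\<lambda>x. indicator {c<..} x * v x)"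
      using integrable_mult_indicator[OF _ u, of "{c<..}"] integrable_mult_indicator[OF _ v, of "{c<..}"]
      by simp_all
    have g: "integrable lborel ?g"
      using integrable_mult_indicator[OF _ w, of "{c<..}"] by simp
    have "integral\<^sup>L lborel ?g = 0"
      using eq[of c] int by (simp add: w_def right_diff_distrib)
    then have "enn2real (\<integral>\<^sup>+x. ennreal (?g x) \<partial>lborel) = enn2real (\<integral>\<^sup>+x. ennreal (- ?g x) \<partial>lborel)"
      using real_lebesgue_integral_def[OF g] by simp
    moreover have P: "(\<integral>\<^sup>+x. ennreal (?g x) \<partial>lborel) = (\<integral>\<^sup>+x. ennreal (w x) * indicator {c<..} x \<partial>lborel)"
      and N: "(\<integral>\<^sup>+x. ennreal (- ?g x) \<partial>lborel) = (\<integral>\<^sup>+x. ennreal (- w x) * indicator {c<..} x \<partial>lborel)"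
      by (auto intro!: nn_integral_cong simp: indicator_def)
    ultimately have "ennreal (enn2real (\<integral>\<^sup>+x. ennreal (w x) * indicator {c<..} x \<partial>lborel))
      = ennreal (enn2real (\<integral>\<^sup>+x. ennreal (- w x) * indicator {c<..} x \<partial>lborel))"
      unfolding P N by simp
    moreover have "(\<integral>\<^sup>+x. ennreal (w x) * indicator {c<..} x \<partial>lborel) < top"
      and "(\<integral>\<^sup>+x. ennreal (- w x) * indicator {c<..} x \<partial>lborel) < top"
      using fin[of 1 "{c<..}"] fin[of "-1" "{c<..}"] by simp_all
    ultimately show ?thesis by (simp only: ennreal_enn2real)
  qed
  have "density lborel (\<lambda>x. ennreal (w x)) = density lborel (\<lambda>x. ennreal (- w x))"
    using half fin[of 1] fin[of "-1"] by (intro measure_eqI_lessThan) (auto simp: emeasure_density)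
  then have "AE x in lborel. ennreal (w x) = ennreal (- w x)"
    using fin[of 1 UNIV] by (subst (asm) finite_density_unique) (auto simp: less_top)
  then show ?thesis
  proof eventually_elim
    case (elim x)
    then have "w x = 0"
      by (cases "0 \<le> w x") (auto simp: ennreal_neg)
    then show ?case by (simp add: w_def)
  qed
qed

section \<open>Abel inversion of the left-sided fractional derivative\<close>

lemma powr_minus_one_minus: "z powr (- \<alpha> - 1) = 1 / z powr (1 + \<alpha>)" for z \<alpha> :: real
proof -
  have "- \<alpha> - 1 = - (1 + \<alpha>)" by simp
  then show ?thesis by (simp only: powr_minus_divide)
qed

lemma integrable_bounded_on_Ioo:
  fixes p :: "real \<Rightarrow> real"
  assumes [measurable]: "p \<in> borel_measurable borel" and "\<And>x. x \<in> {a<..<c} \<Longrightarrow> \<bar>p x\<bar> \<le> Q"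
  shows "integrable lborel (\<lambda>x. indicator {a<..<c} x * p x)"
proof (rule Bochner_Integration.integrable_bound)
  show "integrable lborel (\<lambda>x. Q * indicator {a<..<c} x :: real)"
    using emeasure_lborel_box_finite[of a c]
    by (intro integrable_mult_right integrable_real_indicator) auto
  have "norm (indicator {a<..<c} x * p x) \<le> norm (Q * indicator {a<..<c} x :: real)" for x
    using assms(2)[of x] by (auto simp: indicator_def)
  then show "AE x in lborel. norm (indicator {a<..<c} x * p x) \<le> norm (Q * indicator {a<..<c} x :: real)"
    by simp
qed measurable

text \<open>The two terms of \<open>f x - f y\<close> cannot be integrated separately against the kernel
\<open>(x - y) powr (- \<alpha> - 1)\<close>. Shifting the kernel by \<open>e > 0\<close> makes this possible. Both resulting terms
contain the divergent quantity \<open>e powr - \<alpha>\<close> times the integral of \<open>f\<close>, which cancels, so that the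
limit \<open>e \<longrightarrow> 0\<close> can be taken afterwards.\<close>

lemma regularised_difference_integral:
  fixes f :: "real \<Rightarrow> real"
  assumes \<alpha>: "0 < \<alpha>" "\<alpha> < 1" and ac: "a < c" and e: "0 < e"
    and [measurable]: "f \<in> borel_measurable borel" and bd: "\<And>x. \<bar>f x\<bar> \<le> Q"
  shows "(\<integral>p. (case p of (x, y) \<Rightarrow> indicator {(x, y). a < y \<and> y < x \<and> x < c} (x, y) *
              ((f x - f y) * (\<alpha> * (x - y + e) powr (- \<alpha> - 1)))) \<partial>(lborel \<Otimes>\<^sub>M lborel)) =
         (\<integral>y. indicator {a<..<c} y * (f y * (c - y + e) powr - \<alpha>) \<partial>lborel) -
         (\<integral>x. indicator {a<..<c} x * (f x * (x - a + e) powr - \<alpha>) \<partial>lborel)"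
proof -
  define k where "k x y = \<alpha> * (x - y + e) powr (- \<alpha> - 1)" for x y
  have [measurable]: "case_prod k \<in> borel_measurable (lborel \<Otimes>\<^sub>M lborel)"
    unfolding k_def by measurable
  define p where "p x = indicator {a<..<c} x * f x" for x
  have [measurable]: "p \<in> borel_measurable borel" unfolding p_def by measurable
  have p: "integrable lborel p"
    unfolding p_def using bd by (intro integrable_bounded_on_Ioo) auto
  have k_nonneg: "0 \<le> k x y" for x y using \<alpha> by (simp add: k_def)
  have kL: "has_bochner_integral lborel (\<lambda>y. indicator {a<..<x} y * k x y)
     (if a \<le> x then e powr - \<alpha> - (x - a + e) powr - \<alpha> else 0)" for x
    using shifted_kernel_from_right[of \<alpha> a x e] \<alpha> e by (auto simp: k_def has_bochner_integral_zero)
  have kR: "has_bochner_integral lborel (\<lambda>x. indicator {y<..<c} x * k x y)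
     (if y \<le> c then e powr - \<alpha> - (c - y + e) powr - \<alpha> else 0)" for y
    using shifted_kernel_from_left[of \<alpha> y c e] \<alpha> e by (auto simp: k_def has_bochner_integral_zero)
  have P: "integrable (lborel \<Otimes>\<^sub>M lborel) (\<lambda>(x, y). p x * (indicator {a<..<x} y * k x y))"
  proof (rule integrable_pair_bounded_kernel[OF p])
    show "(\<lambda>(x, y). indicator {a<..<x} y * k x y) \<in> borel_measurable (lborel \<Otimes>\<^sub>M lborel)"
      by (simp add: indicator_def of_bool_def) measurable
    fix x
    show "integrable lborel (\<lambda>y. indicator {a<..<x} y * k x y)"
      using kL by (simp add: has_bochner_integral_iff)
    show "(\<integral>y. \<bar>indicator {a<..<x} y * k x y\<bar> \<partial>lborel) \<le> e powr - \<alpha>"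
      using kL[of x] k_nonneg by (auto simp: has_bochner_integral_iff abs_mult)
  qed
  have R: "integrable (lborel \<Otimes>\<^sub>M lborel) (\<lambda>(y, x). p y * (indicator {y<..<c} x * k x y))"
  proof (rule integrable_pair_bounded_kernel[OF p])
    show "(\<lambda>(y, x). indicator {y<..<c} x * k x y) \<in> borel_measurable (lborel \<Otimes>\<^sub>M lborel)"
      by (simp add: indicator_def of_bool_def) measurable
    fix y
    show "integrable lborel (\<lambda>x. indicator {y<..<c} x * k x y)"
      using kR by (simp add: has_bochner_integral_iff)
    show "(\<integral>x. \<bar>indicator {y<..<c} x * k x y\<bar> \<partial>lborel) \<le> e powr - \<alpha>"
      using kR[of y] k_nonneg by (auto simp: has_bochner_integral_iff abs_mult)
  qed
  have R': "integrable (lborel \<Otimes>\<^sub>M lborel) (\<lambda>(x, y). p y * (indicator {y<..<c} x * k x y))"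
    using lborel_pair.integrable_product_swap[OF R] by (simp add: case_prod_beta')
  have k0: "integrable lborel (\<lambda>x. p x * e powr - \<alpha>)" using p by simp
  have pL: "integrable lborel (\<lambda>x. p x * (x - a + e) powr - \<alpha>)"
    unfolding p_def mult.assoc
  proof (rule integrable_bounded_on_Ioo)
    fix x assume "x \<in> {a<..<c}"
    then have "(x - a + e) powr - \<alpha> \<le> e powr - \<alpha>"
      using \<alpha> e by (intro powr_mono2') auto
    then show "\<bar>f x * (x - a + e) powr - \<alpha>\<bar> \<le> Q * e powr - \<alpha>"
      using bd[of x] by (auto simp: abs_mult intro!: mult_mono order_trans[OF abs_ge_zero bd])
  qed measurable
  have pR: "integrable lborel (\<lambda>x. p x * (c - x + e) powr - \<alpha>)"
    unfolding p_def mult.assoc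
  proof (rule integrable_bounded_on_Ioo)
    fix x assume "x \<in> {a<..<c}"
    then have "(c - x + e) powr - \<alpha> \<le> e powr - \<alpha>"
      using \<alpha> e by (intro powr_mono2') auto
    then show "\<bar>f x * (c - x + e) powr - \<alpha>\<bar> \<le> Q * e powr - \<alpha>"
      using bd[of x] by (auto simp: abs_mult intro!: mult_mono order_trans[OF abs_ge_zero bd])
  qed measurable
  have "(\<integral>p. (case p of (x, y) \<Rightarrow> indicator {(x, y). a < y \<and> y < x \<and> x < c} (x, y) *
              ((f x - f y) * k x y)) \<partial>(lborel \<Otimes>\<^sub>M lborel)) =
     (\<integral>z. (case z of (x, y) \<Rightarrow> p x * (indicator {a<..<x} y * k x y))
          - (case z of (x, y) \<Rightarrow> p y * (indicator {y<..<c} x * k x y)) \<partial>(lborel \<Otimes>\<^sub>M lborel))"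
    by (intro Bochner_Integration.integral_cong refl) (auto simp: p_def indicator_def algebra_simps)
  also have "\<dots> = (\<integral>z. (case z of (x, y) \<Rightarrow> p x * (indicator {a<..<x} y * k x y)) \<partial>(lborel \<Otimes>\<^sub>M lborel))
     - (\<integral>z. (case z of (x, y) \<Rightarrow> p y * (indicator {y<..<c} x * k x y)) \<partial>(lborel \<Otimes>\<^sub>M lborel))"
    using P R' by (rule Bochner_Integration.integral_diff)
  also have "(\<integral>z. (case z of (x, y) \<Rightarrow> p x * (indicator {a<..<x} y * k x y)) \<partial>(lborel \<Otimes>\<^sub>M lborel))
     = (\<integral>x. p x * (e powr - \<alpha> - (x - a + e) powr - \<alpha>) \<partial>lborel)"
    using kL by (subst lborel_pair.integral_fst[OF P, symmetric])
      (auto intro!: Bochner_Integration.integral_cong simp: p_def has_bochner_integral_iff)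
  also have "(\<integral>z. (case z of (x, y) \<Rightarrow> p y * (indicator {y<..<c} x * k x y)) \<partial>(lborel \<Otimes>\<^sub>M lborel))
     = (\<integral>y. p y * (e powr - \<alpha> - (c - y + e) powr - \<alpha>) \<partial>lborel)"
    using kR by (subst lborel_pair.integral_snd[OF R', symmetric])
      (auto intro!: Bochner_Integration.integral_cong simp: p_def has_bochner_integral_iff)
  finally show ?thesis
    using k0 pL pR unfolding right_diff_distrib by (simp add: k_def p_def mult.assoc)
qed

text \<open>The hypotheses that admissibility of the order \<open>\<alpha>\<close> puts on a bounded integrand \<open>f\<close>.\<close>

locale weyl_integrable =
  fixes \<alpha> a b Q :: real and f :: "real \<Rightarrow> real"
  assumes \<alpha>: "0 < \<alpha>" "\<alpha> < 1" and ab: "a < b"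
    and f_borel [measurable]: "f \<in> borel_measurable borel"
    and f_bound: "\<And>x. \<bar>f x\<bar> \<le> Q"
    and difference_integrable: "set_integrable (lborel \<Otimes>\<^sub>M lborel) {(x, y). a < y \<and> y < x \<and> x < b}
       (\<lambda>(x, y). (f x - f y) / (x - y) powr (1 + \<alpha>))"
begin

definition diff_quot :: "real \<Rightarrow> real \<Rightarrow> real" where
  "diff_quot x y = indicator {(x, y). a < y \<and> y < x \<and> x < b} (x, y) * ((f x - f y) / (x - y) powr (1 + \<alpha>))"

lemma integrable_diff_quot: "integrable (lborel \<Otimes>\<^sub>M lborel) (\<lambda>(x, y). diff_quot x y)"
  using difference_integrable by (simp add: set_integrable_def diff_quot_def case_prod_beta')

definition left_deriv :: "real \<Rightarrow> real" where
  "left_deriv x = indicator {a<..<b} x * weyl_deriv_left \<alpha> a f x"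

lemma left_deriv_eq:
  "left_deriv x = (indicator {a<..<b} x * (f x * (x - a) powr - \<alpha>) + \<alpha> * (\<integral>y. diff_quot x y \<partial>lborel)) / Gamma (1 - \<alpha>)"
proof (cases "x \<in> {a<..<b}")
  case True
  then have "(\<integral>y. diff_quot x y \<partial>lborel) = (LBINT y:{a<..<x}. (f x - f y) / (x - y) powr (1 + \<alpha>))"
    unfolding set_lebesgue_integral_def
    by (intro Bochner_Integration.integral_cong) (auto simp: diff_quot_def indicator_def)
  then show ?thesis using True
    by (simp add: left_deriv_def weyl_deriv_left_def powr_minus divide_inverse)
next
  case False
  then have "diff_quot x = (\<lambda>y. 0)" by (auto simp: diff_quot_def fun_eq_iff)
  then show ?thesis using False by (simp add: left_deriv_def)
qed

lemma integrable_f_kernel_left: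
  assumes "a \<le> c"
  shows "integrable lborel (\<lambda>x. indicator {a<..<c} x * (f x * (x - a) powr - \<alpha>))"
proof (rule Bochner_Integration.integrable_bound)
  show "integrable lborel (\<lambda>x. Q * (indicator {a<..<c} x * (x - a) powr ((1 - \<alpha>) - 1)))"
    using powr_kernel_from_left[of "1 - \<alpha>" a c] \<alpha> assms by (simp add: has_bochner_integral_iff)
  show "AE x in lborel. norm (indicator {a<..<c} x * (f x * (x - a) powr - \<alpha>))
      \<le> norm (Q * (indicator {a<..<c} x * (x - a) powr ((1 - \<alpha>) - 1)))"
    using f_bound by (auto simp: indicator_def abs_mult intro!: AE_I2 mult_right_mono order_trans[OF f_bound])
qed measurable

lemma integrable_f_kernel_right:
  assumes "a \<le> c"
  shows "integrable lborel (\<lambda>x. indicator {a<..<c} x * (f x * (c - x) powr - \<alpha>))"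
proof (rule Bochner_Integration.integrable_bound)
  show "integrable lborel (\<lambda>x. Q * (indicator {a<..<c} x * (c - x) powr ((1 - \<alpha>) - 1)))"
    using powr_kernel_from_right[of "1 - \<alpha>" a c] \<alpha> assms by (simp add: has_bochner_integral_iff)
  show "AE x in lborel. norm (indicator {a<..<c} x * (f x * (c - x) powr - \<alpha>))
      \<le> norm (Q * (indicator {a<..<c} x * (c - x) powr ((1 - \<alpha>) - 1)))"
    using f_bound by (auto simp: indicator_def abs_mult intro!: AE_I2 mult_right_mono order_trans[OF f_bound])
qed measurable

lemma integrable_left_deriv: "integrable lborel left_deriv"
  unfolding left_deriv_eq[abs_def]
  using lborel_pair.integrable_fst[OF integrable_diff_quot] integrable_f_kernel_left[of b] ab
  by (intro integrable_divide Bochner_Integration.integrable_add) auto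

text \<open>The limit of \<open>regularised_difference_integral\<close>. The shifted kernels increase to the singular one,
so the integrable functions \<open>\<alpha> * diff_quot\<close> and \<open>f\<close> times a singular kernel serve as majorants.\<close>

lemma difference_double_integral:
  assumes c: "a < c" "c \<le> b"
  shows "\<alpha> * (\<integral>x. indicator {a<..<c} x * (\<integral>y. diff_quot x y \<partial>lborel) \<partial>lborel) =
    (\<integral>x. indicator {a<..<c} x * (f x * (c - x) powr - \<alpha>) \<partial>lborel) -
    (\<integral>x. indicator {a<..<c} x * (f x * (x - a) powr - \<alpha>) \<partial>lborel)"
proof -
  let ?M = "lborel \<Otimes>\<^sub>M lborel :: (real \<times> real) measure"
  define D where "D = {(x, y). a < y \<and> y < x \<and> x < c}"
  define e where "e n = 1 / real (Suc n)" for n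
  have e_pos: "0 < e n" for n by (simp add: e_def)
  have e_lim: "e \<longlonglongrightarrow> 0" unfolding e_def by (rule LIMSEQ_Suc[OF lim_1_over_n])
  define V where "V n = (\<lambda>(x, y). indicator D (x, y) * ((f x - f y) * (\<alpha> * (x - y + e n) powr (- \<alpha> - 1))))" for n
  define V0 where "V0 = (\<lambda>(x, y). \<alpha> * (indicator {a<..<c} x * diff_quot x y))"
  have [measurable]: "D \<in> sets ?M" 
  proof -
    have "D = {z \<in> space ?M. a < snd z \<and> snd z < fst z \<and> fst z < c}"
      by (auto simp: D_def space_pair_measure)
    also have "\<dots> \<in> sets ?M" by measurable
    finally show ?thesis .
  qed
  have V0: "integrable ?M V0"
  proof -
    have "integrable ?M (\<lambda>z. \<alpha> * (indicator ({a<..<c} \<times> UNIV) z *\<^sub>R (case z of (x, y) \<Rightarrow> diff_quot x y)))"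
      using integrable_diff_quot by (intro integrable_mult_right integrable_mult_indicator) auto
    then show ?thesis by (rule Bochner_Integration.integrable_cong[THEN iffD1, rotated -1])
       (auto simp: V0_def indicator_def)
  qed
  have "(\<lambda>n. integral\<^sup>L ?M (V n)) \<longlonglongrightarrow> integral\<^sup>L ?M V0"
  proof (rule integral_dominated_convergence)
    show "V0 \<in> borel_measurable ?M" using V0 by simp
    show "V n \<in> borel_measurable ?M" for n unfolding V_def by measurable
    show "integrable ?M (\<lambda>z. norm (V0 z))" using V0 by simp
    show "AE z in ?M. (\<lambda>n. V n z) \<longlonglongrightarrow> V0 z"
    proof (intro AE_I2)
      fix z :: "real \<times> real"
      obtain x y where z: "z = (x, y)" by force
      show "(\<lambda>n. V n z) \<longlonglongrightarrow> V0 z"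
      proof (cases "(x, y) \<in> D")
        case True
        have "(\<lambda>n. (f x - f y) * (\<alpha> * (x - y + e n) powr (- \<alpha> - 1))) \<longlonglongrightarrow>
            (f x - f y) * (\<alpha> * (x - y + 0) powr (- \<alpha> - 1))"
          using True by (intro tendsto_intros e_lim) (auto simp: D_def)
        moreover have "(x - y) powr (- \<alpha> - 1) = 1 / (x - y) powr (1 + \<alpha>)"
          by (rule powr_minus_one_minus)
        ultimately show ?thesis using True c
          by (simp add: z V_def V0_def diff_quot_def D_def mult.commute)
      next
        case False
        then show ?thesis by (auto simp: z V_def V0_def diff_quot_def D_def indicator_def)
      qed
    qed
    show "AE z in ?M. norm (V n z) \<le> norm (V0 z)" for n
    proof (intro AE_I2)
      fix z :: "real \<times> real"
      obtain x y where z: "z = (x, y)" by force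
      show "norm (V n z) \<le> norm (V0 z)"
      proof (cases "(x, y) \<in> D")
        case True
        then have "(x - y + e n) powr (- \<alpha> - 1) \<le> (x - y) powr (- \<alpha> - 1)"
          using \<alpha> e_pos[of n] by (intro powr_mono2') (auto simp: D_def)
        moreover have "(x - y) powr (- \<alpha> - 1) = 1 / (x - y) powr (1 + \<alpha>)"
          by (rule powr_minus_one_minus)
        ultimately have "\<bar>f x - f y\<bar> * (\<alpha> * (x - y + e n) powr (- \<alpha> - 1)) \<le>
            \<bar>f x - f y\<bar> * (\<alpha> * (1 / (x - y) powr (1 + \<alpha>)))"
          using \<alpha> by (intro mult_left_mono) auto
        then show ?thesis using True c \<alpha>
          by (simp add: z V_def V0_def diff_quot_def D_def abs_mult mult_ac)
      next
        case False
        then show ?thesis by (simp add: z V_def)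
      qed
    qed
  qed
  also have "(\<lambda>n. integral\<^sup>L ?M (V n)) = (\<lambda>n.
      (\<integral>y. indicator {a<..<c} y * (f y * (c - y + e n) powr - \<alpha>) \<partial>lborel) -
      (\<integral>x. indicator {a<..<c} x * (f x * (x - a + e n) powr - \<alpha>) \<partial>lborel))"
    unfolding V_def D_def
    by (rule ext, rule regularised_difference_integral[OF \<alpha> c(1) e_pos f_borel f_bound])
  finally have lim: "(\<lambda>n. (\<integral>y. indicator {a<..<c} y * (f y * (c - y + e n) powr - \<alpha>) \<partial>lborel) -
      (\<integral>x. indicator {a<..<c} x * (f x * (x - a + e n) powr - \<alpha>) \<partial>lborel)) \<longlonglongrightarrow> integral\<^sup>L ?M V0" .
  have limk: "(\<lambda>n. \<integral>y. indicator {a<..<c} y * (f y * (d y + e n) powr - \<alpha>) \<partial>lborel) \<longlonglongrightarrow>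
      (\<integral>y. indicator {a<..<c} y * (f y * d y powr - \<alpha>) \<partial>lborel)"
    if d: "\<And>y. y \<in> {a<..<c} \<Longrightarrow> 0 < d y" "d \<in> borel_measurable borel"
      and int: "integrable lborel (\<lambda>y. indicator {a<..<c} y * (f y * d y powr - \<alpha>))" for d
  proof (rule integral_dominated_convergence)
    have [measurable]: "d \<in> borel_measurable borel" by fact
    show "integrable lborel (\<lambda>y. norm (indicator {a<..<c} y * (f y * d y powr - \<alpha>)))"
      using int by (rule integrable_norm)
    show "AE y in lborel. (\<lambda>n. indicator {a<..<c} y * (f y * (d y + e n) powr - \<alpha>)) \<longlonglongrightarrow>
        indicator {a<..<c} y * (f y * d y powr - \<alpha>)"
    proof (intro AE_I2)
      fix y
      have "y \<in> {a<..<c} \<Longrightarrow> (\<lambda>n. f y * (d y + e n) powr - \<alpha>) \<longlonglongrightarrow> f y * (d y + 0) powr - \<alpha>"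
        using d(1)[of y] by (intro tendsto_intros e_lim) auto
      then show "(\<lambda>n. indicator {a<..<c} y * (f y * (d y + e n) powr - \<alpha>)) \<longlonglongrightarrow>
        indicator {a<..<c} y * (f y * d y powr - \<alpha>)"
        by (auto simp: indicator_def)
    qed
    show "AE y in lborel. norm (indicator {a<..<c} y * (f y * (d y + e n) powr - \<alpha>))
      \<le> norm (indicator {a<..<c} y * (f y * d y powr - \<alpha>))" for n
    proof (intro AE_I2)
      fix y
      have "y \<in> {a<..<c} \<Longrightarrow> (d y + e n) powr - \<alpha> \<le> d y powr - \<alpha>"
        using d(1)[of y] \<alpha> e_pos[of n] by (intro powr_mono2') auto
      then show "norm (indicator {a<..<c} y * (f y * (d y + e n) powr - \<alpha>))
        \<le> norm (indicator {a<..<c} y * (f y * d y powr - \<alpha>))"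
        by (auto simp: indicator_def abs_mult intro!: mult_left_mono)
    qed
  qed (use that in measurable)
  have "integral\<^sup>L ?M V0 = (\<integral>y. indicator {a<..<c} y * (f y * (c - y) powr - \<alpha>) \<partial>lborel) -
      (\<integral>x. indicator {a<..<c} x * (f x * (x - a) powr - \<alpha>) \<partial>lborel)"
    using c integrable_f_kernel_left[of c] integrable_f_kernel_right[of c]
    by (intro LIMSEQ_unique[OF lim] tendsto_diff limk) auto
  moreover have "integral\<^sup>L ?M V0 = \<alpha> * (\<integral>x. indicator {a<..<c} x * (\<integral>y. diff_quot x y \<partial>lborel) \<partial>lborel)"
    using lborel_pair.integral_fst'[OF V0] by (simp add: V0_def)
  ultimately show ?thesis by simp
qed

text \<open>The term of the left derivative that contains \<open>(x - a) powr - \<alpha>\<close> cancels against the one in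
\<open>difference_double_integral\<close>: the indefinite integral of the left derivative is the fractional
integral of \<open>f\<close> of order \<open>1 - \<alpha>\<close>.\<close>

lemma integral_left_deriv:
  assumes c: "a < c" "c \<le> b"
  shows "(\<integral>x. indicator {a<..<c} x * left_deriv x \<partial>lborel) =
    (\<integral>x. indicator {a<..<c} x * (f x * (c - x) powr - \<alpha>) \<partial>lborel) / Gamma (1 - \<alpha>)"
proof -
  have "indicator {a<..<c} x * left_deriv x = (indicator {a<..<c} x * (f x * (x - a) powr - \<alpha>) +
      \<alpha> * (indicator {a<..<c} x * (\<integral>y. diff_quot x y \<partial>lborel))) / Gamma (1 - \<alpha>)" for x
    using c by (auto simp: left_deriv_eq indicator_def)
  moreover have "integrable lborel (\<lambda>x. indicator {a<..<c} x * (\<integral>y. diff_quot x y \<partial>lborel))"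
    using integrable_mult_indicator[OF _ lborel_pair.integrable_fst[OF integrable_diff_quot], of "{a<..<c}"] by simp
  ultimately show ?thesis
    using integrable_f_kernel_left[of c] c difference_double_integral[OF c] by simp
qed

end

lemma AE_eq_on_Ioo:
  fixes u v :: "real \<Rightarrow> real"
  assumes u: "integrable lborel u" and v: "integrable lborel v"
    and out: "\<And>x. x \<notin> {a<..<b} \<Longrightarrow> u x = 0" "\<And>x. x \<notin> {a<..<b} \<Longrightarrow> v x = 0"
    and eq: "\<And>c. a < c \<Longrightarrow> c \<le> b \<Longrightarrow>
      (\<integral>x. indicator {a<..<c} x * u x \<partial>lborel) = (\<integral>x. indicator {a<..<c} x * v x \<partial>lborel)"
  shows "AE x in lborel. u x = v x"
proof (rule AE_eq_of_interval_integrals[OF u v])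
  fix c
  have tail: "(\<integral>x. indicator {c<..} x * w x \<partial>lborel) =
      (\<integral>x. indicator {a<..<b} x * w x \<partial>lborel) - (\<integral>x. indicator {a<..<c} x * w x \<partial>lborel)"
    if "a < c" "c < b" "integrable lborel w" "\<And>x. x \<notin> {a<..<b} \<Longrightarrow> w x = 0" for w :: "real \<Rightarrow> real"
  proof -
    have int: "integrable lborel (\<lambda>x. indicator {a<..<d} x * w x)" for d
      using integrable_mult_indicator[OF _ that(3), of "{a<..<d}"] by simp
    have "AE x in lborel. indicator {c<..} x * w x =
        indicator {a<..<b} x * w x - indicator {a<..<c} x * w x"
      using AE_lborel_singleton[of c]
    proof eventually_elim
      case (elim x)
      then show ?case using that(1,2) that(4)[of x] by (auto simp: indicator_def)
    qed
    then have "(\<integral>x. indicator {c<..} x * w x \<partial>lborel) =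
        (\<integral>x. indicator {a<..<b} x * w x - indicator {a<..<c} x * w x \<partial>lborel)"
      using that(3) by (intro integral_cong_AE) auto
    then show ?thesis using int by simp
  qed
  have all: "(\<integral>x. indicator {c<..} x * w x \<partial>lborel) = (\<integral>x. indicator {a<..<b} x * w x \<partial>lborel)"
    if "c \<le> a" "\<And>x. x \<notin> {a<..<b} \<Longrightarrow> w x = 0" for w :: "real \<Rightarrow> real"
    using that by (intro Bochner_Integration.integral_cong refl) (auto simp: indicator_def)
  have none: "(\<integral>x. indicator {c<..} x * w x \<partial>lborel) = 0"
    if "b \<le> c" "\<And>x. x \<notin> {a<..<b} \<Longrightarrow> w x = 0" for w :: "real \<Rightarrow> real"
    using that by (intro integral_eq_zero_AE AE_I2) (auto simp: indicator_def)
  consider "b \<le> c" | "c < b" "c \<le> a" | "c < b" "a < c" by linarith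
  then show "(\<integral>x. indicator {c<..} x * u x \<partial>lborel) = (\<integral>x. indicator {c<..} x * v x \<partial>lborel)"
  proof cases
    case 1
    then show ?thesis using none out by auto
  next
    case 2
    then show ?thesis using all out eq[of b] by (cases "a < b") (auto simp: not_less)
  next
    case 3
    then show ?thesis using tail u v out eq[of b] eq[of c] by auto
  qed
qed

lemma measurable_indicator_Ioo_pair [measurable]:
  fixes l u h :: "'a \<Rightarrow> real"
  assumes [measurable]: "l \<in> borel_measurable M" "u \<in> borel_measurable M" "h \<in> borel_measurable M"
  shows "(\<lambda>z. indicator {l z<..<u z} (h z) :: real) \<in> borel_measurable M"
proof -
  have "(\<lambda>z. indicator {l z<..<u z} (h z) :: real) = (\<lambda>z. if l z < h z \<and> h z < u z then 1 else 0)"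
    by (auto simp: indicator_def)
  also have "\<dots> \<in> borel_measurable M" by measurable
  finally show ?thesis .
qed

context weyl_integrable
begin

definition abel_kernel :: "real \<Rightarrow> real \<Rightarrow> real" where
  "abel_kernel x y = indicator {a<..<b} x * (indicator {x<..<b} y * (y - x) powr (\<alpha> - 1))"

text \<open>Up to the factor \<open>Gamma \<alpha>\<close>, the fractional integral of order \<open>\<alpha>\<close> of the left derivative.\<close>

definition abel_left_deriv :: "real \<Rightarrow> real" where
  "abel_left_deriv y = (\<integral>x. left_deriv x * abel_kernel x y \<partial>lborel)"

lemma abel_kernel_measurable [measurable]:
  "case_prod abel_kernel \<in> borel_measurable (lborel \<Otimes>\<^sub>M lborel)"
  unfolding abel_kernel_def[abs_def] case_prod_beta' by measurable

lemma integrable_left_deriv_abel_kernel: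
  "integrable (lborel \<Otimes>\<^sub>M lborel) (\<lambda>(x, y). left_deriv x * abel_kernel x y)"
proof (rule integrable_pair_bounded_kernel[OF integrable_left_deriv abel_kernel_measurable])
  fix x
  have k: "has_bochner_integral lborel (\<lambda>y. indicator {x<..<b} y * (y - x) powr (\<alpha> - 1)) ((b - x) powr \<alpha> / \<alpha>)"
    if "a < x" "x < b" using powr_kernel_from_left[of \<alpha> x b] that \<alpha> by simp
  then show "integrable lborel (abel_kernel x)"
    unfolding abel_kernel_def[abs_def] by (cases "x \<in> {a<..<b}") (auto simp: has_bochner_integral_iff)
  show "(\<integral>y. \<bar>abel_kernel x y\<bar> \<partial>lborel) \<le> (b - a) powr \<alpha> / \<alpha>"
  proof (cases "x \<in> {a<..<b}")
    case True
    then have "(\<integral>y. \<bar>abel_kernel x y\<bar> \<partial>lborel) = (b - x) powr \<alpha> / \<alpha>"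
      using k by (simp add: abel_kernel_def abs_mult has_bochner_integral_iff)
    also have "\<dots> \<le> (b - a) powr \<alpha> / \<alpha>"
      using True \<alpha> by (intro divide_right_mono powr_mono2) auto
    finally show ?thesis .
  next
    case False
    then show ?thesis using \<alpha> by (simp add: abel_kernel_def)
  qed
qed

lemma integral_abel_left_deriv:
  assumes c: "a < c" "c \<le> b"
  shows "(\<integral>y. indicator {a<..<c} y * abel_left_deriv y \<partial>lborel) =
    (\<integral>x. indicator {a<..<c} x * left_deriv x * ((c - x) powr \<alpha> / \<alpha>) \<partial>lborel)"
proof -
  have "integrable (lborel \<Otimes>\<^sub>M lborel) (\<lambda>z. indicator (UNIV \<times> {a<..<c}) z *\<^sub>R (case z of (x, y) \<Rightarrow> left_deriv x * abel_kernel x y))"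
    by (intro integrable_mult_indicator integrable_left_deriv_abel_kernel) auto
  then have int: "integrable (lborel \<Otimes>\<^sub>M lborel) (\<lambda>(x, y). indicator {a<..<c} y * (left_deriv x * abel_kernel x y))"
    by (rule Bochner_Integration.integrable_cong[THEN iffD1, rotated -1]) (auto simp: indicator_def)
  have "(\<integral>y. indicator {a<..<c} y * abel_left_deriv y \<partial>lborel) = (\<integral>y. (\<integral>x. indicator {a<..<c} y * (left_deriv x * abel_kernel x y) \<partial>lborel) \<partial>lborel)"
    by (simp add: abel_left_deriv_def)
  also have "\<dots> = (\<integral>x. (\<integral>y. indicator {a<..<c} y * (left_deriv x * abel_kernel x y) \<partial>lborel) \<partial>lborel)"
    by (rule lborel_pair.Fubini_integral[OF int])
  also have "\<dots> = (\<integral>x. indicator {a<..<c} x * left_deriv x * ((c - x) powr \<alpha> / \<alpha>) \<partial>lborel)"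
  proof (intro Bochner_Integration.integral_cong refl)
    fix x
    show "(\<integral>y. indicator {a<..<c} y * (left_deriv x * abel_kernel x y) \<partial>lborel) = indicator {a<..<c} x * left_deriv x * ((c - x) powr \<alpha> / \<alpha>)"
    proof (cases "x \<in> {a<..<c}")
      case True
      then have "(\<integral>y. indicator {a<..<c} y * (left_deriv x * abel_kernel x y) \<partial>lborel)
         = (\<integral>y. left_deriv x * (indicator {x<..<c} y * (y - x) powr (\<alpha> - 1)) \<partial>lborel)"
        using c by (intro Bochner_Integration.integral_cong refl) (auto simp: abel_kernel_def indicator_def)
      also have "\<dots> = left_deriv x * ((c - x) powr \<alpha> / \<alpha>)"
        using powr_kernel_from_left[of \<alpha> x c] True \<alpha> by (simp add: has_bochner_integral_iff)
      finally show ?thesis using True by simp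
    next
      case False
      then have "indicator {a<..<c} y * (left_deriv x * abel_kernel x y) = 0" for y
        using c by (auto simp: abel_kernel_def indicator_def)
      then have "(\<integral>y. indicator {a<..<c} y * (left_deriv x * abel_kernel x y) \<partial>lborel) = (\<integral>y. 0 \<partial>(lborel :: real measure))"
        by (intro Bochner_Integration.integral_cong refl)
      then show ?thesis using False by simp
    qed
  qed
  finally show ?thesis .
qed

text \<open>Write \<open>(c - x) powr \<alpha> / \<alpha>\<close> as the integral of \<open>(c - u) powr (\<alpha> - 1)\<close> over \<open>u\<close> from \<open>x\<close> to \<open>c\<close> and
exchange the integrals: the indefinite integral of the left derivative appears, that is, a
fractional integral of \<open>f\<close> of order \<open>1 - \<alpha>\<close>. A second exchange leaves a Beta integral, since the
orders \<open>\<alpha>\<close> and \<open>1 - \<alpha>\<close> add up to one.\<close>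

lemma integral_left_deriv_powr:
  assumes c: "a < c" "c \<le> b"
  shows "(\<integral>x. indicator {a<..<c} x * left_deriv x * ((c - x) powr \<alpha> / \<alpha>) \<partial>lborel) =
    Gamma \<alpha> * (\<integral>y. indicator {a<..<c} y * f y \<partial>lborel)"
proof -
  define q where "q u = indicator {a<..<c} u * (c - u) powr (\<alpha> - 1)" for u
  have [measurable]: "q \<in> borel_measurable borel" unfolding q_def by measurable
  have q: "integrable lborel q"
    unfolding q_def using powr_kernel_from_right[of \<alpha> a c] c \<alpha> by (simp add: has_bochner_integral_iff)
  have qx: "has_bochner_integral lborel (\<lambda>u. indicator {x<..<c} u * (c - u) powr (\<alpha> - 1)) ((c - x) powr \<alpha> / \<alpha>)"
    if "x \<le> c" for x using powr_kernel_from_right[of \<alpha> x c] that \<alpha> by simp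
  define k where "k x u = indicator {a<..<c} x * (indicator {x<..<c} u * (c - u) powr (\<alpha> - 1))" for x u
  have kq: "k x u = indicator {a<..<u} x * q u" for x u
    by (auto simp: k_def q_def indicator_def)
  have int: "integrable (lborel \<Otimes>\<^sub>M lborel) (\<lambda>(x, u). left_deriv x * k x u)"
  proof (rule integrable_pair_bounded_kernel[OF integrable_left_deriv])
    show "case_prod k \<in> borel_measurable (lborel \<Otimes>\<^sub>M lborel)"
      unfolding k_def[abs_def] case_prod_beta' by measurable
    fix x
    show "integrable lborel (k x)"
      unfolding k_def[abs_def] using qx[of x] by (cases "x \<in> {a<..<c}") (auto simp: has_bochner_integral_iff)
    have "(\<integral>u. \<bar>k x u\<bar> \<partial>lborel) \<le> (\<integral>u. q u \<partial>lborel)"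
      by (intro integral_mono' q) (auto simp: k_def q_def indicator_def)
    then show "(\<integral>u. \<bar>k x u\<bar> \<partial>lborel) \<le> (\<integral>u. q u \<partial>lborel)" .
  qed
  define l where "l u y = indicator {a<..<c} u * (indicator {a<..<u} y * (f y * (u - y) powr - \<alpha>))" for u y
  have int2: "integrable (lborel \<Otimes>\<^sub>M lborel) (\<lambda>(u, y). q u * l u y)"
  proof (rule integrable_pair_bounded_kernel[OF q])
    show "case_prod l \<in> borel_measurable (lborel \<Otimes>\<^sub>M lborel)"
      unfolding l_def[abs_def] case_prod_beta' by measurable
    fix u
    show "integrable lborel (l u)"
      unfolding l_def[abs_def] using integrable_f_kernel_right[of u] by (cases "u \<in> {a<..<c}") auto
    have Q: "0 \<le> Q" using f_bound[of 0] by linarith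
    show "(\<integral>y. \<bar>l u y\<bar> \<partial>lborel) \<le> Q * ((c - a) powr (1 - \<alpha>) / (1 - \<alpha>))"
    proof (cases "u \<in> {a<..<c}")
      case True
      have k: "has_bochner_integral lborel (\<lambda>y. indicator {a<..<u} y * (u - y) powr - \<alpha>) ((u - a) powr (1 - \<alpha>) / (1 - \<alpha>))"
        using powr_kernel_from_right[of "1 - \<alpha>" a u] True \<alpha> by simp
      then have "(\<integral>y. \<bar>l u y\<bar> \<partial>lborel) \<le> (\<integral>y. Q * (indicator {a<..<u} y * (u - y) powr - \<alpha>) \<partial>lborel)"
        using Q True f_bound by (intro integral_mono') (auto simp: has_bochner_integral_iff l_def indicator_def abs_mult mult_right_mono)
      also have "\<dots> = Q * ((u - a) powr (1 - \<alpha>) / (1 - \<alpha>))"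
        using k by (simp add: has_bochner_integral_iff)
      also have "\<dots> \<le> Q * ((c - a) powr (1 - \<alpha>) / (1 - \<alpha>))"
        using Q True \<alpha> by (intro mult_left_mono divide_right_mono powr_mono2) auto
      finally show ?thesis .
    next
      case False
      then show ?thesis using Q \<alpha> by (simp add: l_def)
    qed
  qed
  have "(\<integral>x. indicator {a<..<c} x * left_deriv x * ((c - x) powr \<alpha> / \<alpha>) \<partial>lborel) = (\<integral>x. (\<integral>u. left_deriv x * k x u \<partial>lborel) \<partial>lborel)"
  proof (intro Bochner_Integration.integral_cong refl)
    fix x show "indicator {a<..<c} x * left_deriv x * ((c - x) powr \<alpha> / \<alpha>) = (\<integral>u. left_deriv x * k x u \<partial>lborel)"
      using qx[of x] by (cases "x \<in> {a<..<c}") (auto simp: k_def has_bochner_integral_iff)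
  qed
  also have "\<dots> = (\<integral>u. (\<integral>x. left_deriv x * k x u \<partial>lborel) \<partial>lborel)"
    by (rule lborel_pair.Fubini_integral[OF int, symmetric])
  also have "\<dots> = (\<integral>u. (\<integral>y. q u * l u y \<partial>lborel) / Gamma (1 - \<alpha>) \<partial>lborel)"
  proof (intro Bochner_Integration.integral_cong refl)
    fix u
    have "(\<integral>x. left_deriv x * k x u \<partial>lborel) = (\<integral>x. indicator {a<..<u} x * left_deriv x \<partial>lborel) * q u"
      by (simp add: kq mult_ac)
    also have "\<dots> = (\<integral>y. q u * l u y \<partial>lborel) / Gamma (1 - \<alpha>)"
    proof (cases "u \<in> {a<..<c}")
      case True
      then show ?thesis using integral_left_deriv[of u] c by (simp add: l_def)
    next
      case False
      then show ?thesis by (simp add: q_def)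
    qed
    finally show "(\<integral>x. left_deriv x * k x u \<partial>lborel) = (\<integral>y. q u * l u y \<partial>lborel) / Gamma (1 - \<alpha>)" .
  qed
  also have "\<dots> = (\<integral>u. (\<integral>y. q u * l u y \<partial>lborel) \<partial>lborel) / Gamma (1 - \<alpha>)"
    by simp
  also have "(\<integral>u. (\<integral>y. q u * l u y \<partial>lborel) \<partial>lborel) = (\<integral>y. (\<integral>u. q u * l u y \<partial>lborel) \<partial>lborel)"
    by (rule lborel_pair.Fubini_integral[OF int2, symmetric])
  also have "\<dots> = (\<integral>y. Gamma \<alpha> * Gamma (1 - \<alpha>) * (indicator {a<..<c} y * f y) \<partial>lborel)"
  proof (intro Bochner_Integration.integral_cong refl)
    fix y
    show "(\<integral>u. q u * l u y \<partial>lborel) = Gamma \<alpha> * Gamma (1 - \<alpha>) * (indicator {a<..<c} y * f y)"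
    proof (cases "y \<in> {a<..<c}")
      case True
      then have "(\<integral>u. q u * l u y \<partial>lborel) =
          (\<integral>u. f y * (indicator {y<..<c} u * ((c - u) powr (\<alpha> - 1) * (u - y) powr - \<alpha>)) \<partial>lborel)"
        by (intro Bochner_Integration.integral_cong refl) (auto simp: q_def l_def indicator_def)
      then show ?thesis
        using beta_kernel[OF \<alpha>, of y c] True by (simp add: has_bochner_integral_iff)
    next
      case False
      then have "q u * l u y = 0" for u by (auto simp: q_def l_def indicator_def)
      then have "(\<integral>u. q u * l u y \<partial>lborel) = (\<integral>u. 0 \<partial>(lborel :: real measure))"
        by (intro Bochner_Integration.integral_cong refl)
      then show ?thesis using False by simp
    qed
  qed
  also have "\<dots> / Gamma (1 - \<alpha>) = Gamma \<alpha> * (\<integral>y. indicator {a<..<c} y * f y \<partial>lborel)"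
    using less_imp_neq[OF Gamma_real_pos[of "1 - \<alpha>"]] \<alpha> by simp
  finally show ?thesis .
qed

text \<open>Abel inversion: the fractional integral of order \<open>\<alpha>\<close> undoes the left derivative. Both sides have
the same indefinite integral by \<open>integral_abel_left_deriv\<close> and \<open>integral_left_deriv_powr\<close>.\<close>

lemma abel_left_deriv_eq: "AE y in lborel. abel_left_deriv y = Gamma \<alpha> * (indicator {a<..<b} y * f y)"
proof (rule AE_eq_on_Ioo[where a = a and b = b])
  show "integrable lborel abel_left_deriv"
    unfolding abel_left_deriv_def[abs_def] by (rule lborel_pair.integrable_snd[OF integrable_left_deriv_abel_kernel])
  show "integrable lborel (\<lambda>y. Gamma \<alpha> * (indicator {a<..<b} y * f y))"
    using f_bound by (intro integrable_mult_right integrable_bounded_on_Ioo) auto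
  show "abel_left_deriv y = 0" if "y \<notin> {a<..<b}" for y
  proof -
    have "abel_kernel x y = 0" for x using that by (auto simp: abel_kernel_def indicator_def)
    then show ?thesis by (simp add: abel_left_deriv_def)
  qed
  show "Gamma \<alpha> * (indicator {a<..<b} y * f y) = 0" if "y \<notin> {a<..<b}" for y using that by simp
  fix c assume c: "a < c" "c \<le> b"
  have "(\<integral>x. indicator {a<..<c} x * (Gamma \<alpha> * (indicator {a<..<b} x * f x)) \<partial>lborel)
      = (\<integral>x. Gamma \<alpha> * (indicator {a<..<c} x * f x) \<partial>lborel)"
    using c by (intro Bochner_Integration.integral_cong refl) (auto simp: indicator_def)
  then show "(\<integral>x. indicator {a<..<c} x * abel_left_deriv x \<partial>lborel) =
     (\<integral>x. indicator {a<..<c} x * (Gamma \<alpha> * (indicator {a<..<b} x * f x)) \<partial>lborel)"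
    using integral_abel_left_deriv[OF c] integral_left_deriv_powr[OF c] by simp
qed

text \<open>Fractional integration by parts: the Abel integral of \<open>h\<close> is moved over to the left derivative,
which it inverts.\<close>

lemma integral_left_deriv_test:
  assumes h: "continuous_on UNIV h" 
  shows "(\<integral>x. left_deriv x * (\<integral>y. indicator {x<..<b} y * (h y * (y - x) powr (\<alpha> - 1)) \<partial>lborel) \<partial>lborel)
    = Gamma \<alpha> * (\<integral>y. indicator {a<..<b} y * (f y * h y) \<partial>lborel)"
proof -
  have [measurable]: "h \<in> borel_measurable borel" using h by (rule borel_measurable_continuous_onI)
  obtain B where B: "\<And>y. y \<in> {a..b} \<Longrightarrow> \<bar>h y\<bar> \<le> B"
    using continuous_on_Icc_bounded[OF continuous_on_subset[OF h], of a b] by blast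
  let ?k = "\<lambda>x y. left_deriv x * abel_kernel x y * h y"
  have int: "integrable (lborel \<Otimes>\<^sub>M lborel) (\<lambda>(x, y). ?k x y)"
  proof (rule Bochner_Integration.integrable_bound)
    show "integrable (lborel \<Otimes>\<^sub>M lborel) (\<lambda>z. B * (case z of (x, y) \<Rightarrow> left_deriv x * abel_kernel x y))"
      using integrable_left_deriv_abel_kernel by simp
    have [measurable]: "left_deriv \<in> borel_measurable borel" using integrable_left_deriv by simp
    show "(\<lambda>(x, y). ?k x y) \<in> borel_measurable (lborel \<Otimes>\<^sub>M lborel)" by measurable
    have "\<bar>?k x y\<bar> \<le> \<bar>B * (left_deriv x * abel_kernel x y)\<bar>" for x y
    proof (cases "y \<in> {a..b}")
      case True
      then have "\<bar>left_deriv x * abel_kernel x y\<bar> * \<bar>h y\<bar> \<le> \<bar>left_deriv x * abel_kernel x y\<bar> * \<bar>B\<bar>"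
        using B[OF True] by (intro mult_left_mono) auto
      then show ?thesis by (simp add: abs_mult mult_ac)
    next
      case False
      then have "abel_kernel x y = 0" by (auto simp: abel_kernel_def indicator_def)
      then show ?thesis by simp
    qed
    then show "AE z in lborel \<Otimes>\<^sub>M lborel. norm (case z of (x, y) \<Rightarrow> ?k x y) \<le> norm (B * (case z of (x, y) \<Rightarrow> left_deriv x * abel_kernel x y))"
      by auto
  qed
  have "(\<integral>x. left_deriv x * (\<integral>y. indicator {x<..<b} y * (h y * (y - x) powr (\<alpha> - 1)) \<partial>lborel) \<partial>lborel)
      = (\<integral>x. (\<integral>y. ?k x y \<partial>lborel) \<partial>lborel)"
  proof (intro Bochner_Integration.integral_cong refl)
    fix x
    have "(\<integral>y. ?k x y \<partial>lborel) = left_deriv x * (\<integral>y. abel_kernel x y * h y \<partial>lborel)"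
      by (simp add: mult.assoc)
    also have "\<dots> = left_deriv x * (\<integral>y. indicator {x<..<b} y * (h y * (y - x) powr (\<alpha> - 1)) \<partial>lborel)"
      by (cases "x \<in> {a<..<b}") (auto simp: abel_kernel_def mult_ac left_deriv_def)
    finally show "left_deriv x * (\<integral>y. indicator {x<..<b} y * (h y * (y - x) powr (\<alpha> - 1)) \<partial>lborel) = (\<integral>y. ?k x y \<partial>lborel)" ..
  qed
  also have "\<dots> = (\<integral>y. (\<integral>x. ?k x y \<partial>lborel) \<partial>lborel)"
    by (rule lborel_pair.Fubini_integral[OF int, symmetric])
  also have "\<dots> = (\<integral>y. abel_left_deriv y * h y \<partial>lborel)" by (simp add: abel_left_deriv_def)
  also have "\<dots> = (\<integral>y. Gamma \<alpha> * (indicator {a<..<b} y * (f y * h y)) \<partial>lborel)"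
  proof (rule integral_cong_AE)
    have [measurable]: "abel_left_deriv \<in> borel_measurable borel"
      using lborel_pair.integrable_snd[OF integrable_left_deriv_abel_kernel] by (simp add: abel_left_deriv_def[abs_def])
    show "(\<lambda>y. abel_left_deriv y * h y) \<in> borel_measurable lborel" by measurable
    show "AE y in lborel. abel_left_deriv y * h y = Gamma \<alpha> * (indicator {a<..<b} y * (f y * h y))"
      using abel_left_deriv_eq by eventually_elim simp
  qed measurable
  finally show ?thesis by simp
qed

end

section \<open>The right-sided fractional derivative of smooth and of Hoelder functions\<close>

lemma set_integrable_if_kernel_bound:
  fixes q :: "real \<Rightarrow> real"
  assumes \<gamma>: "0 < \<gamma>" and "x \<le> b" and [measurable]: "q \<in> borel_measurable borel"
    and le: "\<And>y. x < y \<Longrightarrow> y < b \<Longrightarrow> \<bar>q y\<bar> \<le> B * (y - x) powr (\<gamma> - 1)"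
  shows "set_integrable lborel {x<..<b} q"
    and "\<bar>LBINT y:{x<..<b}. q y\<bar> \<le> B * ((b - x) powr \<gamma> / \<gamma>)"
proof -
  let ?k = "\<lambda>y. B * (indicator {x<..<b} y * (y - x) powr (\<gamma> - 1))"
  have k: "has_bochner_integral lborel ?k (B * ((b - x) powr \<gamma> / \<gamma>))"
    using assms by (intro has_bochner_integral_mult_right powr_kernel_from_left) auto
  then have int: "integrable lborel ?k" by (simp add: has_bochner_integral_iff)
  have le': "\<bar>indicator {x<..<b} y *\<^sub>R q y\<bar> \<le> ?k y" for y
    using le[of y] by (auto simp: indicator_def)
  have "integrable lborel (\<lambda>y. indicator {x<..<b} y *\<^sub>R q y)"
  proof (rule Bochner_Integration.integrable_bound[OF int])
    show "AE y in lborel. norm (indicator {x<..<b} y *\<^sub>R q y) \<le> norm (?k y)"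
      using le' by (intro AE_I2) (metis abs_ge_self order_trans real_norm_def)
  qed measurable
  then show *: "set_integrable lborel {x<..<b} q" by (simp add: set_integrable_def)
  have "\<bar>LBINT y:{x<..<b}. q y\<bar> \<le> (\<integral>y. \<bar>indicator {x<..<b} y *\<^sub>R q y\<bar> \<partial>lborel)"
    unfolding set_lebesgue_integral_def by (rule integral_abs_bound)
  also have "\<dots> \<le> (\<integral>y. ?k y \<partial>lborel)"
    using * int le' by (intro integral_mono) (auto simp: set_integrable_def)
  also have "\<dots> = B * ((b - x) powr \<gamma> / \<gamma>)" using k by (rule has_bochner_integral_integral_eq)
  finally show "\<bar>LBINT y:{x<..<b}. q y\<bar> \<le> B * ((b - x) powr \<gamma> / \<gamma>)" .
qed

text \<open>Integration by parts turns the difference quotients of \<open>G\<close> into its derivative. The boundary term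
at \<open>b\<close> is the first term of the right derivative, and the one at \<open>x\<close> vanishes because
\<open>(G y - G x) * (y - x) powr (\<alpha> - 1)\<close> is of the size of \<open>(y - x) powr \<alpha>\<close> near \<open>x\<close>.\<close>

lemma weyl_deriv_right_differentiable:
  fixes G h :: "real \<Rightarrow> real"
  assumes \<alpha>: "0 < \<alpha>" "\<alpha> < 1" and xb: "x < b"
    and G: "\<And>y. (G has_real_derivative h y) (at y)" and h: "continuous_on UNIV h"
  shows "weyl_deriv_right (1 - \<alpha>) b (\<lambda>u. G u - G b) x =
    - (\<integral>y. indicator {x<..<b} y * (h y * (y - x) powr (\<alpha> - 1)) \<partial>lborel) / Gamma \<alpha>"
proof -
  have hm [measurable]: "h \<in> borel_measurable borel" using h by (rule borel_measurable_continuous_onI)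
  have "continuous_on UNIV G"
    using G by (meson DERIV_isCont continuous_at_imp_continuous_on)
  then have Gm [measurable]: "G \<in> borel_measurable borel" by (rule borel_measurable_continuous_onI)
  obtain B where B: "0 \<le> B" "\<And>y. y \<in> {x..b} \<Longrightarrow> \<bar>h y\<bar> \<le> B" using continuous_on_Icc_bounded[OF continuous_on_subset[OF h], of x b] by blast
  define P where "P y = (G y - G x) * (y - x) powr (\<alpha> - 1)" for y
  define p1 where "p1 y = h y * (y - x) powr (\<alpha> - 1)" for y
  define p2 where "p2 y = (G x - G y) / (y - x) powr (1 + (1 - \<alpha>))" for y
  have lip: "\<bar>G x - G y\<bar> \<le> B * (y - x)" if y: "x < y" "y < b" for y
  proof -
    obtain z where "x < z" "z < y" "G y - G x = (y - x) * h z"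
      using MVT2[OF y(1), of G h] G by auto
    moreover from this have "\<bar>h z\<bar> \<le> B" using B(2)[of z] y by auto
    then have "\<bar>h z\<bar> * (y - x) \<le> B * (y - x)" using y by (intro mult_right_mono) auto
    moreover have "\<bar>G x - G y\<bar> = \<bar>G y - G x\<bar>" by (rule abs_minus_commute)
    ultimately show ?thesis using y by (simp add: abs_mult mult.commute)
  qed
  have [measurable]: "p1 \<in> borel_measurable borel" "p2 \<in> borel_measurable borel"
    unfolding p1_def[abs_def] p2_def[abs_def] by measurable
  have i1: "set_integrable lborel {x<..<b} p1"
    using B xb by (intro set_integrable_if_kernel_bound(1)[OF \<alpha>(1), where B = B])
      (auto simp: p1_def abs_mult intro!: mult_right_mono)
  have i2: "set_integrable lborel {x<..<b} p2"
  proof (rule set_integrable_if_kernel_bound(1)[OF \<alpha>(1), where B = B])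
    fix y assume y: "x < y" "y < b"
    have "(y - x) / (y - x) powr (1 + (1 - \<alpha>)) = (y - x) powr (1 - (1 + (1 - \<alpha>)))"
      using y by (simp only: powr_diff) simp
    also have "\<dots> = (y - x) powr (\<alpha> - 1)" by simp
    finally have "B * (y - x) / (y - x) powr (1 + (1 - \<alpha>)) = B * (y - x) powr (\<alpha> - 1)"
      by (metis times_divide_eq_right)
    then show "\<bar>p2 y\<bar> \<le> B * (y - x) powr (\<alpha> - 1)"
      using divide_right_mono[OF lip[OF y], of "(y - x) powr (1 + (1 - \<alpha>))"] by (simp add: p2_def)
  qed (use xb in \<open>auto simp: p2_def\<close>)
  have der: "(P has_real_derivative (p1 y + (1 - \<alpha>) * p2 y)) (at y)" if "x < y" for y
  proof -
    have "1 / (y - x) powr (1 + (1 - \<alpha>)) = (y - x) powr (\<alpha> - 1 - 1)"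
      using powr_minus_one_minus[of "y - x" "1 - \<alpha>"] by (simp add: algebra_simps)
    then have p2: "p2 y = (G x - G y) * (y - x) powr (\<alpha> - 1 - 1)"
      by (metis p2_def times_divide_eq_right mult.right_neutral)
    show ?thesis unfolding P_def[abs_def] p1_def p2 using that
      by (auto intro!: derivative_eq_intros G simp: algebra_simps)
  qed
  have cont: "continuous_on {x..b} P"
    unfolding continuous_on_eq_continuous_within
  proof
    fix z assume z: "z \<in> {x..b}"
    show "continuous (at z within {x..b}) P"
    proof (cases "z = x")
      case False
      then show ?thesis using z DERIV_isCont[OF der, of z] by (auto intro: continuous_at_imp_continuous_within)
    next
      case True
      \<comment> \<open>Caratheodory's form of the derivative absorbs one power of \<open>w - x\<close>.\<close>
      obtain g where g: "\<And>w. G w - G x = g w * (w - x)" "isCont g x"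
        using G[of x] unfolding CARAT_DERIV by blast
      have "((\<lambda>w. g w * (w - x) powr \<alpha>) \<longlongrightarrow> g x * (x - x) powr \<alpha>) (at x within {x..b})"
      proof (intro tendsto_mult)
        show "(g \<longlongrightarrow> g x) (at x within {x..b})"
          using g(2) by (simp add: isCont_def tendsto_within_subset[OF _ subset_UNIV])
        have "continuous_on {x..b} (\<lambda>w. (w - x) powr \<alpha>)"
          using \<alpha> by (intro continuous_on_powr' continuous_intros) auto
        then show "((\<lambda>w. (w - x) powr \<alpha>) \<longlongrightarrow> (x - x) powr \<alpha>) (at x within {x..b})"
          unfolding continuous_on_def using xb by (meson atLeastAtMost_iff less_imp_le order_refl)
      qed
      moreover have "P w = g w * (w - x) powr \<alpha>" if "w \<in> {x..b}" for w
        using that g(1)[of w] by (cases "w = x") (auto simp: P_def powr_diff)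
      then have "eventually (\<lambda>w. g w * (w - x) powr \<alpha> = P w) (at x within {x..b})"
        by (auto simp: eventually_at_filter)
      ultimately have "(P \<longlongrightarrow> g x * (x - x) powr \<alpha>) (at x within {x..b})"
        by (rule Lim_transform_eventually)
      then show ?thesis using True by (simp add: continuous_within P_def)
    qed
  qed
  have "((\<lambda>y. p1 y + (1 - \<alpha>) * p2 y) has_integral (P b - P x)) {x..b}"
    using xb cont der by (intro fundamental_theorem_of_calculus_interior)
      (auto simp flip: has_real_derivative_iff_has_vector_derivative)
  then have "((\<lambda>y. p1 y + (1 - \<alpha>) * p2 y) has_integral P b) {x<..<b}"
    by (simp add: has_integral_Icc_iff_Ioo P_def)
  moreover have i3: "set_integrable lborel {x<..<b} (\<lambda>y. p1 y + (1 - \<alpha>) * p2 y)"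
    using i1 i2 by (intro set_integral_add(1) set_integrable_mult_right)
  ultimately have "(LBINT y:{x<..<b}. p1 y + (1 - \<alpha>) * p2 y) = P b"
    using set_borel_integral_eq_integral(2)[OF i3] by (simp add: integral_unique)
  then have "(LBINT y:{x<..<b}. p1 y) + (1 - \<alpha>) * (LBINT y:{x<..<b}. p2 y) = P b"
    using i1 i2 by (simp add: set_integral_add(2))
  moreover have "P b = - ((G x - G b) / (b - x) powr (1 - \<alpha>))"
    using powr_minus_divide[of "b - x" "1 - \<alpha>"] by (simp add: P_def diff_divide_distrib)
  ultimately have "(G x - G b) / (b - x) powr (1 - \<alpha>) + (1 - \<alpha>) * (LBINT y:{x<..<b}. p2 y)
      = - (LBINT y:{x<..<b}. p1 y)"
    by linarith
  moreover have "weyl_deriv_right (1 - \<alpha>) b (\<lambda>u. G u - G b) x =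
      ((G x - G b) / (b - x) powr (1 - \<alpha>) + (1 - \<alpha>) * (LBINT y:{x<..<b}. p2 y)) / Gamma \<alpha>"
    unfolding weyl_deriv_right_def p2_def by simp
  moreover have "(LBINT y:{x<..<b}. p1 y) =
      (\<integral>y. indicator {x<..<b} y * (h y * (y - x) powr (\<alpha> - 1)) \<partial>lborel)"
    by (simp add: set_lebesgue_integral_def p1_def)
  ultimately show ?thesis by simp
qed

context
  fixes \<beta> \<mu> L b :: real
  assumes \<beta>: "0 < \<beta>" "\<beta> < 1" "\<beta> < \<mu>"
begin

lemma holder_difference_bound:
  fixes x y :: real
  assumes "\<bar>G x - G y\<bar> \<le> L * \<bar>x - y\<bar> powr \<mu>" "x < y"
  shows "\<bar>(G x - G y) / (y - x) powr (1 + \<beta>)\<bar> \<le> L * (y - x) powr ((\<mu> - \<beta>) - 1)"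
proof -
  have "(y - x) powr \<mu> / (y - x) powr (1 + \<beta>) = (y - x) powr (\<mu> - (1 + \<beta>))"
    by (rule powr_diff[symmetric])
  also have "\<mu> - (1 + \<beta>) = (\<mu> - \<beta>) - 1" by simp
  finally have "L * (y - x) powr \<mu> / (y - x) powr (1 + \<beta>) = L * (y - x) powr ((\<mu> - \<beta>) - 1)"
    by (metis times_divide_eq_right)
  then show ?thesis
    using divide_right_mono[OF assms(1), of "(y - x) powr (1 + \<beta>)"] assms(2) by simp
qed

text \<open>The bound depends on \<open>G\<close> through its Hoelder constant only, so it is uniform along a sequence of
approximations with a common constant.\<close>

lemma weyl_deriv_right_bound:
  assumes G: "\<And>x y. \<bar>G x - G y\<bar> \<le> L * \<bar>x - y\<bar> powr \<mu>" and [measurable]: "G \<in> borel_measurable borel"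
    and x: "a < x" "x < b"
  shows "\<bar>weyl_deriv_right \<beta> b (\<lambda>u. G u - G b) x\<bar> \<le>
    (L * (b - a) powr (\<mu> - \<beta>) + L * (b - a) powr (\<mu> - \<beta>) / (\<mu> - \<beta>)) / Gamma (1 - \<beta>)"
proof -
  have L: "0 \<le> L" using G[of 0 1] by auto
  let ?I = "LBINT y:{x<..<b}. (G x - G y) / (y - x) powr (1 + \<beta>)"
  have le: "(b - x) powr (\<mu> - \<beta>) \<le> (b - a) powr (\<mu> - \<beta>)"
    using x \<beta> by (intro powr_mono2) auto
  have "\<bar>?I\<bar> \<le> L * ((b - x) powr (\<mu> - \<beta>) / (\<mu> - \<beta>))"
    using \<beta> x by (intro set_integrable_if_kernel_bound(2) holder_difference_bound G) auto
  also have "\<dots> \<le> L * (b - a) powr (\<mu> - \<beta>) / (\<mu> - \<beta>)"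
    using L \<beta> le by (auto intro!: mult_left_mono divide_right_mono)
  finally have I: "\<bar>?I\<bar> \<le> L * (b - a) powr (\<mu> - \<beta>) / (\<mu> - \<beta>)" .
  have "\<bar>(G x - G b) / (b - x) powr \<beta>\<bar> = \<bar>G x - G b\<bar> / (b - x) powr \<beta>" by simp
  also have "\<dots> \<le> L * (b - x) powr \<mu> / (b - x) powr \<beta>"
    using G[of x b] x by (intro divide_right_mono) (auto simp: abs_minus_commute)
  also have "\<dots> = L * (b - x) powr (\<mu> - \<beta>)" by (simp add: powr_diff)
  also have "\<dots> \<le> L * (b - a) powr (\<mu> - \<beta>)" using L le by (intro mult_left_mono)
  finally have "\<bar>(G x - G b) / (b - x) powr \<beta>\<bar> \<le> L * (b - a) powr (\<mu> - \<beta>)" .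
  moreover have "\<bar>\<beta> * ?I\<bar> \<le> L * (b - a) powr (\<mu> - \<beta>) / (\<mu> - \<beta>)"
    using I \<beta> mult_mono[of "\<beta>" 1 "\<bar>?I\<bar>" "\<bar>?I\<bar>"] by (simp add: abs_mult)
  ultimately have "\<bar>(G x - G b) / (b - x) powr \<beta> + \<beta> * ?I\<bar> \<le>
     L * (b - a) powr (\<mu> - \<beta>) + L * (b - a) powr (\<mu> - \<beta>) / (\<mu> - \<beta>)"
    by linarith
  then show ?thesis using \<beta> Gamma_real_pos[of "1 - \<beta>"]
    by (auto simp: weyl_deriv_right_def intro!: divide_right_mono)
qed

lemma weyl_deriv_right_tendsto:
  assumes G: "\<And>n x y. \<bar>G n x - G n y\<bar> \<le> L * \<bar>x - y\<bar> powr \<mu>" "\<And>n. G n \<in> borel_measurable borel"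
    and g: "g \<in> borel_measurable borel"
    and lim: "\<And>x. (\<lambda>n. G n x) \<longlonglongrightarrow> g x" and x: "x < b"
  shows "(\<lambda>n. weyl_deriv_right \<beta> b (\<lambda>u. G n u - G n b) x) \<longlonglongrightarrow>
    weyl_deriv_right \<beta> b (\<lambda>u. g u - g b) x"
proof -
  note [measurable] = G(2) g
  have "(\<lambda>n. LBINT y:{x<..<b}. (G n x - G n y) / (y - x) powr (1 + \<beta>)) \<longlonglongrightarrow>
      (LBINT y:{x<..<b}. (g x - g y) / (y - x) powr (1 + \<beta>))"
    unfolding set_lebesgue_integral_def
  proof (rule integral_dominated_convergence)
    show "integrable lborel (\<lambda>y. L * (indicator {x<..<b} y * (y - x) powr ((\<mu> - \<beta>) - 1)))"
      using powr_kernel_from_left[of "\<mu> - \<beta>" x b] \<beta> x by (auto simp: has_bochner_integral_iff)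
    show "AE y in lborel. (\<lambda>n. indicator {x<..<b} y *\<^sub>R ((G n x - G n y) / (y - x) powr (1 + \<beta>))) \<longlonglongrightarrow>
        indicator {x<..<b} y *\<^sub>R ((g x - g y) / (y - x) powr (1 + \<beta>))"
    proof (intro AE_I2)
      fix y show "(\<lambda>n. indicator {x<..<b} y *\<^sub>R ((G n x - G n y) / (y - x) powr (1 + \<beta>))) \<longlonglongrightarrow>
        indicator {x<..<b} y *\<^sub>R ((g x - g y) / (y - x) powr (1 + \<beta>))"
        by (cases "y \<in> {x<..<b}") (auto intro!: tendsto_intros lim)
    qed
    show "AE y in lborel. norm (indicator {x<..<b} y *\<^sub>R ((G n x - G n y) / (y - x) powr (1 + \<beta>)))
       \<le> L * (indicator {x<..<b} y * (y - x) powr ((\<mu> - \<beta>) - 1))" for n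
    proof (intro AE_I2)
      fix y show "norm (indicator {x<..<b} y *\<^sub>R ((G n x - G n y) / (y - x) powr (1 + \<beta>)))
        \<le> L * (indicator {x<..<b} y * (y - x) powr ((\<mu> - \<beta>) - 1))"
        using holder_difference_bound[OF G(1)[of n x y]] by (cases "y \<in> {x<..<b}") auto
    qed
  qed measurable
  then show ?thesis
    unfolding weyl_deriv_right_def using x \<beta> less_imp_neq[OF Gamma_real_pos[of "1 - \<beta>"]]
    by (auto intro!: tendsto_intros lim)
qed

end


lemma holder_imp_continuous:
  fixes g :: "real \<Rightarrow> real"
  assumes g: "\<And>x y. \<bar>g x - g y\<bar> \<le> L * \<bar>x - y\<bar> powr \<mu>" and \<mu>: "0 < \<mu>"
  shows "continuous_on UNIV g"
proof (intro continuous_at_imp_continuous_on ballI)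
  fix x
  have "((\<lambda>y. L * \<bar>y - x\<bar> powr \<mu>) \<longlongrightarrow> L * \<bar>x - x\<bar> powr \<mu>) (at x)"
    using \<mu> by (intro tendsto_intros tendsto_powr') auto
  then have "((\<lambda>y. L * \<bar>y - x\<bar> powr \<mu>) \<longlongrightarrow> 0) (at x)" by simp
  then have "((\<lambda>y. g y - g x) \<longlongrightarrow> 0) (at x)"
    by (rule Lim_null_comparison[rotated]) (use g in auto)
  then show "isCont g x" by (simp add: isCont_def LIM_zero_iff)
qed

text \<open>The Steklov averages of \<open>g\<close> over \<open>[x, x + 1/(n + 1)]\<close> are smooth, converge to \<open>g\<close>, and inherit its
Hoelder estimate with the same constant. With a primitive \<open>P\<close> of \<open>g\<close> both the Hoelder estimate and
the convergence are applications of the mean value theorem.\<close>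

lemma steklov_average:
  fixes g :: "real \<Rightarrow> real"
  assumes g: "\<And>x y. \<bar>g x - g y\<bar> \<le> L * \<bar>x - y\<bar> powr \<mu>" and \<mu>: "0 < \<mu>"
  obtains G where "\<And>n x. (G n has_real_derivative real (Suc n) * (g (x + 1 / real (Suc n)) - g x)) (at x)"
    and "\<And>n x y. \<bar>G n x - G n y\<bar> \<le> L * \<bar>x - y\<bar> powr \<mu>"
    and "\<And>x. (\<lambda>n. G n x) \<longlonglongrightarrow> g x"
proof -
  have L: "0 \<le> L" using g[of 0 1] by auto
  have "continuous_on UNIV g" using g \<mu> by (rule holder_imp_continuous)
  then have "\<exists>P. \<forall>x::real. - \<infinity> < ereal x \<longrightarrow> ereal x < \<infinity> \<longrightarrow> (P has_vector_derivative g x) (at x)"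
    by (intro einterval_antiderivative) (auto simp: continuous_on_eq_continuous_at)
  then obtain P where P: "\<And>x. (P has_real_derivative g x) (at x)"
    by (auto simp: has_real_derivative_iff_has_vector_derivative)
  have Pc: "((\<lambda>z. P (c + z)) has_real_derivative g (c + z)) (at z)" for c z
    using DERIV_shift[of P "g (c + z)" z c] P[of "z + c"] by (simp add: add.commute)
  define e where "e n = 1 / real (Suc n)" for n
  have e: "0 < e n" "real (Suc n) * e n = 1" for n by (auto simp: e_def)
  define G where "G n x = real (Suc n) * (P (x + e n) - P x)" for n x
  show thesis
  proof (rule that[of G])
    fix n x y
    show "(G n has_real_derivative real (Suc n) * (g (x + 1 / real (Suc n)) - g x)) (at x)"
      unfolding G_def[abs_def] e_def[symmetric]
      using Pc[of "e n" x] P[of x] by (intro DERIV_cmult DERIV_diff) (auto simp: add.commute)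
    obtain z where z: "P (x + e n) - P (y + e n) - (P (x + 0) - P (y + 0)) = (e n - 0) * (g (x + z) - g (y + z))"
      using MVT2[OF e(1)[of n], of "\<lambda>z. P (x + z) - P (y + z)" "\<lambda>z. g (x + z) - g (y + z)"]
        DERIV_diff[OF Pc[of x] Pc[of y]] by auto
    have "G n x - G n y = real (Suc n) * (P (x + e n) - P (y + e n) - (P (x + 0) - P (y + 0)))"
      by (simp add: G_def algebra_simps)
    then have "G n x - G n y = real (Suc n) * e n * (g (x + z) - g (y + z))"
      unfolding z by (simp only: diff_0_right mult.assoc)
    then show "\<bar>G n x - G n y\<bar> \<le> L * \<bar>x - y\<bar> powr \<mu>"
      using g[of "x + z" "y + z"] e(2) by simp
  next
    fix x
    have "\<bar>G n x - g x\<bar> \<le> L * e n powr \<mu>" for n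
    proof -
      obtain z where z: "x < z" "z < x + e n" "P (x + e n) - P x = (x + e n - x) * g z"
        using MVT2[of x "x + e n" P g] P e by auto
      then have "G n x = real (Suc n) * e n * g z" by (simp add: G_def)
      then have "\<bar>G n x - g x\<bar> \<le> L * \<bar>z - x\<bar> powr \<mu>" using g[of z x] e(2) by simp
      also have "\<dots> \<le> L * e n powr \<mu>" using z L \<mu> by (intro mult_left_mono powr_mono2) auto
      finally show ?thesis .
    qed
    moreover have "(\<lambda>n. L * e n powr \<mu>) \<longlonglongrightarrow> L * 0 powr \<mu>"
      using \<mu> LIMSEQ_Suc[OF lim_1_over_n] by (intro tendsto_intros tendsto_powr') (auto simp: e_def)
    ultimately have "(\<lambda>n. G n x - g x) \<longlonglongrightarrow> 0"
      using \<mu> by (intro Lim_null_comparison[of "\<lambda>n. G n x - g x"]) auto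
    then show "(\<lambda>n. G n x) \<longlonglongrightarrow> g x" by (simp add: LIM_zero_iff)
  qed
qed

section \<open>The generalized integral as a limit of ordinary integrals\<close>

context weyl_integrable
begin

text \<open>For the Steklov averages \<open>G n\<close> of \<open>g\<close> the two sides agree, by \<open>weyl_deriv_right_differentiable\<close> and
\<open>integral_left_deriv_test\<close>. On the right-hand side the average may be replaced by \<open>g\<close> in the limit
by dominated convergence: the condition \<open>1 - \<alpha> < \<mu>\<close> bounds the right derivatives of the averages
uniformly, and the left derivative of \<open>f\<close> is integrable.\<close>

theorem gls_integral_eq_lim:
  assumes g: "\<And>x y. \<bar>g x - g y\<bar> \<le> L * \<bar>x - y\<bar> powr \<mu>" and \<mu>: "1 - \<alpha> < \<mu>"
  shows "(\<lambda>n. \<integral>y. indicator {a<..<b} y * (f y * (real (Suc n) * (g (y + 1 / real (Suc n)) - g y))) \<partial>lborel)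
     \<longlonglongrightarrow> - (LBINT x:{a<..<b}. weyl_deriv_left \<alpha> a f x * weyl_deriv_right (1 - \<alpha>) b (\<lambda>u. g u - g b) x)"
proof -
  have \<mu>0: "0 < \<mu>" using \<mu> \<alpha> by simp
  have L: "0 \<le> L" using g[of 0 1] by auto
  have gc: "continuous_on UNIV g" using g \<mu>0 by (rule holder_imp_continuous)
  then have gm [measurable]: "g \<in> borel_measurable borel" by (rule borel_measurable_continuous_onI)
  have Fm [measurable]: "left_deriv \<in> borel_measurable borel" using integrable_left_deriv by simp
  obtain G where G: "\<And>n x. (G n has_real_derivative real (Suc n) * (g (x + 1 / real (Suc n)) - g x)) (at x)"
      "\<And>n x y. \<bar>G n x - G n y\<bar> \<le> L * \<bar>x - y\<bar> powr \<mu>" "\<And>x. (\<lambda>n. G n x) \<longlonglongrightarrow> g x"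
    using steklov_average[OF g \<mu>0] by metis
  define h where "h n x = real (Suc n) * (g (x + 1 / real (Suc n)) - g x)" for n x
  have hc: "continuous_on UNIV (h n)" for n
    unfolding h_def[abs_def] by (intro continuous_intros continuous_on_compose2[OF gc]) auto
  then have [measurable]: "h n \<in> borel_measurable borel" for n by (rule borel_measurable_continuous_onI)
  have [measurable]: "G n \<in> borel_measurable borel" for n
    using holder_imp_continuous[OF G(2) \<mu>0, of n] by (rule borel_measurable_continuous_onI)
  define D where "D n x = left_deriv x * weyl_deriv_right (1 - \<alpha>) b (\<lambda>u. G n u - G n b) x" for n x
  define D0 where "D0 x = left_deriv x * weyl_deriv_right (1 - \<alpha>) b (\<lambda>u. g u - g b) x" for x
  define I where "I n x = (\<integral>y. indicator {x<..<b} y * (h n y * (y - x) powr (\<alpha> - 1)) \<partial>lborel)" for n x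
  have [measurable]: "I n \<in> borel_measurable borel" for n
    unfolding I_def[abs_def] by measurable
  have D_eq: "D n x = - (left_deriv x * I n x / Gamma \<alpha>)" for n x
  proof (cases "x \<in> {a<..<b}")
    case True
    then show ?thesis
      using weyl_deriv_right_differentiable[OF \<alpha>, of x b "G n" "h n"] G(1) hc
      by (simp add: D_def I_def h_def)
  next
    case False
    then show ?thesis by (simp add: D_def left_deriv_def)
  qed
  have Dm [measurable]: "D n \<in> borel_measurable borel" for n
    unfolding D_eq[abs_def] by measurable
  have D_lim: "(\<lambda>n. D n x) \<longlonglongrightarrow> D0 x" for x
  proof (cases "x \<in> {a<..<b}")
    case True
    then show ?thesis unfolding D_def D0_def using \<alpha> \<mu> G
      by (intro tendsto_mult_left weyl_deriv_right_tendsto[where \<mu> = \<mu> and L = L]) auto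
  next
    case False
    then show ?thesis by (simp add: D_def D0_def left_deriv_def)
  qed
  define C where "C = (L * (b - a) powr (\<mu> - (1 - \<alpha>)) + L * (b - a) powr (\<mu> - (1 - \<alpha>)) / (\<mu> - (1 - \<alpha>))) / Gamma (1 - (1 - \<alpha>))"
  have D_bound: "\<bar>D n x\<bar> \<le> \<bar>C * left_deriv x\<bar>" for n x
  proof (cases "x \<in> {a<..<b}")
    case True
    then have "\<bar>weyl_deriv_right (1 - \<alpha>) b (\<lambda>u. G n u - G n b) x\<bar> \<le> C"
      unfolding C_def using \<alpha> \<mu> G by (intro weyl_deriv_right_bound) auto
    then show ?thesis by (auto simp: D_def abs_mult mult.commute[of _ "\<bar>left_deriv x\<bar>"] intro!: mult_left_mono)
  next
    case False
    then show ?thesis by (simp add: D_def left_deriv_def)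
  qed
  have "(\<lambda>n. integral\<^sup>L lborel (D n)) \<longlonglongrightarrow> integral\<^sup>L lborel D0"
  proof (rule integral_dominated_convergence)
    show "integrable lborel (\<lambda>x. norm (C * left_deriv x))" using integrable_left_deriv by (intro integrable_norm integrable_mult_right) auto
    have "D0 \<in> borel_measurable borel" by (rule borel_measurable_LIMSEQ_real[OF D_lim Dm])
    then show "D0 \<in> borel_measurable lborel" by simp
  qed (use D_lim D_bound in auto)
  moreover have "integral\<^sup>L lborel (D n) = - (\<integral>y. indicator {a<..<b} y * (f y * h n y) \<partial>lborel)" for n
  proof -
    have "integral\<^sup>L lborel (D n) = - ((\<integral>x. left_deriv x * I n x \<partial>lborel) / Gamma \<alpha>)"
      unfolding D_eq[abs_def] by simp
    then show ?thesis using integral_left_deriv_test[OF hc[of n]] less_imp_neq[OF Gamma_real_pos[OF \<alpha>(1)]]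
      by (simp add: I_def)
  qed
  moreover have "integral\<^sup>L lborel D0 =
      (LBINT x:{a<..<b}. weyl_deriv_left \<alpha> a f x * weyl_deriv_right (1 - \<alpha>) b (\<lambda>u. g u - g b) x)"
    by (simp add: D0_def[abs_def] left_deriv_def set_lebesgue_integral_def mult.assoc)
  ultimately have "(\<lambda>n. - (\<integral>y. indicator {a<..<b} y * (f y * h n y) \<partial>lborel)) \<longlonglongrightarrow> 
    (LBINT x:{a<..<b}. weyl_deriv_left \<alpha> a f x * weyl_deriv_right (1 - \<alpha>) b (\<lambda>u. g u - g b) x)"
    by simp
  from tendsto_minus[OF this] show ?thesis by (simp add: h_def)
qed

end

section \<open>The Young--Loeve estimate and the indefinite integral\<close>

text \<open>Write \<open>R u v\<close> for the integral over \<open>[u,v]\<close>. Cutting \<open>[u,v]\<close> at its midpoint \<open>m\<close> expresses \<open>R u v\<close>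
as \<open>R u m + R m v\<close> plus the product \<open>(f m - f u) * (G v - G m)\<close>, which the Hoelder estimates control.
So a bound \<open>\<bar>R u v\<bar> \<le> A * (v - u) powr \<theta>\<close> with \<open>\<theta> = \<nu> + \<mu>\<close> improves to the same bound with
\<open>q * A + D\<close> in place of \<open>A\<close>, where \<open>q = 2 powr (1 - \<theta>) < 1\<close>. Some finite \<open>A\<close> exists because the
derivative \<open>h\<close> is bounded on \<open>[s,t]\<close>, and iteration replaces it by the fixed point \<open>D / (1 - q)\<close>, which no
longer depends on \<open>h\<close>.\<close>

lemma young_loeve_bound:
  fixes f h G :: "real \<Rightarrow> real"
  assumes f: "\<And>x y. \<bar>f x - f y\<bar> \<le> N * \<bar>x - y\<bar> powr \<nu>"
    and G: "\<And>x y. \<bar>G x - G y\<bar> \<le> L * \<bar>x - y\<bar> powr \<mu>"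
    and der: "\<And>x. (G has_real_derivative h x) (at x)" and h: "continuous_on UNIV h"
    and exps: "0 < \<nu>" "\<mu> \<le> 1" "1 < \<nu> + \<mu>" and st: "s \<le> t"
  shows "\<bar>integral {s..t} (\<lambda>x. (f x - f s) * h x)\<bar> \<le>
    N * L * (1/2) powr (\<nu> + \<mu>) / (1 - 2 * (1/2) powr (\<nu> + \<mu>)) * (t - s) powr (\<nu> + \<mu>)"
proof -
  define \<theta> where "\<theta> = \<nu> + \<mu>"
  define D where "D = N * L * (1/2) powr \<theta>"
  define q where "q = 2 * (1/2::real) powr \<theta>"
  have N: "0 \<le> N" using f[of 0 1] by auto
  have L: "0 \<le> L" using G[of 0 1] by auto
  have "(1/2::real) powr \<theta> < (1/2) powr 1"
    using exps by (intro powr_less_mono') (auto simp: \<theta>_def)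
  then have q: "0 < q" "q < 1" by (auto simp: q_def)
  have fc: "continuous_on UNIV f" using f exps(1) by (rule holder_imp_continuous)
  have int: "(\<lambda>x. (f x - c) * h x) integrable_on {u..v}" for c u v
    by (intro integrable_continuous_interval continuous_intros continuous_on_subset[OF fc] continuous_on_subset[OF h]) auto
  have hint: "(h has_integral G v - G u) {u..v}" if "u \<le> v" for u v
    using that der by (intro fundamental_theorem_of_calculus)
      (auto simp flip: has_real_derivative_iff_has_vector_derivative intro: has_field_derivative_at_within)
  define R where "R u v = integral {u..v} (\<lambda>x. (f x - f u) * h x)" for u v
  obtain B where B: "0 \<le> B" "\<And>y. y \<in> {s..t} \<Longrightarrow> \<bar>h y\<bar> \<le> B"
    using continuous_on_Icc_bounded[OF continuous_on_subset[OF h], of s t] by blast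
  define K where "K = N * B * (t - s) powr (1 - \<mu>)"
  have crude: "\<bar>R u v\<bar> \<le> K * (v - u) powr \<theta>" if uv: "s \<le> u" "u \<le> v" "v \<le> t" for u v
  proof (cases "u = v")
    case True
    then show ?thesis using N B by (simp add: R_def)
  next
    case False
    have "norm (R u v) \<le> (N * (v - u) powr \<nu> * B) * measure lborel (cbox u v)"
      unfolding R_def box_real(2)[symmetric]
    proof (rule has_integral_bound[OF _ integrable_integral])
      show "norm ((f x - f u) * h x) \<le> N * (v - u) powr \<nu> * B" if "x \<in> cbox u v" for x
      proof -
        have "\<bar>f x - f u\<bar> \<le> N * \<bar>x - u\<bar> powr \<nu>" by (rule f)
        also have "\<dots> \<le> N * (v - u) powr \<nu>" using that N exps by (intro mult_left_mono powr_mono2) auto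
        finally show ?thesis using B(2)[of x] that uv B(1) N
          by (auto simp: abs_mult intro!: mult_mono)
      qed
    qed (use N B int[of "f u" u v] in auto)
    also have "\<dots> = N * B * ((v - u) powr \<nu> * (v - u))" using uv by simp
    also have "(v - u) powr \<nu> * (v - u) = (v - u) powr (1 - \<mu>) * (v - u) powr \<theta>"
    proof -
      have "(v - u) powr 1 = v - u" using uv by simp
      then have "(v - u) powr \<nu> * (v - u) = (v - u) powr \<nu> * (v - u) powr 1" by (simp only:)
      also have "\<dots> = (v - u) powr (1 - \<mu>) * (v - u) powr \<theta>" 
        unfolding \<theta>_def by (simp only: powr_add[symmetric]) (simp add: algebra_simps)
      finally show ?thesis .
    qed
    also have "N * B * \<dots> \<le> N * B * ((t - s) powr (1 - \<mu>) * (v - u) powr \<theta>)"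
      using N B uv exps by (intro mult_left_mono mult_right_mono powr_mono2) auto
    finally show ?thesis by (simp add: K_def mult_ac)
  qed
  have halve: "\<bar>R u v\<bar> \<le> (q * A + D) * (v - u) powr \<theta>"
    if uv: "s \<le> u" "u \<le> v" "v \<le> t" and A: "\<And>u v. s \<le> u \<Longrightarrow> u \<le> v \<Longrightarrow> v \<le> t \<Longrightarrow> \<bar>R u v\<bar> \<le> A * (v - u) powr \<theta>"
    for A u v
  proof -
    define m where "m = (u + v) / 2"
    have m: "u \<le> m" "m \<le> v" "m - u = (v - u) / 2" "v - m = (v - u) / 2"
      using uv by (auto simp: m_def field_simps)
    have "R u v = integral {u..m} (\<lambda>x. (f x - f u) * h x) + integral {m..v} (\<lambda>x. (f x - f u) * h x)"
      unfolding R_def using m int by (intro Henstock_Kurzweil_Integration.integral_combine[symmetric]) auto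
    also have "integral {m..v} (\<lambda>x. (f x - f u) * h x) = integral {m..v} (\<lambda>x. (f x - f m) * h x + (f m - f u) * h x)"
      by (intro integral_cong) (simp add: algebra_simps)
    also have "\<dots> = R m v + (f m - f u) * (G v - G m)"
      unfolding R_def using hint[OF m(2)]
      by (subst integral_add[OF int]) (auto intro!: integrable_on_mult_right simp: has_integral_iff integral_mult_right)
    finally have "\<bar>R u v\<bar> \<le> \<bar>R u m\<bar> + \<bar>R m v\<bar> + \<bar>(f m - f u) * (G v - G m)\<bar>"
      unfolding R_def by linarith
    also have "\<bar>R u m\<bar> \<le> A * ((v - u) / 2) powr \<theta>" using A[of u m] m uv by simp
    also have "\<bar>R m v\<bar> \<le> A * ((v - u) / 2) powr \<theta>" using A[of m v] m uv by simp
    also have "\<bar>(f m - f u) * (G v - G m)\<bar> \<le> (N * ((v - u) / 2) powr \<nu>) * (L * ((v - u) / 2) powr \<mu>)"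
      unfolding abs_mult using f[of m u] G[of v m] m uv N by (intro mult_mono) auto
    also have "\<dots> = N * L * ((v - u) / 2) powr \<theta>" by (simp add: \<theta>_def powr_add mult_ac)
    also have "((v - u) / 2) powr \<theta> = (1/2) powr \<theta> * (v - u) powr \<theta>"
      using uv powr_mult[of "1/2" "v - u" \<theta>] by simp
    finally show ?thesis by (simp add: q_def D_def algebra_simps)
  qed
  have iter: "\<bar>R u v\<bar> \<le> (q ^ n * K + D / (1 - q)) * (v - u) powr \<theta>"
    if "s \<le> u" "u \<le> v" "v \<le> t" for n u v
    using that
  proof (induction n arbitrary: u v)
    case 0
    have "0 \<le> D" using N L by (simp add: D_def)
    then have "K * (v - u) powr \<theta> \<le> (K + D / (1 - q)) * (v - u) powr \<theta>"
      using q by (intro mult_right_mono) auto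
    then show ?case using crude[OF 0] by simp
  next
    case (Suc n)
    have "q * (q ^ n * K + D / (1 - q)) + D = q ^ Suc n * K + D / (1 - q)"
      using q by (simp add: field_simps)
    then show ?case using halve[OF Suc.prems Suc.IH] by simp
  qed
  have "(\<lambda>n. (q ^ n * K + D / (1 - q)) * (t - s) powr \<theta>) \<longlonglongrightarrow> (0 * K + D / (1 - q)) * (t - s) powr \<theta>"
    using q by (intro tendsto_intros LIMSEQ_power_zero) auto
  then have "\<bar>R s t\<bar> \<le> (0 * K + D / (1 - q)) * (t - s) powr \<theta>"
    using iter[of s t] st by (intro LIMSEQ_le_const) auto
  then show ?thesis by (simp add: R_def D_def q_def \<theta>_def)
qed

text \<open>The approximating integrals in \<open>gls_integral_eq_lim\<close> do not involve \<open>\<alpha>\<close>, so that the order of the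
derivatives may be chosen separately for each upper limit \<open>t\<close>, as long as each choice leaves \<open>g\<close>
with a Hoelder order above \<open>1 - \<alpha>\<close>.\<close>

theorem gls_integral_holder:
  fixes f g J :: "real \<Rightarrow> real"
  assumes f: "\<And>x y. \<bar>f x - f y\<bar> \<le> N * \<bar>x - y\<bar> powr \<nu>" "\<And>x. \<bar>f x\<bar> \<le> Q"
    and g: "\<And>x y. \<bar>g x - g y\<bar> \<le> L * \<bar>x - y\<bar> powr \<mu>"
    and exps: "0 < \<nu>" "0 < \<mu>" "\<mu> \<le> 1" "1 < \<nu> + \<mu>"
    and J: "\<And>t. t \<in> {a..T} \<Longrightarrow> has_gls_integral f g a t (J t)"
    and adm: "\<And>t \<alpha>. t \<in> {a<..T} \<Longrightarrow> gls_admissible \<alpha> f g a t \<Longrightarrow>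
       \<exists>\<mu>' L'. 1 - \<alpha> < \<mu>' \<and> (\<forall>x y. \<bar>g x - g y\<bar> \<le> L' * \<bar>x - y\<bar> powr \<mu>')"
  obtains C where "\<And>s t. a \<le> s \<Longrightarrow> s \<le> t \<Longrightarrow> t \<le> T \<Longrightarrow> \<bar>J t - J s\<bar> \<le> C * (t - s) powr \<mu>"
proof -
  have N: "0 \<le> N" using f(1)[of 0 1] by auto
  have L: "0 \<le> L" using g[of 0 1] by auto
  obtain G where G: "\<And>n x. (G n has_real_derivative real (Suc n) * (g (x + 1 / real (Suc n)) - g x)) (at x)"
      "\<And>n x y. \<bar>G n x - G n y\<bar> \<le> L * \<bar>x - y\<bar> powr \<mu>"
    using steklov_average[OF g exps(2)] by metis
  define h where "h n x = real (Suc n) * (g (x + 1 / real (Suc n)) - g x)" for n x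
  have fc: "continuous_on UNIV f" using f(1) exps(1) by (rule holder_imp_continuous)
  have gc: "continuous_on UNIV g" using g exps(2) by (rule holder_imp_continuous)
  have hc: "continuous_on UNIV (h n)" for n
    unfolding h_def[abs_def] by (intro continuous_intros continuous_on_compose2[OF gc]) auto
  have fhc: "continuous_on S (\<lambda>x. f x * h n x)" for n S
    by (intro continuous_intros continuous_on_subset[OF fc] continuous_on_subset[OF hc]) auto
  have int: "(\<lambda>x. f x * h n x) integrable_on {u..v}" for n u v
    by (intro integrable_continuous_interval fhc)
  have lim: "(\<lambda>n. integral {a..t} (\<lambda>x. f x * h n x)) \<longlonglongrightarrow> J t" if t: "t \<in> {a..T}" for t
  proof -
    obtain \<alpha> where gls: "gls_admissible \<alpha> f g a t"
        "J t = - (LBINT x:{a<..<t}. weyl_deriv_left \<alpha> a f x * weyl_deriv_right (1 - \<alpha>) t (\<lambda>u. g u - g t) x)"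
      using J[OF t] by (auto simp: has_gls_integral_def)
    show ?thesis
    proof (cases "t = a")
      case True
      then show ?thesis using gls(2) by (simp add: set_lebesgue_integral_def)
    next
      case False
      then have at: "a < t" using t by auto
      obtain \<mu>' L' where \<mu>': "1 - \<alpha> < \<mu>'" "\<And>x y. \<bar>g x - g y\<bar> \<le> L' * \<bar>x - y\<bar> powr \<mu>'"
        using adm[OF _ gls(1)] t at by auto
      interpret weyl_integrable \<alpha> a t Q f
      proof
        show "f \<in> borel_measurable borel" using fc by (rule borel_measurable_continuous_onI)
      qed (use gls(1) at f(2) in \<open>auto simp: gls_admissible_def\<close>)
      have "(\<integral>y. indicator {a<..<t} y * (f y * h n y) \<partial>lborel) = integral {a..t} (\<lambda>x. f x * h n x)" for n
      proof -
        have "set_integrable lborel {a..t} (\<lambda>x. f x * h n x)"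
          by (intro borel_integrable_atLeastAtMost' fhc)
        then have "set_integrable lborel {a<..<t} (\<lambda>x. f x * h n x)"
          by (rule set_integrable_subset) auto
        from set_borel_integral_eq_integral(2)[OF this]
        show ?thesis by (simp add: set_lebesgue_integral_def integral_open_interval_real)
      qed
      then show ?thesis using gls_integral_eq_lim[OF \<mu>'(2,1)] gls(2) by (simp add: h_def)
    qed
  qed
  define C0 where "C0 = N * L * (1/2) powr (\<nu> + \<mu>) / (1 - 2 * (1/2) powr (\<nu> + \<mu>))"
  have "(1/2::real) powr (\<nu> + \<mu>) < (1/2) powr 1" using exps by (intro powr_less_mono') auto
  then have C0: "0 \<le> C0" using N L by (auto simp: C0_def)
  show thesis
  proof (rule that)
    fix s t assume st: "a \<le> s" "s \<le> t" "t \<le> T"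
    have bound: "\<bar>integral {a..t} (\<lambda>x. f x * h n x) - integral {a..s} (\<lambda>x. f x * h n x)\<bar>
        \<le> (C0 * (T - a) powr \<nu> + Q * L) * (t - s) powr \<mu>" for n
    proof -
      have hint: "(h n has_integral G n t - G n s) {s..t}"
        using st G(1)[of n] by (intro fundamental_theorem_of_calculus)
          (auto simp: h_def simp flip: has_real_derivative_iff_has_vector_derivative intro: has_field_derivative_at_within)
      have i1: "(\<lambda>x. (f x - f s) * h n x) integrable_on {s..t}"
        by (intro integrable_continuous_interval continuous_intros continuous_on_subset[OF fc] continuous_on_subset[OF hc]) auto
      have "integral {a..t} (\<lambda>x. f x * h n x) - integral {a..s} (\<lambda>x. f x * h n x) = integral {s..t} (\<lambda>x. f x * h n x)"
        using Henstock_Kurzweil_Integration.integral_combine[OF st(1,2) int] by (simp add: algebra_simps)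
      also have "\<dots> = integral {s..t} (\<lambda>x. (f x - f s) * h n x + f s * h n x)"
        by (simp add: algebra_simps)
      also have "\<dots> = integral {s..t} (\<lambda>x. (f x - f s) * h n x) + f s * (G n t - G n s)"
        using hint by (subst integral_add[OF i1]) (auto intro!: integrable_on_mult_right simp: has_integral_iff integral_mult_right)
      finally have "\<bar>integral {a..t} (\<lambda>x. f x * h n x) - integral {a..s} (\<lambda>x. f x * h n x)\<bar>
          \<le> \<bar>integral {s..t} (\<lambda>x. (f x - f s) * h n x)\<bar> + \<bar>f s\<bar> * \<bar>G n t - G n s\<bar>"
        by (simp add: abs_mult[symmetric])
      also have "\<bar>integral {s..t} (\<lambda>x. (f x - f s) * h n x)\<bar> \<le> C0 * (t - s) powr (\<nu> + \<mu>)"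
        unfolding C0_def
        by (rule young_loeve_bound[OF f(1) G(2) _ hc]) (use G(1) exps st in \<open>auto simp: h_def\<close>)
      also have "\<dots> \<le> C0 * ((T - a) powr \<nu> * (t - s) powr \<mu>)"
        unfolding powr_add using C0 st exps by (intro mult_left_mono mult_right_mono powr_mono2) auto
      also have "\<bar>f s\<bar> * \<bar>G n t - G n s\<bar> \<le> Q * (L * (t - s) powr \<mu>)"
        using f(2)[of s] G(2)[of n t s] st by (intro mult_mono) auto
      finally show ?thesis by (simp add: algebra_simps)
    qed
    have "(\<lambda>n. \<bar>integral {a..t} (\<lambda>x. f x * h n x) - integral {a..s} (\<lambda>x. f x * h n x)\<bar>) \<longlonglongrightarrow> \<bar>J t - J s\<bar>"
      using st by (intro tendsto_intros lim) auto
    then show "\<bar>J t - J s\<bar> \<le> (C0 * (T - a) powr \<nu> + Q * L) * (t - s) powr \<mu>"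
      by (rule LIMSEQ_le_const2) (use bound in auto)
  qed
qed

section \<open>Increments of fractional Brownian motion\<close>

text \<open>Zero mean fixes the parameter \<open>\<mu>\<close> in both alternatives of \<open>normal_rv\<close>.\<close>

lemma (in prob_space) normal_rv_centred_cases:
  assumes Z: "normal_rv M Z" and EZ: "expectation Z = 0"
  obtains (nondegenerate) \<sigma> where "0 < \<sigma>" "distributed M lborel Z (normal_density 0 \<sigma>)"
    | (degenerate) "Z \<in> borel_measurable M" "AE \<omega> in M. Z \<omega> = 0"
  using Z unfolding normal_rv_def
proof (elim disjE exE conjE)
  fix \<mu> \<sigma> :: real assume *: "0 < \<sigma>" "distributed M lborel Z (normal_density \<mu> \<sigma>)"
  then have "\<mu> = 0" using normal_distributed_expectation[OF *] EZ by simp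
  then show thesis using * by (intro nondegenerate) auto
next
  fix \<mu> assume *: "Z \<in> borel_measurable M" "AE \<omega> in M. Z \<omega> = \<mu>"
  then have "expectation Z = (\<integral>\<omega>. \<mu> \<partial>M)" by (intro integral_cong_AE) auto
  then have "\<mu> = 0" using EZ by (simp add: prob_space)
  then show thesis using * by (intro degenerate) auto
qed

lemma (in prob_space) integrable_power_normal_rv:
  assumes Z: "normal_rv M Z" and EZ: "expectation Z = 0"
  shows "integrable M (\<lambda>\<omega>. Z \<omega> ^ k)"
proof (cases rule: normal_rv_centred_cases[OF Z EZ, case_names nondegenerate degenerate])
  case (nondegenerate \<sigma>)
  have "integrable lborel (\<lambda>x. normal_density 0 \<sigma> x * (x - 0) ^ k)"
    by (rule integrable_normal_moment[OF nondegenerate(1)])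
  then show ?thesis
    using distributed_integrable[OF nondegenerate(2), of "\<lambda>x. x ^ k"] by simp
next
  case degenerate
  note [measurable] = degenerate(1)
  have "AE \<omega> in M. 0 ^ k = Z \<omega> ^ k"
    using degenerate(2) by eventually_elim simp
  moreover have "integrable M (\<lambda>\<omega>. 0 ^ k :: real)" by simp
  ultimately show ?thesis
    by (subst integrable_cong_AE[of "\<lambda>\<omega>. Z \<omega> ^ k" M "\<lambda>\<omega>. 0 ^ k"]) auto
qed

text \<open>An increment is a linear combination of two values of a Gaussian process, hence normal. The
covariance function determines its variance \<open>(t - s) powr (2 * H)\<close>, and as this is positive the
degenerate case is excluded.\<close>

lemma (in prob_space) fbm_increment_normal:
  assumes B: "fractional_brownian_motion M H B" and st: "0 \<le> s" "s < t"
  shows "distributed M lborel (\<lambda>\<omega>. B t \<omega> - B s \<omega>) (normal_density 0 ((t - s) powr H))"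
proof -
  have B_meas [measurable]: "\<And>u. 0 \<le> u \<Longrightarrow> B u \<in> borel_measurable M"
    and B_gauss: "gaussian_process M {0..} B"
    and B_mean: "\<And>u. 0 \<le> u \<Longrightarrow> expectation (B u) = 0"
    and B_cov: "\<And>u v. 0 \<le> u \<Longrightarrow> 0 \<le> v \<Longrightarrow> expectation (\<lambda>\<omega>. B u \<omega> * B v \<omega>) =
        (u powr (2 * H) + v powr (2 * H) - \<bar>v - u\<bar> powr (2 * H)) / 2"
    using B unfolding fractional_brownian_motion_def by auto
  have B_normal: "normal_rv M (B u)" if "0 \<le> u" for u
    using B_gauss[unfolded gaussian_process_def, rule_format, of "{u}" "\<lambda>_. 1"] that by simp
  define Z where "Z \<omega> = B t \<omega> - B s \<omega>" for \<omega>
  have "normal_rv M (\<lambda>\<omega>. \<Sum>u\<in>{s, t}. (if u = t then 1 else - 1) * B u \<omega>)"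
    using B_gauss[unfolded gaussian_process_def, rule_format, of "{s, t}" "\<lambda>u. if u = t then 1 else - 1"] st
    by simp
  moreover have "(\<lambda>\<omega>. \<Sum>u\<in>{s, t}. (if u = t then 1 else - 1) * B u \<omega>) = Z"
    using st by (auto simp: Z_def fun_eq_iff)
  ultimately have Z_normal: "normal_rv M Z" by simp
  have B1: "integrable M (B u)" and B2: "integrable M (\<lambda>\<omega>. (B u \<omega>)\<^sup>2)" if "0 \<le> u" for u
    using integrable_power_normal_rv[OF B_normal B_mean, OF that that, of 1]
      integrable_power_normal_rv[OF B_normal B_mean, OF that that, of 2] by auto
  have Z_mean: "expectation Z = 0"
    unfolding Z_def[abs_def] using B1[of s] B1[of t] B_mean[of s] B_mean[of t] st by simp
  have Z2: "integrable M (\<lambda>\<omega>. (Z \<omega>)\<^sup>2)"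
    by (rule integrable_power_normal_rv[OF Z_normal Z_mean])
  have "integrable M (\<lambda>\<omega>. ((B s \<omega>)\<^sup>2 + (B t \<omega>)\<^sup>2 - (Z \<omega>)\<^sup>2) / 2)"
    using B2[of s] B2[of t] Z2 st by simp
  moreover have "(\<lambda>\<omega>. ((B s \<omega>)\<^sup>2 + (B t \<omega>)\<^sup>2 - (Z \<omega>)\<^sup>2) / 2) = (\<lambda>\<omega>. B s \<omega> * B t \<omega>)"
    by (simp add: Z_def power2_eq_square algebra_simps)
  ultimately have BB: "integrable M (\<lambda>\<omega>. B s \<omega> * B t \<omega>)" by simp
  have "expectation (\<lambda>\<omega>. (Z \<omega>)\<^sup>2) = expectation (\<lambda>\<omega>. (B t \<omega>)\<^sup>2 + (B s \<omega>)\<^sup>2 - 2 * (B s \<omega> * B t \<omega>))"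
    by (simp add: Z_def power2_eq_square algebra_simps)
  also have "\<dots> = expectation (\<lambda>\<omega>. (B t \<omega>)\<^sup>2) + expectation (\<lambda>\<omega>. (B s \<omega>)\<^sup>2) - 2 * expectation (\<lambda>\<omega>. B s \<omega> * B t \<omega>)"
    using B2[of s] B2[of t] BB st by simp
  also have "\<dots> = (t - s) powr (2 * H)"
    using B_cov[of t t] B_cov[of s s] B_cov[of s t] st by (simp add: power2_eq_square)
  finally have Z_var: "expectation (\<lambda>\<omega>. (Z \<omega>)\<^sup>2) = ((t - s) powr H)\<^sup>2"
    by (simp add: power2_eq_square flip: powr_add)
  have "distributed M lborel Z (normal_density 0 ((t - s) powr H))"
  proof (cases rule: normal_rv_centred_cases[OF Z_normal Z_mean, case_names nondegenerate degenerate])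
    case (nondegenerate \<sigma>)
    have "\<sigma>\<^sup>2 = ((t - s) powr H)\<^sup>2"
      using normal_distributed_variance[OF nondegenerate] Z_mean Z_var by simp
    then have "\<sigma> = (t - s) powr H" using nondegenerate(1) by (simp add: power2_eq_iff_nonneg)
    then show ?thesis using nondegenerate(2) by simp
  next
    case degenerate
    note [measurable] = degenerate(1)
    have "AE \<omega> in M. (Z \<omega>)\<^sup>2 = 0" using degenerate(2) by eventually_elim simp
    then have "expectation (\<lambda>\<omega>. (Z \<omega>)\<^sup>2) = 0" by (rule integral_eq_zero_AE)
    then show ?thesis using Z_var st by simp
  qed
  then show ?thesis by (simp add: Z_def[abs_def])
qed

lemma (in prob_space) fbm_increment_moment:
  assumes B: "fractional_brownian_motion M H B" and st: "0 \<le> s" "s < t"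
  shows "(\<integral>\<^sup>+\<omega>. ennreal ((B t \<omega> - B s \<omega>) ^ (2 * k)) \<partial>M) =
    ennreal (fact (2 * k) / (2 ^ k * fact k) * ((t - s) powr H) ^ (2 * k))"
proof -
  note D = fbm_increment_normal[OF assms]
  have s: "0 < (t - s) powr H" using st by simp
  have "has_bochner_integral lborel (\<lambda>x. normal_density 0 ((t - s) powr H) x * x ^ (2 * k))
      (fact (2 * k) / ((2 / ((t - s) powr H)\<^sup>2)^k * fact k))"
    using normal_moment_even[OF s, of 0 k] by simp
  moreover have "fact (2 * k) / ((2 / ((t - s) powr H)\<^sup>2)^k * fact k) =
      fact (2 * k) / (2 ^ k * fact k) * ((t - s) powr H) ^ (2 * k)"
    by (simp add: power_divide power_mult)
  ultimately have "has_bochner_integral lborel (\<lambda>x. normal_density 0 ((t - s) powr H) x * x ^ (2 * k))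
      (fact (2 * k) / (2 ^ k * fact k) * ((t - s) powr H) ^ (2 * k))" by metis
  then have "(\<integral>\<^sup>+x. ennreal (normal_density 0 ((t - s) powr H) x * x ^ (2 * k)) \<partial>lborel) =
      ennreal (fact (2 * k) / (2 ^ k * fact k) * ((t - s) powr H) ^ (2 * k))"
    by (subst nn_integral_eq_integral) (auto simp: has_bochner_integral_iff)
  then show ?thesis
    using distributed_nn_integral[OF D, of "\<lambda>x. ennreal (x ^ (2 * k))"]
    by (simp add: ennreal_mult)
qed

text \<open>The density of a centred normal law with standard deviation \<open>\<sigma>\<close> is at most \<open>1 / (2 * \<sigma>)\<close>, and the
interval in question has length \<open>2 * \<delta> * \<sigma>\<close>.\<close>

lemma (in prob_space) fbm_increment_small_ball:
  assumes B: "fractional_brownian_motion M H B" and st: "0 \<le> s" "s < t" and \<delta>: "0 \<le> \<delta>"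
  shows "prob {\<omega> \<in> space M. \<bar>B t \<omega> - B s \<omega>\<bar> < \<delta> * (t - s) powr H} \<le> \<delta>"
proof -
  note D = fbm_increment_normal[OF assms(1-3)]
  define \<sigma> where "\<sigma> = (t - s) powr H"
  have \<sigma>: "0 < \<sigma>" using st by (simp add: \<sigma>_def)
  define E where "E = {\<omega> \<in> space M. \<bar>B t \<omega> - B s \<omega>\<bar> < \<delta> * \<sigma>}"
  have "emeasure M E = emeasure M ((\<lambda>\<omega>. B t \<omega> - B s \<omega>) -` {- (\<delta> * \<sigma>)<..<\<delta> * \<sigma>} \<inter> space M)"
    by (rule arg_cong[where f = "emeasure M"]) (auto simp: E_def)
  also have "\<dots> = (\<integral>\<^sup>+x. ennreal (normal_density 0 \<sigma> x) * indicator {- (\<delta> * \<sigma>)<..<\<delta> * \<sigma>} x \<partial>lborel)"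
    unfolding \<sigma>_def by (rule distributed_emeasure[OF D]) auto
  also have "\<dots> \<le> (\<integral>\<^sup>+x. ennreal (1 / (2 * \<sigma>)) * indicator {- (\<delta> * \<sigma>)<..<\<delta> * \<sigma>} x \<partial>lborel)"
  proof (intro nn_integral_mono mult_right_mono ennreal_leI)
    fix x
    have "2 * \<sigma> = sqrt (4 * \<sigma>\<^sup>2)" using \<sigma> by (simp add: real_sqrt_mult)
    also have "\<dots> \<le> sqrt (2 * pi * \<sigma>\<^sup>2)" using pi_ge_two by (intro real_sqrt_le_mono mult_right_mono) auto
    finally have "1 / sqrt (2 * pi * \<sigma>\<^sup>2) \<le> 1 / (2 * \<sigma>)" using \<sigma> by (intro divide_left_mono) auto
    moreover have "exp (- (x - 0)\<^sup>2 / (2 * \<sigma>\<^sup>2)) \<le> 1" by simp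
    ultimately have "1 / sqrt (2 * pi * \<sigma>\<^sup>2) * exp (- (x - 0)\<^sup>2 / (2 * \<sigma>\<^sup>2)) \<le> 1 / (2 * \<sigma>) * 1"
      using \<sigma> by (intro mult_mono) auto
    then show "normal_density 0 \<sigma> x \<le> 1 / (2 * \<sigma>)" by (simp add: normal_density_def)
  qed auto
  also have "\<dots> = ennreal (1 / (2 * \<sigma>)) * ennreal (2 * (\<delta> * \<sigma>))"
    using \<sigma> \<delta> by (simp add: nn_integral_cmult)
  also have "\<dots> = ennreal \<delta>" using \<sigma> \<delta> by (simp flip: ennreal_mult)
  finally have "emeasure M E \<le> ennreal \<delta>" .
  then have "prob E \<le> \<delta>" using \<delta> by (simp add: emeasure_eq_measure)
  then show ?thesis by (simp add: E_def \<sigma>_def)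
qed

section \<open>Functions of a given Hoelder order\<close>

lemma holder_onI:
  assumes "\<And>s t. s \<in> S \<Longrightarrow> t \<in> S \<Longrightarrow> \<bar>f t - f s\<bar> \<le> L * \<bar>t - s\<bar> powr \<nu>"
  shows "holder_on S \<nu> f"
  unfolding holder_on_def
proof (intro exI[of _ "max L 1"] conjI ballI)
  fix s t assume "s \<in> S" "t \<in> S"
  then have "\<bar>f t - f s\<bar> \<le> L * \<bar>t - s\<bar> powr \<nu>" by (rule assms)
  also have "\<dots> \<le> max L 1 * \<bar>t - s\<bar> powr \<nu>" by (intro mult_right_mono) auto
  finally show "\<bar>f t - f s\<bar> \<le> max L 1 * \<bar>t - s\<bar> powr \<nu>" .
qed simp

lemma powr_le_powr_lower_exponent:
  fixes z c :: real
  assumes "0 \<le> z" "z \<le> c" "\<nu>' \<le> \<nu>"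
  shows "z powr \<nu> \<le> c powr (\<nu> - \<nu>') * z powr \<nu>'"
proof -
  have "z powr \<nu> = z powr (\<nu> - \<nu>') * z powr \<nu>'" by (simp flip: powr_add)
  also have "\<dots> \<le> c powr (\<nu> - \<nu>') * z powr \<nu>'"
    using assms by (intro mult_right_mono powr_mono2) auto
  finally show ?thesis .
qed

lemma holder_on_lower_exponent:
  assumes "holder_on {a..b} \<nu> f" "\<nu>' \<le> \<nu>"
  shows "holder_on {a..b} \<nu>' f"
proof -
  obtain L where L: "0 < L" "\<And>s t. s \<in> {a..b} \<Longrightarrow> t \<in> {a..b} \<Longrightarrow> \<bar>f t - f s\<bar> \<le> L * \<bar>t - s\<bar> powr \<nu>"
    using assms(1) by (auto simp: holder_on_def)
  show ?thesis
  proof (rule holder_onI)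
    fix s t assume st: "s \<in> {a..b}" "t \<in> {a..b}"
    then have "L * \<bar>t - s\<bar> powr \<nu> \<le> L * ((b - a) powr (\<nu> - \<nu>') * \<bar>t - s\<bar> powr \<nu>')"
      using L(1) assms(2) by (intro mult_left_mono powr_le_powr_lower_exponent) auto
    then show "\<bar>f t - f s\<bar> \<le> (L * (b - a) powr (\<nu> - \<nu>')) * \<bar>t - s\<bar> powr \<nu>'"
      using L(2)[OF st] by (simp add: mult_ac)
  qed
qed

text \<open>Over \<open>c\<close> the increment splits into the increment between the times cut off above at \<open>c\<close> and the one
between the times cut off below at \<open>c\<close>.\<close>

lemma holder_on_glue:
  assumes f: "holder_on {a..c} \<nu> f" "holder_on {c..b} \<nu> f" and \<nu>: "0 \<le> \<nu>" and acb: "a \<le> c" "c \<le> b"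
  shows "holder_on {a..b} \<nu> f"
proof -
  obtain L1 where L1: "0 < L1" "\<And>s t. s \<in> {a..c} \<Longrightarrow> t \<in> {a..c} \<Longrightarrow> \<bar>f t - f s\<bar> \<le> L1 * \<bar>t - s\<bar> powr \<nu>"
    using f(1) by (auto simp: holder_on_def)
  obtain L2 where L2: "0 < L2" "\<And>s t. s \<in> {c..b} \<Longrightarrow> t \<in> {c..b} \<Longrightarrow> \<bar>f t - f s\<bar> \<le> L2 * \<bar>t - s\<bar> powr \<nu>"
    using f(2) by (auto simp: holder_on_def)
  have ordered: "\<bar>f t - f s\<bar> \<le> (L1 + L2) * \<bar>t - s\<bar> powr \<nu>" if "s \<in> {a..b}" "t \<in> {a..b}" "s \<le> t" for s t
  proof -
    have 1: "\<bar>f (min t c) - f (min s c)\<bar> \<le> L1 * \<bar>min t c - min s c\<bar> powr \<nu>"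
      using that acb by (intro L1) auto
    also have "\<dots> \<le> L1 * \<bar>t - s\<bar> powr \<nu>"
      using L1(1) \<nu> that by (intro mult_left_mono powr_mono2) auto
    finally have 1: "\<bar>f (min t c) - f (min s c)\<bar> \<le> L1 * \<bar>t - s\<bar> powr \<nu>" .
    have "\<bar>f (max t c) - f (max s c)\<bar> \<le> L2 * \<bar>max t c - max s c\<bar> powr \<nu>"
      using that acb by (intro L2) auto
    also have "\<dots> \<le> L2 * \<bar>t - s\<bar> powr \<nu>"
      using L2(1) \<nu> that by (intro mult_left_mono powr_mono2) auto
    finally have 2: "\<bar>f (max t c) - f (max s c)\<bar> \<le> L2 * \<bar>t - s\<bar> powr \<nu>" .
    have "f t - f s = (f (min t c) - f (min s c)) + (f (max t c) - f (max s c))"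
      by (auto simp: min_def max_def)
    then show ?thesis using 1 2 unfolding distrib_right by linarith
  qed
  show ?thesis
  proof (rule holder_onI)
    fix s t assume "s \<in> {a..b}" "t \<in> {a..b}"
    then show "\<bar>f t - f s\<bar> \<le> (L1 + L2) * \<bar>t - s\<bar> powr \<nu>"
      using ordered[of s t] ordered[of t s] by (cases "s \<le> t") (auto simp: abs_minus_commute)
  qed
qed

text \<open>Clamping the argument to the interval extends the function to the whole line with the same Hoelder
estimate, as the clamp is a contraction.\<close>

lemma holder_on_clamp:
  assumes "holder_on {a..b} \<nu> f" "a \<le> b" "0 \<le> \<nu>"
  obtains L where "0 < L" "\<And>s t. \<bar>f (max a (min b s)) - f (max a (min b t))\<bar> \<le> L * \<bar>s - t\<bar> powr \<nu>"
proof -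
  obtain L where L: "0 < L" "\<And>s t. s \<in> {a..b} \<Longrightarrow> t \<in> {a..b} \<Longrightarrow> \<bar>f t - f s\<bar> \<le> L * \<bar>t - s\<bar> powr \<nu>"
    using assms(1) by (auto simp: holder_on_def)
  show thesis
  proof (rule that[OF L(1)])
    fix s t
    have "\<bar>f (max a (min b s)) - f (max a (min b t))\<bar> \<le> L * \<bar>max a (min b s) - max a (min b t)\<bar> powr \<nu>"
      using assms(2) by (intro L) auto
    also have "\<dots> \<le> L * \<bar>s - t\<bar> powr \<nu>"
      using L(1) assms(3) by (intro mult_left_mono powr_mono2) auto
    finally show "\<bar>f (max a (min b s)) - f (max a (min b t))\<bar> \<le> L * \<bar>s - t\<bar> powr \<nu>" .
  qed
qed

lemma holder_on_imp_continuous_on: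
  assumes "holder_on {a..b} \<nu> f" "0 < \<nu>"
  shows "continuous_on {a..b} f"
proof (cases "a \<le> b")
  case True
  obtain L where "\<And>s t. \<bar>f (max a (min b s)) - f (max a (min b t))\<bar> \<le> L * \<bar>s - t\<bar> powr \<nu>"
    using holder_on_clamp[OF assms(1) True less_imp_le[OF assms(2)]] by metis
  then have "continuous_on UNIV (\<lambda>s. f (max a (min b s)))"
    using assms(2) by (rule holder_imp_continuous)
  then have "continuous_on {a..b} (\<lambda>s. f (max a (min b s)))" by (rule continuous_on_subset) auto
  then show ?thesis by (rule continuous_on_eq) (auto simp: max_def min_def)
qed simp

section \<open>Hoelder continuity of the paths\<close>

lemma half_power_bracket:
  fixes z :: real
  assumes "0 < z" "z \<le> 1"
  obtains n where "(1/2) ^ Suc n < z" "z \<le> (1/2) ^ n"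
proof -
  obtain m where "(1/2) ^ m < z" using real_arch_pow_inv[of z "1/2"] assms by auto
  moreover have "(1/2::real) ^ Suc m \<le> (1/2) ^ m" by simp
  ultimately have ex: "\<exists>n. (1/2) ^ Suc n < z" by (intro exI[of _ m]) linarith
  define n where "n = (LEAST n. (1/2) ^ Suc n < z)"
  have "(1/2) ^ Suc n < z" unfolding n_def using LeastI_ex[OF ex] .
  moreover have "z \<le> (1/2) ^ n"
  proof (cases n)
    case 0
    then show ?thesis using assms by simp
  next
    case (Suc k)
    then have "\<not> (1/2) ^ Suc k < z" unfolding n_def by (intro not_less_Least) auto
    then show ?thesis using Suc by simp
  qed
  ultimately show thesis by (rule that)
qed

text \<open>Each point is the limit of its dyadic floors \<open>d n x\<close>, and consecutive floors are equal or
neighbours on the finer grid. Hence \<open>\<bar>g x - g (d n x)\<bar>\<close> is bounded by a geometric series of the size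
of its first term. Two points at distance about \<open>(1/2) ^ n\<close> have floors of level \<open>n\<close> that are equal
or neighbours.\<close>

lemma dyadic_chaining:
  fixes g :: "real \<Rightarrow> real" and N :: nat
  assumes g: "continuous_on {0..real N} g" and \<mu>: "0 < \<mu>"
    and incr: "\<And>n i. i < N * 2 ^ n \<Longrightarrow> \<bar>g (real (Suc i) / 2 ^ n) - g (real i / 2 ^ n)\<bar> \<le> C * (2 powr - \<mu>) ^ n"
  obtains L where "\<And>x y. x \<in> {0..real N} \<Longrightarrow> y \<in> {0..real N} \<Longrightarrow> \<bar>g x - g y\<bar> \<le> L * \<bar>x - y\<bar> powr \<mu>"
proof (cases "N = 0")
  case True
  show thesis by (rule that[of 0]) (use True in auto)
next
  case False
  define p where "p = 2 powr - \<mu>"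
  have p: "0 < p" "p < 1" using \<mu> powr_less_mono[of "- \<mu>" 0 2] by (auto simp: p_def)
  have C: "0 \<le> C"
    using order_trans[OF abs_ge_zero incr[of 0 0]] False by simp
  define k where "k n x = nat \<lfloor>x * 2 ^ n\<rfloor>" for n :: nat and x :: real
  define d where "d n x = real (k n x) / 2 ^ n" for n x
  have k_real: "real (k n x) = of_int \<lfloor>x * 2 ^ n\<rfloor>" if "0 \<le> x" for n x
    using that by (simp add: k_def)
  have k_le: "k n x \<le> N * 2 ^ n" if "x \<in> {0..real N}" for n x
  proof -
    have "real (k n x) \<le> x * 2 ^ n" using k_real[of x n] that by simp
    also have "\<dots> \<le> real N * 2 ^ n" using that by (intro mult_right_mono) auto
    finally have "real (k n x) \<le> real (N * 2 ^ n)" by simp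
    then show ?thesis by (simp only: of_nat_le_iff)
  qed
  have d_mem: "d n x \<in> {0..real N}" if "x \<in> {0..real N}" for n x
  proof -
    have "real (k n x) \<le> real (N * 2 ^ n)" using k_le[OF that, of n] by (simp only: of_nat_le_iff)
    then show ?thesis by (simp add: d_def field_simps)
  qed
  have d_close: "d n x \<le> x" "x - d n x \<le> (1/2) ^ n" if "0 \<le> x" for n x
  proof -
    have "of_int \<lfloor>x * 2 ^ n\<rfloor> \<le> x * 2 ^ n" "x * 2 ^ n \<le> of_int \<lfloor>x * 2 ^ n\<rfloor> + 1" by linarith+
    then have *: "real (k n x) \<le> x * 2 ^ n" "x * 2 ^ n - real (k n x) \<le> 1"
      unfolding k_real[OF that] by linarith+
    have "real (k n x) / 2 ^ n \<le> x * 2 ^ n / 2 ^ n" using *(1) by (intro divide_right_mono) auto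
    then show "d n x \<le> x" by (simp add: d_def)
    have "x - d n x = (x * 2 ^ n - real (k n x)) / 2 ^ n" by (simp add: d_def diff_divide_distrib)
    also have "\<dots> \<le> 1 / 2 ^ n" using *(2) by (intro divide_right_mono) auto
    finally show "x - d n x \<le> (1/2) ^ n" by (simp add: power_one_over)
  qed
  have step: "\<bar>g (d (Suc n) x) - g (d n x)\<bar> \<le> C * p ^ Suc n" if x: "x \<in> {0..real N}" for n x
  proof -
    have "k (Suc n) x = 2 * k n x \<or> k (Suc n) x = Suc (2 * k n x)"
    proof -
      have "\<lfloor>x * 2 ^ Suc n\<rfloor> = 2 * \<lfloor>x * 2 ^ n\<rfloor> \<or> \<lfloor>x * 2 ^ Suc n\<rfloor> = 2 * \<lfloor>x * 2 ^ n\<rfloor> + 1"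
        by (simp add: floor_eq_iff mult.assoc mult.commute[of 2]) linarith
      moreover have "0 \<le> \<lfloor>x * 2 ^ n\<rfloor>" "0 \<le> \<lfloor>x * 2 ^ Suc n\<rfloor>" using x by auto
      ultimately show ?thesis unfolding k_def by linarith
    qed
    moreover have dn: "d n x = real (2 * k n x) / 2 ^ Suc n" by (simp add: d_def)
    ultimately show ?thesis
    proof (elim disjE)
      assume "k (Suc n) x = 2 * k n x"
      then show ?thesis using C p unfolding dn by (simp add: d_def)
    next
      assume k: "k (Suc n) x = Suc (2 * k n x)"
      then have "2 * k n x < N * 2 ^ Suc n" using k_le[OF x, of "Suc n"] by simp
      moreover have "d (Suc n) x = real (Suc (2 * k n x)) / 2 ^ Suc n" by (simp only: d_def k)
      ultimately show ?thesis using incr unfolding dn p_def by (simp only:)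
    qed
  qed
  define E where "E = C / (1 - p)"
  have E: "0 \<le> E" using C p by (simp add: E_def)
  have chain: "\<bar>g (d (n + m) x) - g (d n x)\<bar> \<le> E * (p ^ n - p ^ (n + m))" if x: "x \<in> {0..real N}" for n m x
  proof (induction m)
    case (Suc m)
    have "C * p ^ Suc (n + m) \<le> C * p ^ (n + m)"
      using C p by (intro mult_left_mono power_decreasing) auto
    also have "\<dots> = E * (p ^ (n + m) - p ^ (n + Suc m))"
      using p by (simp add: E_def field_simps)
    finally show ?case
      using Suc.IH step[OF x, of "n + m"] by (simp add: algebra_simps)
  qed simp
  have approx: "\<bar>g x - g (d n x)\<bar> \<le> E * p ^ n" if x: "x \<in> {0..real N}" for n x
  proof -
    have "(\<lambda>m. x - d (n + m) x) \<longlonglongrightarrow> 0"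
    proof (rule Lim_null_comparison)
      show "eventually (\<lambda>m. norm (x - d (n + m) x) \<le> (1/2) ^ (m + n)) sequentially"
        using d_close[of x "n + _"] x by (auto simp: add.commute)
      show "(\<lambda>m. (1/2::real) ^ (m + n)) \<longlonglongrightarrow> 0"
        by (intro LIMSEQ_ignore_initial_segment LIMSEQ_power_zero) auto
    qed
    then have "(\<lambda>m. d (n + m) x) \<longlonglongrightarrow> x"
      using tendsto_diff[OF tendsto_const[of x], of "\<lambda>m. x - d (n + m) x" 0] by simp
    then have "(\<lambda>m. g (d (n + m) x)) \<longlonglongrightarrow> g x"
      using x d_mem[OF x] by (intro continuous_on_tendsto_compose[OF g]) auto
    then have "(\<lambda>m. \<bar>g (d (n + m) x) - g (d n x)\<bar>) \<longlonglongrightarrow> \<bar>g x - g (d n x)\<bar>"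
      by (intro tendsto_intros)
    moreover have "\<bar>g (d (n + m) x) - g (d n x)\<bar> \<le> E * p ^ n" for m
    proof -
      have "E * (p ^ n - p ^ (n + m)) \<le> E * p ^ n" using E p by (intro mult_left_mono) auto
      then show ?thesis using chain[OF x, of n m] by linarith
    qed
    ultimately show ?thesis by (intro LIMSEQ_le_const2) auto
  qed
  obtain Q where Q0: "0 \<le> Q" and Q: "\<And>x. x \<in> {0..real N} \<Longrightarrow> \<bar>g x\<bar> \<le> Q"
    using continuous_on_Icc_bounded[OF g] by blast
  define L where "L = 2 * Q + (2 * E + C) * 2 powr \<mu>"
  have ordered: "\<bar>g x - g y\<bar> \<le> L * \<bar>x - y\<bar> powr \<mu>"
    if x: "x \<in> {0..real N}" and y: "y \<in> {0..real N}" and xy: "x < y" for x y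
  proof (cases "y - x \<le> 1")
    case False
    then have "1 powr \<mu> \<le> \<bar>x - y\<bar> powr \<mu>" using \<mu> by (intro powr_mono2) auto
    moreover have "\<bar>g x - g y\<bar> \<le> 2 * Q" using Q[OF x] Q[OF y] by linarith
    moreover have "2 * Q \<le> L" using C E by (simp add: L_def)
    ultimately show ?thesis using mult_mono[of "2 * Q" L 1 "\<bar>x - y\<bar> powr \<mu>"] Q0 by simp
  next
    case True
    then obtain n where n: "(1/2) ^ Suc n < y - x" "y - x \<le> (1/2) ^ n"
      using half_power_bracket[of "y - x"] xy by auto
    have "k n y = k n x \<or> k n y = Suc (k n x)"
    proof -
      have "(y - x) * 2 ^ n \<le> (1/2) ^ n * 2 ^ n" using n by (intro mult_right_mono) auto
      also have "\<dots> = (1::real)" by (simp flip: power_mult_distrib)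
      finally have "y * 2 ^ n \<le> x * 2 ^ n + 1" by (simp add: algebra_simps)
      moreover have "x * 2 ^ n \<le> y * 2 ^ n" using xy by simp
      ultimately have "\<lfloor>y * 2 ^ n\<rfloor> = \<lfloor>x * 2 ^ n\<rfloor> \<or> \<lfloor>y * 2 ^ n\<rfloor> = \<lfloor>x * 2 ^ n\<rfloor> + 1" by linarith
      moreover have "0 \<le> \<lfloor>x * 2 ^ n\<rfloor>" using x by auto
      ultimately show ?thesis unfolding k_def by linarith
    qed
    then have "\<bar>g (d n y) - g (d n x)\<bar> \<le> C * p ^ n"
    proof (elim disjE)
      assume "k n y = k n x"
      then show ?thesis using C p by (simp add: d_def)
    next
      assume k: "k n y = Suc (k n x)"
      then have "k n x < N * 2 ^ n" using k_le[OF y, of n] by simp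
      from incr[OF this] show ?thesis unfolding d_def k p_def .
    qed
    then have "\<bar>g x - g y\<bar> \<le> (2 * E + C) * p ^ n"
      using approx[OF x, of n] approx[OF y, of n] by (simp add: algebra_simps)
    also have "p ^ n = 2 powr \<mu> * ((1/2) ^ Suc n) powr \<mu>"
    proof -
      have "((1/2::real) ^ Suc n) powr \<mu> = p ^ Suc n"
      proof -
        have "(1/2::real) ^ Suc n = 2 powr - real (Suc n)"
          by (simp only: powr_minus powr_realpow power_one_over zero_less_numeral) (simp only: inverse_eq_divide)
        then have "((1/2::real) ^ Suc n) powr \<mu> = 2 powr (- real (Suc n) * \<mu>)"
          by (simp only: powr_powr)
        also have "\<dots> = 2 powr (real (Suc n) * - \<mu>)"
          by (rule arg_cong[where f = "\<lambda>z. 2 powr z"]) (simp add: algebra_simps)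
        also have "\<dots> = p ^ Suc n" unfolding p_def by (rule powr_power[symmetric]) simp
        finally show ?thesis .
      qed
      moreover have "2 powr \<mu> * p = 1" by (simp add: p_def flip: powr_add)
      ultimately show ?thesis by (metis mult.assoc mult_1 power_Suc)
    qed
    also have "(2 * E + C) * (2 powr \<mu> * ((1/2) ^ Suc n) powr \<mu>) \<le> (2 * E + C) * (2 powr \<mu> * \<bar>x - y\<bar> powr \<mu>)"
      using E C n xy \<mu> by (intro mult_left_mono powr_mono2) auto
    also have "\<dots> \<le> L * \<bar>x - y\<bar> powr \<mu>"
      unfolding mult.assoc[symmetric] using Q0 by (intro mult_right_mono) (auto simp: L_def)
    finally show ?thesis .
  qed
  show thesis
  proof (rule that)
    fix x y assume "x \<in> {0..real N}" "y \<in> {0..real N}"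
    then show "\<bar>g x - g y\<bar> \<le> L * \<bar>x - y\<bar> powr \<mu>"
      using ordered[of x y] ordered[of y x] by (cases x y rule: linorder_cases) (auto simp: abs_minus_commute)
  qed
qed

text \<open>The argument of Kolmogorov. The expected value of the sum over all \<open>n\<close> and all dyadic increments
of level \<open>n\<close>, each raised to the power \<open>2 * m\<close> after multiplication by \<open>2 powr (\<mu> * n)\<close>, is a
geometric series with ratio \<open>r = 2 powr (1 - 2 * m * (H - \<mu>))\<close>. For large \<open>m\<close> the ratio is below one.
Then the sum is almost surely finite, each of its terms is bounded by the sum, and the paths, being
continuous, fall under \<open>dyadic_chaining\<close>.\<close>

lemma (in prob_space) fbm_holder:
  assumes B: "fractional_brownian_motion M H B" and \<mu>: "0 < \<mu>" "\<mu> < H"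
  shows "AE \<omega> in M. \<exists>L. \<forall>x\<in>{0..real N}. \<forall>y\<in>{0..real N}. \<bar>B x \<omega> - B y \<omega>\<bar> \<le> L * \<bar>x - y\<bar> powr \<mu>"
proof -
  have B_meas [measurable]: "\<And>u. 0 \<le> u \<Longrightarrow> B u \<in> borel_measurable M"
    and B_cont: "AE \<omega> in M. continuous_on {0..} (\<lambda>t. B t \<omega>)"
    using B unfolding fractional_brownian_motion_def by auto
  obtain m :: nat where m: "1 / (H - \<mu>) < real m" using reals_Archimedean2 by blast
  then have m_gt: "1 < real m * (H - \<mu>)" using \<mu> by (simp add: field_simps)
  define c :: real where "c = fact (2 * m) / (2 ^ m * fact m)"
  define r :: real where "r = 2 powr (1 - real (2 * m) * (H - \<mu>))"
  have "1 < real (2 * m) * (H - \<mu>)" using m_gt by simp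
  then have r: "0 < r" "r < 1" unfolding r_def
    using powr_less_mono[of "1 - real (2 * m) * (H - \<mu>)" 0 2] by auto
  define \<Delta> where "\<Delta> n i \<omega> = B (real (Suc i) / 2 ^ n) \<omega> - B (real i / 2 ^ n) \<omega>" for n i \<omega>
  define V where "V n i \<omega> = ennreal ((2 powr \<mu>) ^ n * \<bar>\<Delta> n i \<omega>\<bar>) ^ (2 * m)" for n i \<omega>
  have [measurable]: "V n i \<in> borel_measurable M" for n i
    unfolding V_def \<Delta>_def by measurable
  have V_int: "(\<integral>\<^sup>+\<omega>. V n i \<omega> \<partial>M) = ennreal (c * (r / 2) ^ n)" for n i
  proof -
    have diff: "real (Suc i) / 2 ^ n - real i / 2 ^ n = 1 / 2 ^ n" by (simp add: field_simps)
    have "(\<integral>\<^sup>+\<omega>. V n i \<omega> \<partial>M) = (\<integral>\<^sup>+\<omega>. ennreal (((2 powr \<mu>) ^ n) ^ (2 * m)) * ennreal ((\<Delta> n i \<omega>) ^ (2 * m)) \<partial>M)"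
      by (intro nn_integral_cong) (simp add: V_def ennreal_power power_mult_distrib power_even_abs flip: ennreal_mult)
    also have "\<dots> = ennreal (((2 powr \<mu>) ^ n) ^ (2 * m)) * (\<integral>\<^sup>+\<omega>. ennreal ((\<Delta> n i \<omega>) ^ (2 * m)) \<partial>M)"
      unfolding \<Delta>_def by (intro nn_integral_cmult) measurable
    also have "(\<integral>\<^sup>+\<omega>. ennreal ((\<Delta> n i \<omega>) ^ (2 * m)) \<partial>M) = ennreal (c * ((1 / 2 ^ n) powr H) ^ (2 * m))"
      unfolding \<Delta>_def c_def
      using fbm_increment_moment[OF B, of "real i / 2 ^ n" "real (Suc i) / 2 ^ n" m]
      by (simp add: divide_strict_right_mono diff[simplified])
    also have "ennreal (((2 powr \<mu>) ^ n) ^ (2 * m)) * \<dots> = ennreal (c * (((2 powr \<mu>) ^ n * (1 / 2 ^ n) powr H) ^ (2 * m)))"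
      by (simp add: c_def power_mult_distrib mult_ac flip: ennreal_mult)
    also have "((2 powr \<mu>) ^ n * (1 / 2 ^ n) powr H) ^ (2 * m) = (r / 2) ^ n"
    proof -
      have "(2 powr \<mu>) ^ n * (1 / 2 ^ n) powr H = 2 powr (real n * (\<mu> - H))"
        by (simp add: powr_divide powr_power algebra_simps powr_diff powr_powr mult.commute flip: powr_realpow)
      moreover have "r / 2 = 2 powr (- real (2 * m) * (H - \<mu>))"
      proof -
        have "r / 2 powr 1 = 2 powr (- real (2 * m) * (H - \<mu>))"
          unfolding r_def powr_diff[symmetric] by simp
        then show ?thesis by simp
      qed
      moreover have pw: "(2 powr a) ^ k = 2 powr (real k * a)" for a :: real and k
        by (simp add: powr_power)
      have "(2 powr (real n * (\<mu> - H))) ^ (2 * m) = (2 powr (- real (2 * m) * (H - \<mu>))) ^ n"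
        unfolding pw by (rule arg_cong[where f = "\<lambda>z. 2 powr z"]) (simp add: algebra_simps)
      ultimately show ?thesis by (simp only:)
    qed
    finally show ?thesis .
  qed
  have "(\<integral>\<^sup>+\<omega>. (\<Sum>n. \<Sum>i<N * 2 ^ n. V n i \<omega>) \<partial>M) = (\<Sum>n. \<Sum>i<N * 2 ^ n. (\<integral>\<^sup>+\<omega>. V n i \<omega> \<partial>M))"
    by (simp add: nn_integral_suminf nn_integral_sum)
  also have "\<dots> = (\<Sum>n. ennreal (real N * c * r ^ n))"
  proof (intro suminf_cong)
    fix n
    have "(\<Sum>i<N * 2 ^ n. (\<integral>\<^sup>+\<omega>. V n i \<omega> \<partial>M)) = ennreal (\<Sum>i<N * 2 ^ n. c * (r / 2) ^ n)"
      unfolding V_int using r by (intro sum_ennreal) (auto simp: c_def)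
    also have "(\<Sum>i<N * 2 ^ n. c * (r / 2) ^ n) = real N * c * r ^ n"
      by (simp add: power_divide)
    finally show "(\<Sum>i<N * 2 ^ n. (\<integral>\<^sup>+\<omega>. V n i \<omega> \<partial>M)) = ennreal (real N * c * r ^ n)" .
  qed
  also have "\<dots> \<noteq> \<infinity>"
    using r by (subst suminf_ennreal2) (auto simp: c_def intro!: summable_mult summable_geometric)
  finally have "AE \<omega> in M. (\<Sum>n. \<Sum>i<N * 2 ^ n. V n i \<omega>) \<noteq> \<infinity>"
    by (intro nn_integral_PInf_AE) auto
  with B_cont show ?thesis
  proof eventually_elim
    case (elim \<omega>)
    then obtain A where A: "0 \<le> A" "(\<Sum>n. \<Sum>i<N * 2 ^ n. V n i \<omega>) = ennreal A"
      by (cases "\<Sum>n. \<Sum>i<N * 2 ^ n. V n i \<omega>") (auto simp: top_ennreal_def)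
    have "\<bar>B (real (Suc i) / 2 ^ n) \<omega> - B (real i / 2 ^ n) \<omega>\<bar> \<le> max 1 A * (2 powr - \<mu>) ^ n"
      if i: "i < N * 2 ^ n" for n i
    proof -
      define z where "z = (2 powr \<mu>) ^ n * \<bar>\<Delta> n i \<omega>\<bar>"
      have "V n i \<omega> \<le> (\<Sum>i<N * 2 ^ n. V n i \<omega>)"
        using i by (intro member_le_sum) auto
      also have "\<dots> \<le> (\<Sum>n. \<Sum>i<N * 2 ^ n. V n i \<omega>)"
        using sum_le_suminf[OF summableI, of "{n}" "\<lambda>n. \<Sum>i<N * 2 ^ n. V n i \<omega>"] by simp
      finally have "V n i \<omega> \<le> ennreal A" unfolding A(2) .
      then have "ennreal (z ^ (2 * m)) \<le> ennreal A"
        by (simp add: V_def z_def ennreal_power)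
      then have zA: "z ^ (2 * m) \<le> A" using A(1) by simp
      have "z \<le> max 1 A"
      proof (cases "z \<le> 1")
        case False
        have "0 < m" using m_gt by (cases m) auto
        then have "z ^ 1 \<le> z ^ (2 * m)" using False by (intro power_increasing) auto
        then show ?thesis using zA by simp
      qed simp
      then have "z * (2 powr - \<mu>) ^ n \<le> max 1 A * (2 powr - \<mu>) ^ n" by (intro mult_right_mono) auto
      moreover have "z * (2 powr - \<mu>) ^ n = \<bar>\<Delta> n i \<omega>\<bar>"
      proof -
        have "(2 powr \<mu>) ^ n * (2 powr - \<mu>) ^ n = 1"
          by (simp flip: power_mult_distrib powr_add)
        then show ?thesis by (simp add: z_def)
      qed
      ultimately show ?thesis by (simp add: \<Delta>_def)
    qed
    moreover have "continuous_on {0..real N} (\<lambda>t. B t \<omega>)"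
      using elim(1) by (rule continuous_on_subset) auto
    ultimately show ?case using dyadic_chaining[of N "\<lambda>t. B t \<omega>" \<mu> "max 1 A"] \<mu>(1) by metis
  qed
qed

lemma (in prob_space) fbm_paths_holder:
  assumes B: "fractional_brownian_motion M H B" and H: "0 < H"
  shows "AE \<omega> in M. \<forall>\<mu>. 0 < \<mu> \<longrightarrow> \<mu> < H \<longrightarrow> holder_on {0..T} \<mu> (\<lambda>t. B t \<omega>)"
proof -
  obtain N :: nat where N: "T \<le> real N" using real_arch_simple by blast
  \<comment> \<open>Countably many orders that increase to \<open>H\<close> control all orders below \<open>H\<close>.\<close>
  define m where "m k = H * (1 - 1 / real (k + 2))" for k
  have m: "0 < m k" "m k < H" for k
    using H by (auto simp: m_def intro!: mult_pos_pos)
  have "AE \<omega> in M. \<forall>k. \<exists>L. \<forall>x\<in>{0..real N}. \<forall>y\<in>{0..real N}. \<bar>B x \<omega> - B y \<omega>\<bar> \<le> L * \<bar>x - y\<bar> powr m k"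
    unfolding AE_all_countable using fbm_holder[OF B m] by blast
  then show ?thesis
  proof eventually_elim
    case (elim \<omega>)
    show ?case
    proof (intro allI impI)
      fix \<mu> assume \<mu>: "0 < \<mu>" "\<mu> < H"
      obtain k :: nat where "H / (H - \<mu>) < real k" using reals_Archimedean2 by blast
      then have "H < (H - \<mu>) * real (k + 2)" using \<mu> by (simp add: field_simps)
      then have "\<mu> \<le> m k" by (simp add: m_def field_simps)
      moreover have "holder_on {0..T} (m k) (\<lambda>t. B t \<omega>)"
      proof -
        obtain L where L: "\<And>x y. x \<in> {0..real N} \<Longrightarrow> y \<in> {0..real N} \<Longrightarrow> \<bar>B x \<omega> - B y \<omega>\<bar> \<le> L * \<bar>x - y\<bar> powr m k"
          using elim by blast
        show ?thesis using N by (intro holder_onI[of _ _ L] L) auto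
      qed
      ultimately show "holder_on {0..T} \<mu> (\<lambda>t. B t \<omega>)" by (rule holder_on_lower_exponent[rotated])
    qed
  qed
qed

section \<open>Roughness of the paths\<close>

text \<open>By continuity, \<open>Z y\<close> is the limit of \<open>Z\<close> at grid points approaching \<open>y\<close>, and these take countably
many values.\<close>

lemma measurable_pair_of_continuous_paths:
  fixes Z :: "real \<Rightarrow> 'a \<Rightarrow> real"
  assumes cont: "\<And>\<omega>. \<omega> \<in> space M \<Longrightarrow> continuous_on UNIV (\<lambda>y. Z y \<omega>)"
    and [measurable]: "\<And>y. Z y \<in> borel_measurable M"
  shows "(\<lambda>(\<omega>, y). Z y \<omega>) \<in> borel_measurable (M \<Otimes>\<^sub>M lborel)"
proof (rule borel_measurable_LIMSEQ_real)
  let ?q = "\<lambda>n y. of_int \<lfloor>real (Suc n) * y\<rfloor> / real (Suc n)"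
  show "(\<lambda>(\<omega>, y). Z (?q n y) \<omega>) \<in> borel_measurable (M \<Otimes>\<^sub>M lborel)" for n
  proof -
    have "(\<lambda>z. Z (of_int i / real (Suc n)) (fst z)) \<in> borel_measurable (M \<Otimes>\<^sub>M lborel)" for i
      by measurable
    moreover have "(\<lambda>z :: 'a \<times> real. \<lfloor>real (Suc n) * snd z\<rfloor>) \<in> measurable (M \<Otimes>\<^sub>M lborel) (count_space UNIV)"
      by measurable
    ultimately have "(\<lambda>z. Z (of_int \<lfloor>real (Suc n) * snd z\<rfloor> / real (Suc n)) (fst z)) \<in> borel_measurable (M \<Otimes>\<^sub>M lborel)"
      by (rule measurable_compose_countable)
    then show ?thesis by (simp add: case_prod_beta')
  qed
  fix z :: "'a \<times> real" assume z: "z \<in> space (M \<Otimes>\<^sub>M lborel)"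
  obtain \<omega> y where zz: "z = (\<omega>, y)" by force
  then have \<omega>: "\<omega> \<in> space M" using z by (simp add: space_pair_measure)
  have "(\<lambda>n. ?q n y) \<longlonglongrightarrow> y"
  proof -
    have "\<bar>?q n y - y\<bar> \<le> 1 / real (Suc n)" for n
    proof -
      have "?q n y - y = (of_int \<lfloor>real (Suc n) * y\<rfloor> - real (Suc n) * y) / real (Suc n)"
        by (simp add: diff_divide_distrib)
      moreover have "\<bar>of_int \<lfloor>real (Suc n) * y\<rfloor> - real (Suc n) * y\<bar> \<le> 1" by linarith
      ultimately show ?thesis by (simp add: divide_right_mono)
    qed
    then have "(\<lambda>n. ?q n y - y) \<longlonglongrightarrow> 0"
      using LIMSEQ_Suc[OF lim_1_over_n] by (intro Lim_null_comparison[of "\<lambda>n. ?q n y - y" "\<lambda>n. 1 / real (Suc n)"]) auto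
    then show ?thesis by (simp only: LIM_zero_iff)
  qed
  then have "(\<lambda>n. Z (?q n y) \<omega>) \<longlonglongrightarrow> Z y \<omega>"
    by (intro continuous_on_tendsto_compose[OF cont[OF \<omega>]]) auto
  then show "(\<lambda>n. case z of (\<omega>, y) \<Rightarrow> Z (?q n y) \<omega>) \<longlonglongrightarrow> (case z of (\<omega>, y) \<Rightarrow> Z y \<omega>)"
    by (simp add: zz)
qed

lemma nn_integral_inverse_infinite:
  fixes x t :: real
  assumes "x < t"
  shows "(\<integral>\<^sup>+y. indicator {x<..<t} y * ennreal (1 / (y - x)) \<partial>lborel) = \<infinity>"
proof (rule ccontr)
  let ?I = "\<integral>\<^sup>+y. indicator {x<..<t} y * ennreal (1 / (y - x)) \<partial>lborel"
  assume "?I \<noteq> \<infinity>"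
  then obtain A where A: "0 \<le> A" "?I = ennreal A" by (cases ?I) (auto simp: top_ennreal_def)
  define e where "e = (t - x) * exp (- (A + 1))"
  have "exp (- (A + 1)) < 1" using A by simp
  then have e: "0 < e" "e < t - x" using assms by (auto simp: e_def)
  have "(\<integral>\<^sup>+y. ennreal (1 / (y - x)) * indicator {x + e..t} y \<partial>lborel) = ennreal (ln (t - x) - ln (x + e - x))"
    using e by (intro nn_integral_FTC_Icc) (auto intro!: derivative_eq_intros DERIV_imp_deriv simp: divide_simps)
  also have "ln (t - x) - ln (x + e - x) = A + 1"
    using assms by (simp add: e_def ln_mult)
  finally have "ennreal (A + 1) = (\<integral>\<^sup>+y. ennreal (1 / (y - x)) * indicator {x + e..t} y \<partial>lborel)" ..
  also have "\<dots> = (\<integral>\<^sup>+y. ennreal (1 / (y - x)) * indicator {x + e..<t} y \<partial>lborel)"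
    using AE_lborel_singleton[of t] by (intro nn_integral_cong_AE) (auto simp: indicator_def elim!: eventually_mono)
  also have "\<dots> \<le> ?I"
    using e by (intro nn_integral_mono) (auto simp: indicator_def)
  finally show False unfolding A(2) using A(1) by simp
qed

text \<open>Let \<open>V\<close> be the integral of the absolute value of the quotient, and suppose that \<open>V \<le> n\<close> on an event
\<open>A\<close> of positive probability. By \<open>fbm_increment_small_ball\<close> with \<open>\<delta>\<close> half the probability of \<open>A\<close>, the
normalised increment \<open>\<bar>B x - B y\<bar> / (y - x) powr H\<close> is at least \<open>\<delta>\<close> on a part of \<open>A\<close> of probability at
least \<open>\<delta>\<close>, whatever \<open>y\<close> is. By Tonelli the expectation of \<open>V\<close> over \<open>A\<close> is then at least \<open>\<delta>\<^sup>2\<close> times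
the divergent integral of \<open>1 / (y - x)\<close>, although it is at most \<open>n\<close>.\<close>

lemma (in prob_space) fbm_difference_quotient_not_integrable:
  assumes B: "fractional_brownian_motion M H B" and x: "0 \<le> x" "x < t"
  shows "AE \<omega> in M. \<not> set_integrable lborel {x<..<t} (\<lambda>y. (B x \<omega> - B y \<omega>) / (y - x) powr (1 + H))"
proof -
  have B_meas [measurable]: "\<And>u. 0 \<le> u \<Longrightarrow> B u \<in> borel_measurable M"
    and B_cont: "AE \<omega> in M. continuous_on {0..} (\<lambda>t. B t \<omega>)"
    using B unfolding fractional_brownian_motion_def by auto
  obtain N where N: "N \<in> null_sets M" "{\<omega> \<in> space M. \<not> continuous_on {0..} (\<lambda>t. B t \<omega>)} \<subseteq> N"
    using B_cont by (auto simp: eventually_ae_filter)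
  have [measurable]: "N \<in> sets M" using N by auto
  \<comment> \<open>Joint measurability is obtained from continuity of all paths: the increments are set to zero on
    the null set \<open>N\<close>, and the path is continued to negative times by its value at \<open>0\<close>.\<close>
  define Z where "Z y \<omega> = indicator (space M - N) \<omega> * (B x \<omega> - B (max y 0) \<omega>)" for y \<omega>
  have Z_meas [measurable]: "Z y \<in> borel_measurable M" for y
    unfolding Z_def using x by measurable
  have Z_pair [measurable]: "(\<lambda>(\<omega>, y). Z y \<omega>) \<in> borel_measurable (M \<Otimes>\<^sub>M lborel)"
  proof (rule measurable_pair_of_continuous_paths[OF _ Z_meas])
    fix \<omega> assume "\<omega> \<in> space M"
    show "continuous_on UNIV (\<lambda>y. Z y \<omega>)"
    proof (cases "\<omega> \<in> N")
      case True
      then show ?thesis by (simp add: Z_def)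
    next
      case False
      then have "continuous_on {0..} (\<lambda>t. B t \<omega>)" using N \<open>\<omega> \<in> space M\<close> by auto
      then have "continuous_on UNIV (\<lambda>y. B (max y 0) \<omega>)"
        by (rule continuous_on_compose2) (auto intro!: continuous_intros)
      then show ?thesis unfolding Z_def by (intro continuous_intros)
    qed
  qed
  have AE_N: "AE \<omega> in M. \<omega> \<notin> N" using N(1) by (rule AE_not_in)
  define k where "k y = indicator {x<..<t} y * (y - x) powr - (1 + H)" for y
  have [measurable]: "k \<in> borel_measurable borel" unfolding k_def[abs_def] by measurable
  have k_nonneg: "0 \<le> k y" for y by (simp add: k_def)
  define V where "V \<omega> = (\<integral>\<^sup>+y. ennreal (k y * \<bar>Z y \<omega>\<bar>) \<partial>lborel)" for \<omega>
  have [measurable]: "V \<in> borel_measurable M"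
    unfolding V_def by measurable
  have null: "emeasure M {\<omega> \<in> space M. V \<omega> \<le> ennreal (real n)} = 0" for n
  proof (rule ccontr)
    define A where "A = {\<omega> \<in> space M. V \<omega> \<le> ennreal (real n)}"
    have [measurable]: "A \<in> sets M" unfolding A_def by measurable
    assume "emeasure M {\<omega> \<in> space M. V \<omega> \<le> ennreal (real n)} \<noteq> 0"
    then have p: "0 < prob A" by (simp add: A_def emeasure_eq_measure zero_less_measure_iff)
    define \<delta> where "\<delta> = prob A / 2"
    have \<delta>: "0 < \<delta>" using p by (simp add: \<delta>_def)
    have lower: "ennreal (\<delta> * \<delta> * (y - x) powr H) \<le> (\<integral>\<^sup>+\<omega>. ennreal (indicator A \<omega> * \<bar>Z y \<omega>\<bar>) \<partial>M)"
      if y: "y \<in> {x<..<t}" for y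
    proof -
      define s where "s = \<delta> * (y - x) powr H"
      have s: "0 < s" using \<delta> y by (simp add: s_def)
      define S where "S = {\<omega> \<in> space M. \<bar>B y \<omega> - B x \<omega>\<bar> < s}"
      have "B x \<in> borel_measurable M" "B y \<in> borel_measurable M" using x y by auto
      note [measurable] = this
      have [measurable]: "S \<in> sets M" unfolding S_def by measurable
      have "prob S \<le> \<delta>"
        unfolding S_def s_def using fbm_increment_small_ball[OF B x(1), of y \<delta>] y \<delta> by simp
      moreover have "prob A \<le> prob (A - S) + prob S"
      proof -
        have "prob A \<le> prob ((A - S) \<union> S)" by (intro finite_measure_mono) auto
        also have "\<dots> \<le> prob (A - S) + prob S" by (intro measure_Un_le) auto
        finally show ?thesis .
      qed
      ultimately have AS: "\<delta> \<le> prob (A - S)" by (simp add: \<delta>_def)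
      have "ennreal (\<delta> * \<delta> * (y - x) powr H) = ennreal s * ennreal \<delta>"
        using \<delta> by (simp add: s_def mult_ac flip: ennreal_mult)
      also have "\<dots> \<le> ennreal s * emeasure M (A - S)"
        using AS by (simp add: emeasure_eq_measure mult_left_mono)
      also have "\<dots> = (\<integral>\<^sup>+\<omega>. ennreal s * indicator (A - S) \<omega> \<partial>M)"
        by (simp add: nn_integral_cmult)
      also have "\<dots> \<le> (\<integral>\<^sup>+\<omega>. ennreal (indicator A \<omega> * \<bar>Z y \<omega>\<bar>) \<partial>M)"
      proof (rule nn_integral_mono_AE)
        show "AE \<omega> in M. ennreal s * indicator (A - S) \<omega> \<le> ennreal (indicator A \<omega> * \<bar>Z y \<omega>\<bar>)"
          using AE_N AE_space
        proof eventually_elim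
          case (elim \<omega>)
          then have "\<bar>Z y \<omega>\<bar> = \<bar>B y \<omega> - B x \<omega>\<bar>" using x y by (simp add: Z_def max_def abs_minus_commute)
          then show ?case using elim by (auto simp: S_def indicator_def intro!: ennreal_leI)
        qed
      qed
      finally show ?thesis .
    qed
    have "\<infinity> = ennreal (\<delta> * \<delta>) * (\<integral>\<^sup>+y. indicator {x<..<t} y * ennreal (1 / (y - x)) \<partial>lborel)"
      using \<delta> by (subst nn_integral_inverse_infinite[OF x(2)]) (auto simp: ennreal_mult_eq_top_iff)
    also have "\<dots> = (\<integral>\<^sup>+y. ennreal (\<delta> * \<delta>) * (indicator {x<..<t} y * ennreal (1 / (y - x))) \<partial>lborel)"
      by (intro nn_integral_cmult[symmetric]) measurable
    also have "\<dots> = (\<integral>\<^sup>+y. ennreal (k y) * ennreal (\<delta> * \<delta> * (y - x) powr H) \<partial>lborel)"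
    proof (intro nn_integral_cong)
      fix y
      have "(y - x) powr - (1 + H) * (y - x) powr H = 1 / (y - x)" if "x < y"
        using that by (simp add: powr_minus_divide flip: powr_add)
      then show "ennreal (\<delta> * \<delta>) * (indicator {x<..<t} y * ennreal (1 / (y - x))) = ennreal (k y) * ennreal (\<delta> * \<delta> * (y - x) powr H)"
        using \<delta> by (cases "y \<in> {x<..<t}") (auto simp: k_def mult_ac simp flip: ennreal_mult)
    qed
    also have "\<dots> \<le> (\<integral>\<^sup>+y. ennreal (k y) * (\<integral>\<^sup>+\<omega>. ennreal (indicator A \<omega> * \<bar>Z y \<omega>\<bar>) \<partial>M) \<partial>lborel)"
    proof (intro nn_integral_mono)
      fix y show "ennreal (k y) * ennreal (\<delta> * \<delta> * (y - x) powr H) \<le> ennreal (k y) * (\<integral>\<^sup>+\<omega>. ennreal (indicator A \<omega> * \<bar>Z y \<omega>\<bar>) \<partial>M)"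
        using lower[of y] by (cases "y \<in> {x<..<t}") (auto simp: k_def intro!: mult_left_mono)
    qed
    also have "\<dots> = (\<integral>\<^sup>+y. (\<integral>\<^sup>+\<omega>. ennreal (k y) * ennreal (indicator A \<omega> * \<bar>Z y \<omega>\<bar>) \<partial>M) \<partial>lborel)"
      by (intro nn_integral_cong nn_integral_cmult[symmetric]) measurable
    also have "\<dots> = (\<integral>\<^sup>+\<omega>. (\<integral>\<^sup>+y. ennreal (k y) * ennreal (indicator A \<omega> * \<bar>Z y \<omega>\<bar>) \<partial>lborel) \<partial>M)"
    proof -
      interpret pair_sigma_finite M lborel ..
      have "(\<lambda>(\<omega>, y). ennreal (k y) * ennreal (indicator A \<omega> * \<bar>Z y \<omega>\<bar>)) \<in> borel_measurable (M \<Otimes>\<^sub>M lborel)"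
        by measurable
      from Fubini'[OF this] show ?thesis .
    qed
    also have "\<dots> = (\<integral>\<^sup>+\<omega>. indicator A \<omega> * V \<omega> \<partial>M)"
      by (intro nn_integral_cong) (auto simp: V_def indicator_def k_nonneg simp flip: ennreal_mult)
    also have "\<dots> \<le> (\<integral>\<^sup>+\<omega>. ennreal (real n) \<partial>M)"
      by (intro nn_integral_mono) (auto simp: indicator_def A_def)
    also have "\<dots> = ennreal (real n)" by (simp add: emeasure_space_1)
    finally show False by (simp add: top_unique)
  qed
  have "AE \<omega> in M. \<forall>n::nat. \<not> V \<omega> \<le> ennreal (real n)"
    unfolding AE_all_countable
  proof
    fix n :: nat
    show "AE \<omega> in M. \<not> V \<omega> \<le> ennreal (real n)"
      using null[of n] by (subst AE_iff_measurable[OF _ refl]) auto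
  qed
  with AE_N AE_space show ?thesis
  proof eventually_elim
    case (elim \<omega>)
    show ?case
    proof
      assume int: "set_integrable lborel {x<..<t} (\<lambda>y. (B x \<omega> - B y \<omega>) / (y - x) powr (1 + H))"
      have "V \<omega> = (\<integral>\<^sup>+y. ennreal (norm (indicator {x<..<t} y *\<^sub>R ((B x \<omega> - B y \<omega>) / (y - x) powr (1 + H)))) \<partial>lborel)"
        unfolding V_def
      proof (intro nn_integral_cong arg_cong[where f = ennreal])
        fix y show "k y * \<bar>Z y \<omega>\<bar> = norm (indicator {x<..<t} y *\<^sub>R ((B x \<omega> - B y \<omega>) / (y - x) powr (1 + H)))"
        proof (cases "y \<in> {x<..<t}")
          case True
          have "(y - x) powr - (1 + H) = 1 / (y - x) powr (1 + H)" by (rule powr_minus_divide)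
          then show ?thesis using True elim x by (simp only: k_def) (simp add: Z_def max_def abs_divide)
        qed (simp add: k_def)
      qed
      also have "\<dots> < \<infinity>"
        using int by (auto simp: set_integrable_def integrable_iff_bounded)
      finally obtain v where v: "0 \<le> v" "V \<omega> = ennreal v"
        by (cases "V \<omega>") auto
      obtain n :: nat where "v \<le> real n" using real_arch_simple by blast
      then have "V \<omega> \<le> ennreal (real n)" unfolding v(2) by (rule ennreal_leI)
      then show False using elim by simp
    qed
  qed
qed

lemma (in prob_space) fbm_paths_rough:
  assumes B: "fractional_brownian_motion M H B"
  shows "AE \<omega> in M. \<forall>x\<in>\<rat>. \<forall>u\<in>\<rat>. 0 < x \<longrightarrow> x < u \<longrightarrow>
    \<not> set_integrable lborel {x<..<u} (\<lambda>y. (B x \<omega> - B y \<omega>) / (y - x) powr (1 + H))"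
proof (intro AE_ball_countable' countable_rat)
  fix x u :: real
  show "AE \<omega> in M. 0 < x \<longrightarrow> x < u \<longrightarrow>
      \<not> set_integrable lborel {x<..<u} (\<lambda>y. (B x \<omega> - B y \<omega>) / (y - x) powr (1 + H))"
    using fbm_difference_quotient_not_integrable[OF B, of x u] by (cases "0 < x \<and> x < u") auto
qed

section \<open>Coefficients along a path\<close>

lemma gls_admissible_cong:
  assumes f: "\<And>x. x \<in> {a<..<b} \<Longrightarrow> f x = f' x" and g: "\<And>x. x \<in> {a<..b} \<Longrightarrow> g x = g' x"
  shows "gls_admissible \<alpha> f g a b \<longleftrightarrow> gls_admissible \<alpha> f' g' a b"
proof -
  have R: "weyl_deriv_right (1 - \<alpha>) b (\<lambda>u. g u - g b) x = weyl_deriv_right (1 - \<alpha>) b (\<lambda>u. g' u - g' b) x"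
    if "x \<in> {a<..<b}" for x
    unfolding weyl_deriv_right_def using that g by (auto intro!: set_lebesgue_integral_cong arg_cong2[where f = "(/)"] arg_cong2[where f = "(+)"])
  have "set_integrable lborel {a<..<b} (\<lambda>x. f x / (x - a) powr \<alpha>) \<longleftrightarrow>
      set_integrable lborel {a<..<b} (\<lambda>x. f' x / (x - a) powr \<alpha>)"
    by (intro set_integrable_cong) (auto simp: f)
  moreover have "set_integrable (lborel \<Otimes>\<^sub>M lborel) {(x, y). a < y \<and> y < x \<and> x < b} (\<lambda>(x, y). (f x - f y) / (x - y) powr (1 + \<alpha>)) \<longleftrightarrow>
      set_integrable (lborel \<Otimes>\<^sub>M lborel) {(x, y). a < y \<and> y < x \<and> x < b} (\<lambda>(x, y). (f' x - f' y) / (x - y) powr (1 + \<alpha>))"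
    by (intro set_integrable_cong) (auto simp: f)
  moreover have "set_integrable lborel {x<..<b} (\<lambda>y. (g x - g y) / (y - x) powr (2 - \<alpha>)) \<longleftrightarrow>
     set_integrable lborel {x<..<b} (\<lambda>y. (g' x - g' y) / (y - x) powr (2 - \<alpha>))" if "x \<in> {a<..<b}" for x
    using that by (intro set_integrable_cong) (auto simp: g)
  moreover have "weyl_deriv_right (1 - \<alpha>) b (\<lambda>x. g x - g b) ` {a<..<b} = weyl_deriv_right (1 - \<alpha>) b (\<lambda>x. g' x - g' b) ` {a<..<b}"
    using R by (intro image_cong) auto
  ultimately show ?thesis unfolding gls_admissible_def by auto
qed

lemma has_gls_integral_cong:
  assumes f: "\<And>x. x \<in> {a<..<b} \<Longrightarrow> f x = f' x" and g: "\<And>x. x \<in> {a<..b} \<Longrightarrow> g x = g' x"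
  shows "has_gls_integral f g a b I \<longleftrightarrow> has_gls_integral f' g' a b I"
proof -
  have "(LBINT x:{a<..<b}. weyl_deriv_left \<alpha> a f x * weyl_deriv_right (1 - \<alpha>) b (\<lambda>u. g u - g b) x) =
     (LBINT x:{a<..<b}. weyl_deriv_left \<alpha> a f' x * weyl_deriv_right (1 - \<alpha>) b (\<lambda>u. g' u - g' b) x)" for \<alpha>
  proof (rule set_lebesgue_integral_cong)
    show "\<forall>x. x \<in> {a<..<b} \<longrightarrow> weyl_deriv_left \<alpha> a f x * weyl_deriv_right (1 - \<alpha>) b (\<lambda>u. g u - g b) x =
      weyl_deriv_left \<alpha> a f' x * weyl_deriv_right (1 - \<alpha>) b (\<lambda>u. g' u - g' b) x"
    proof (intro allI impI arg_cong2[where f = "(*)"])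
      fix x assume "x \<in> {a<..<b}"
      then show "weyl_deriv_left \<alpha> a f x = weyl_deriv_left \<alpha> a f' x"
        unfolding weyl_deriv_left_def using f by (auto intro!: set_lebesgue_integral_cong arg_cong2[where f = "(/)"] arg_cong2[where f = "(+)"])
      show "weyl_deriv_right (1 - \<alpha>) b (\<lambda>u. g u - g b) x = weyl_deriv_right (1 - \<alpha>) b (\<lambda>u. g' u - g' b) x"
        unfolding weyl_deriv_right_def using \<open>x \<in> {a<..<b}\<close> g by (auto intro!: set_lebesgue_integral_cong arg_cong2[where f = "(/)"] arg_cong2[where f = "(+)"])
    qed
  qed simp
  then show ?thesis
    unfolding has_gls_integral_def using gls_admissible_cong[of a b f f' g g'] f g by auto
qed

text \<open>If \<open>\<alpha> \<le> 1 - H\<close>, then \<open>2 - \<alpha> \<ge> 1 + H\<close>, and multiplication by the bounded factor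
\<open>(y - x) powr (1 - \<alpha> - H)\<close> turns the integrability required by admissibility into the one that is
excluded. Rational end points suffice, since the integrability holds for every \<open>x\<close> and is inherited
by smaller intervals.\<close>

lemma gls_admissible_order:
  assumes rough: "\<And>x u. x \<in> \<rat> \<Longrightarrow> u \<in> \<rat> \<Longrightarrow> a < x \<Longrightarrow> x < u \<Longrightarrow>
      \<not> set_integrable lborel {x<..<u} (\<lambda>y. (g x - g y) / (y - x) powr (1 + H))"
    and adm: "gls_admissible \<alpha> f g a t" and at: "a < t"
  shows "1 - H < \<alpha>"
proof (rule ccontr)
  assume "\<not> 1 - H < \<alpha>"
  then have e: "0 \<le> 1 - \<alpha> - H" by simp
  obtain x where x: "x \<in> \<rat>" "a < x" "x < t" using Rats_dense_in_real[OF at] by auto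
  obtain u where u: "u \<in> \<rat>" "x < u" "u < t" using Rats_dense_in_real[OF x(3)] by auto
  define q where "q y = (g x - g y) / (y - x) powr (2 - \<alpha>)" for y
  have "set_integrable lborel {x<..<t} q"
    using adm x unfolding gls_admissible_def q_def by auto
  then have q: "set_integrable lborel {x<..<u} q"
    by (rule set_integrable_subset) (use u in auto)
  have "integrable lborel (\<lambda>y. (y - x) powr (1 - \<alpha> - H) * (indicator {x<..<u} y *\<^sub>R q y))"
  proof (rule Bochner_Integration.integrable_bound)
    show "integrable lborel (\<lambda>y. (u - x) powr (1 - \<alpha> - H) * (indicator {x<..<u} y *\<^sub>R q y))"
      using q by (auto simp: set_integrable_def)
    have "(\<lambda>y. indicator {x<..<u} y *\<^sub>R q y) \<in> borel_measurable lborel"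
      using q by (auto simp: set_integrable_def)
    then show "(\<lambda>y. (y - x) powr (1 - \<alpha> - H) * (indicator {x<..<u} y *\<^sub>R q y)) \<in> borel_measurable lborel"
      by measurable
    have "\<bar>(y - x) powr (1 - \<alpha> - H) * (indicator {x<..<u} y *\<^sub>R q y)\<bar> \<le> \<bar>(u - x) powr (1 - \<alpha> - H) * (indicator {x<..<u} y *\<^sub>R q y)\<bar>" for y
    proof (cases "y \<in> {x<..<u}")
      case True
      then have "(y - x) powr (1 - \<alpha> - H) \<le> (u - x) powr (1 - \<alpha> - H)" using e by (intro powr_mono2) auto
      then show ?thesis by (auto simp: abs_mult intro!: mult_right_mono)
    qed simp
    then show "AE y in lborel. norm ((y - x) powr (1 - \<alpha> - H) * (indicator {x<..<u} y *\<^sub>R q y))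
        \<le> norm ((u - x) powr (1 - \<alpha> - H) * (indicator {x<..<u} y *\<^sub>R q y))" by simp
  qed
  moreover have "(y - x) powr (1 - \<alpha> - H) * (indicator {x<..<u} y *\<^sub>R q y) =
      indicator {x<..<u} y *\<^sub>R ((g x - g y) / (y - x) powr (1 + H))" for y
  proof -
    have "(y - x) powr (1 - \<alpha> - H) = (y - x) powr (2 - \<alpha>) / (y - x) powr (1 + H)"
      by (simp flip: powr_diff) (simp add: algebra_simps)
    then show ?thesis by (auto simp: q_def indicator_def)
  qed
  ultimately have "set_integrable lborel {x<..<u} (\<lambda>y. (g x - g y) / (y - x) powr (1 + H))"
    by (simp add: set_integrable_def)
  then show False using rough x u by blast
qed

lemma integral_holder:
  fixes \<beta> :: "real \<Rightarrow> real"
  assumes \<beta>: "continuous_on {a..T} \<beta>" and \<mu>: "\<mu> \<le> 1"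
  shows "\<exists>C. \<forall>s t. a \<le> s \<and> s \<le> t \<and> t \<le> T \<longrightarrow>
    \<bar>(LBINT u:{a..t}. \<beta> u) - (LBINT u:{a..s}. \<beta> u)\<bar> \<le> C * (t - s) powr \<mu>"
proof -
  obtain Q where Q0: "0 \<le> Q" and Q: "\<And>u. u \<in> {a..T} \<Longrightarrow> \<bar>\<beta> u\<bar> \<le> Q"
    using continuous_on_Icc_bounded[OF \<beta>] by blast
  show ?thesis
  proof (intro exI allI impI)
    fix s t assume st: "a \<le> s \<and> s \<le> t \<and> t \<le> T"
    have cont: "continuous_on {u..v} \<beta>" if "a \<le> u" "v \<le> T" for u v
      using \<beta> by (rule continuous_on_subset) (use that in auto)
    have eq: "(LBINT u:{a..v}. \<beta> u) = integral {a..v} \<beta>" if "v \<le> T" for v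
      by (intro set_borel_integral_eq_integral borel_integrable_atLeastAtMost' cont that) auto
    have "integral {a..s} \<beta> + integral {s..t} \<beta> = integral {a..t} \<beta>"
      using st by (intro Henstock_Kurzweil_Integration.integral_combine integrable_continuous_interval cont) auto
    then have "\<bar>(LBINT u:{a..t}. \<beta> u) - (LBINT u:{a..s}. \<beta> u)\<bar> = norm (integral {s..t} \<beta>)"
      using eq st by simp
    also have "\<dots> \<le> Q * (t - s)"
      using st Q by (intro integral_bound cont) auto
    also have "\<dots> = Q * (t - s) powr 1" using st by simp
    also have "\<dots> \<le> Q * ((T - a) powr (1 - \<mu>) * (t - s) powr \<mu>)"
      using st \<mu> Q0 by (intro mult_left_mono powr_le_powr_lower_exponent) auto
    finally show "\<bar>(LBINT u:{a..t}. \<beta> u) - (LBINT u:{a..s}. \<beta> u)\<bar> \<le> (Q * (T - a) powr (1 - \<mu>)) * (t - s) powr \<mu>"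
      by (simp add: mult_ac)
  qed
qed

lemma delay_term_holder:
  assumes K_cont: "continuous_on ({0..T} \<times> {-r..0} \<times> UNIV) (\<lambda>(t, s, x). K t s x)"
    and K1: "\<And>t u s x. t \<in> {0..T} \<Longrightarrow> u \<in> {0..T} \<Longrightarrow> s \<in> {-r..0} \<Longrightarrow> \<bar>K t s x - K u s x\<bar> \<le> K\<^sub>1 * \<bar>t - u\<bar>"
    and K2: "\<And>t s x y. t \<in> {0..T} \<Longrightarrow> s \<in> {-r..0} \<Longrightarrow> \<bar>K t s x - K t s y\<bar> \<le> K\<^sub>2 * \<bar>x - y\<bar>"
    and pos: "0 < K\<^sub>1" "0 < K\<^sub>2" "0 < r"
    and x: "holder_on {-r..T} \<nu> x" and \<nu>: "0 < \<nu>" "\<nu> \<le> 1"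
  shows "holder_on {0..T} \<nu> (delay_term K r x)"
proof -
  obtain L where L: "0 < L" "\<And>s t. s \<in> {-r..T} \<Longrightarrow> t \<in> {-r..T} \<Longrightarrow> \<bar>x t - x s\<bar> \<le> L * \<bar>t - s\<bar> powr \<nu>"
    using x by (auto simp: holder_on_def)
  have xc: "continuous_on {-r..T} x" using x \<nu>(1) by (rule holder_on_imp_continuous_on)
  have cont: "continuous_on {-r..0} (\<lambda>u. K t u (x (t + u)))" if t: "t \<in> {0..T}" for t
  proof -
    have "continuous_on {-r..0} (\<lambda>u. (t, u, x (t + u)))"
      using t by (intro continuous_intros continuous_on_compose2[OF xc]) auto
    then have "continuous_on {-r..0} (\<lambda>u. (\<lambda>(t, s, x). K t s x) (t, u, x (t + u)))"
      using t by (intro continuous_on_compose2[OF K_cont]) auto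
    then show ?thesis by simp
  qed
  have Y: "delay_term K r x t = integral {-r..0} (\<lambda>u. K t u (x (t + u)))" if "t \<in> {0..T}" for t
    unfolding delay_term_def
    by (intro set_borel_integral_eq_integral borel_integrable_atLeastAtMost' cont that)
  show ?thesis
  proof (rule holder_onI)
    fix s t assume st: "s \<in> {0..T}" "t \<in> {0..T}"
    define D where "D = (K\<^sub>1 * T powr (1 - \<nu>) + K\<^sub>2 * L) * \<bar>t - s\<bar> powr \<nu>"
    have D: "\<bar>K t u (x (t + u)) - K s u (x (s + u))\<bar> \<le> D" if u: "u \<in> {-r..0}" for u
    proof -
      have "\<bar>K t u (x (t + u)) - K s u (x (s + u))\<bar> \<le>
          \<bar>K t u (x (t + u)) - K s u (x (t + u))\<bar> + \<bar>K s u (x (t + u)) - K s u (x (s + u))\<bar>" by linarith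
      also have "\<dots> \<le> K\<^sub>1 * \<bar>t - s\<bar> + K\<^sub>2 * \<bar>x (t + u) - x (s + u)\<bar>"
        using K1 K2 st u by (intro add_mono) auto
      also have "\<bar>x (t + u) - x (s + u)\<bar> \<le> L * \<bar>(t + u) - (s + u)\<bar> powr \<nu>"
        using st u by (intro L) auto
      also have "\<bar>t - s\<bar> = \<bar>t - s\<bar> powr 1" by simp
      also have "\<dots> \<le> T powr (1 - \<nu>) * \<bar>t - s\<bar> powr \<nu>"
        using st \<nu> by (intro powr_le_powr_lower_exponent) auto
      finally show ?thesis using pos by (simp add: D_def algebra_simps)
    qed
    have "delay_term K r x t - delay_term K r x s = integral {-r..0} (\<lambda>u. K t u (x (t + u)) - K s u (x (s + u)))"
      unfolding Y[OF st(1)] Y[OF st(2)]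
      by (intro Henstock_Kurzweil_Integration.integral_diff[symmetric] integrable_continuous_interval cont st)
    also have "norm \<dots> \<le> D * (0 - (-r))"
      using pos D st by (intro integral_bound continuous_intros cont) auto
    finally show "\<bar>delay_term K r x t - delay_term K r x s\<bar> \<le> (K\<^sub>1 * T powr (1 - \<nu>) + K\<^sub>2 * L) * r * \<bar>t - s\<bar> powr \<nu>"
      by (simp add: D_def mult_ac)
  qed
qed

lemma coefficient_holder:
  fixes c :: "real \<Rightarrow> real \<Rightarrow> real \<Rightarrow> real"
  assumes c1: "\<And>s t x y. s \<in> {0..T} \<Longrightarrow> t \<in> {0..T} \<Longrightarrow> \<bar>c t x y - c s x y\<bar> \<le> L\<^sub>1 * \<bar>t - s\<bar>"
    and c2: "\<And>t x\<^sub>1 x\<^sub>2 y\<^sub>1 y\<^sub>2. t \<in> {0..T} \<Longrightarrow> \<bar>c t x\<^sub>1 y\<^sub>1 - c t x\<^sub>2 y\<^sub>2\<bar> \<le> L\<^sub>2 * (\<bar>x\<^sub>1 - x\<^sub>2\<bar> + \<bar>y\<^sub>1 - y\<^sub>2\<bar>)"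
    and pos: "0 < L\<^sub>1" "0 < L\<^sub>2"
    and x: "holder_on {0..T} \<nu> x" and y: "holder_on {0..T} \<nu> y" and \<nu>: "\<nu> \<le> 1"
  shows "holder_on {0..T} \<nu> (\<lambda>s. c s (x s) (y s))"
proof -
  obtain A where A: "0 < A" "\<And>s t. s \<in> {0..T} \<Longrightarrow> t \<in> {0..T} \<Longrightarrow> \<bar>x t - x s\<bar> \<le> A * \<bar>t - s\<bar> powr \<nu>"
    using x by (auto simp: holder_on_def)
  obtain B where B: "0 < B" "\<And>s t. s \<in> {0..T} \<Longrightarrow> t \<in> {0..T} \<Longrightarrow> \<bar>y t - y s\<bar> \<le> B * \<bar>t - s\<bar> powr \<nu>"
    using y by (auto simp: holder_on_def)
  show ?thesis
  proof (rule holder_onI)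
    fix s t assume st: "s \<in> {0..T}" "t \<in> {0..T}"
    have "\<bar>c t (x t) (y t) - c s (x s) (y s)\<bar> \<le>
        \<bar>c t (x t) (y t) - c s (x t) (y t)\<bar> + \<bar>c s (x t) (y t) - c s (x s) (y s)\<bar>" by linarith
    also have "\<dots> \<le> L\<^sub>1 * \<bar>t - s\<bar> + L\<^sub>2 * (\<bar>x t - x s\<bar> + \<bar>y t - y s\<bar>)"
      using c1 c2 st by (intro add_mono) auto
    also have "\<bar>t - s\<bar> = \<bar>t - s\<bar> powr 1" by simp
    also have "\<dots> \<le> T powr (1 - \<nu>) * \<bar>t - s\<bar> powr \<nu>"
      using st \<nu> by (intro powr_le_powr_lower_exponent) auto
    also have "\<bar>x t - x s\<bar> + \<bar>y t - y s\<bar> \<le> A * \<bar>t - s\<bar> powr \<nu> + B * \<bar>t - s\<bar> powr \<nu>"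
      using A B st by (intro add_mono) auto
    finally show "\<bar>c t (x t) (y t) - c s (x s) (y s)\<bar> \<le> (L\<^sub>1 * T powr (1 - \<nu>) + L\<^sub>2 * (A + B)) * \<bar>t - s\<bar> powr \<nu>"
      using pos by (simp add: algebra_simps)
  qed
qed


section \<open>Regularity of the solution\<close>

text \<open>The deterministic part of the argument, for a single path \<open>x\<close> driven by \<open>g\<close>, with the coefficients along
the path already inserted as \<open>\<beta>\<close> and \<open>\<gamma>\<close>.\<close>

theorem delay_equation_path_holder:
  fixes x g \<beta> \<gamma> :: "real \<Rightarrow> real"
  assumes H: "0 < H" "H < 1" and T: "0 < T" and \<nu>: "1 - H < \<nu>" "0 < \<nu>" "\<nu> \<le> 1"
    and \<beta>: "continuous_on {0..T} \<beta>" and \<gamma>: "holder_on {0..T} \<nu> \<gamma>"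
    and g: "\<And>\<mu>. 0 < \<mu> \<Longrightarrow> \<mu> < H \<Longrightarrow> holder_on {0..T} \<mu> g"
    and rough: "\<And>x u. x \<in> \<rat> \<Longrightarrow> u \<in> \<rat> \<Longrightarrow> 0 < x \<Longrightarrow> x < u \<Longrightarrow>
      \<not> set_integrable lborel {x<..<u} (\<lambda>y. (g x - g y) / (y - x) powr (1 + H))"
    and eq: "\<And>t. t \<in> {0..T} \<Longrightarrow> \<exists>I. has_gls_integral \<gamma> g 0 t I \<and> x t = x 0 + (LBINT s:{0..t}. \<beta> s) + I"
    and \<mu>: "0 < \<mu>" "\<mu> < H"
  shows "\<exists>C. \<forall>s t. 0 \<le> s \<and> s \<le> t \<and> t \<le> T \<longrightarrow> \<bar>x t - x s\<bar> \<le> C * (t - s) powr \<mu>"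
proof -
  \<comment> \<open>The order \<open>\<kappa>\<close> has to be at least \<open>\<mu>\<close> and to exceed \<open>1 - \<nu>\<close>, but to stay below \<open>H\<close>.\<close>
  define \<kappa> where "\<kappa> = max \<mu> ((1 - \<nu> + H) / 2)"
  have \<kappa>: "0 < \<kappa>" "\<kappa> < H" "\<mu> \<le> \<kappa>" "1 < \<nu> + \<kappa>" "\<kappa> \<le> 1"
    using \<mu> \<nu> H by (auto simp: \<kappa>_def max_def field_simps)
  define p where "p u = max 0 (min T u)" for u
  have p: "p u = u" if "u \<in> {0..T}" for u using that by (simp add: p_def)
  obtain N where N: "0 < N" "\<And>s t. \<bar>\<gamma> (p s) - \<gamma> (p t)\<bar> \<le> N * \<bar>s - t\<bar> powr \<nu>"
    unfolding p_def by (rule holder_on_clamp[OF \<gamma> less_imp_le[OF T] less_imp_le[OF \<nu>(2)]]) blast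
  have g_clamp: "\<exists>L. \<forall>s t. \<bar>g (p s) - g (p t)\<bar> \<le> L * \<bar>s - t\<bar> powr \<mu>'" if "0 < \<mu>'" "\<mu>' < H" for \<mu>'
    unfolding p_def by (rule holder_on_clamp[OF g[OF that] less_imp_le[OF T] less_imp_le[OF that(1)]]) blast
  obtain L where L: "\<And>s t. \<bar>g (p s) - g (p t)\<bar> \<le> L * \<bar>s - t\<bar> powr \<kappa>"
    using g_clamp[OF \<kappa>(1,2)] by blast
  obtain Q where "\<And>s. s \<in> {0..T} \<Longrightarrow> \<bar>\<gamma> s\<bar> \<le> Q"
    using continuous_on_Icc_bounded[OF holder_on_imp_continuous_on[OF \<gamma> \<nu>(2)]] by blast
  then have Q: "\<bar>\<gamma> (p s)\<bar> \<le> Q" for s using T by (auto simp: p_def)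
  obtain J where J: "\<And>t. t \<in> {0..T} \<Longrightarrow> has_gls_integral \<gamma> g 0 t (J t)"
      "\<And>t. t \<in> {0..T} \<Longrightarrow> x t = x 0 + (LBINT s:{0..t}. \<beta> s) + J t"
    using eq by metis
  have cong: "has_gls_integral \<gamma> g 0 t = has_gls_integral (\<lambda>s. \<gamma> (p s)) (\<lambda>s. g (p s)) 0 t"
    "gls_admissible \<alpha> \<gamma> g 0 t = gls_admissible \<alpha> (\<lambda>s. \<gamma> (p s)) (\<lambda>s. g (p s)) 0 t" if "t \<in> {0..T}" for t \<alpha>
  proof -
    show "has_gls_integral \<gamma> g 0 t = has_gls_integral (\<lambda>s. \<gamma> (p s)) (\<lambda>s. g (p s)) 0 t"
      using that by (intro ext has_gls_integral_cong) (auto simp: p)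
    show "gls_admissible \<alpha> \<gamma> g 0 t = gls_admissible \<alpha> (\<lambda>s. \<gamma> (p s)) (\<lambda>s. g (p s)) 0 t"
      using that by (intro gls_admissible_cong) (auto simp: p)
  qed
  obtain C1 where C1: "\<And>s t. 0 \<le> s \<Longrightarrow> s \<le> t \<Longrightarrow> t \<le> T \<Longrightarrow> \<bar>J t - J s\<bar> \<le> C1 * (t - s) powr \<kappa>"
  proof (rule gls_integral_holder[OF N(2) Q L \<nu>(2) \<kappa>(1,5,4), of 0 T J])
    fix t assume "t \<in> {0..T}"
    then show "has_gls_integral (\<lambda>s. \<gamma> (p s)) (\<lambda>s. g (p s)) 0 t (J t)" using J(1) cong by simp
  next
    fix t \<alpha> assume t: "t \<in> {0<..T}" and "gls_admissible \<alpha> (\<lambda>s. \<gamma> (p s)) (\<lambda>s. g (p s)) 0 t"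
    then have adm: "gls_admissible \<alpha> \<gamma> g 0 t" using cong(2)[of t \<alpha>] by auto
    then have "1 - H < \<alpha>" using gls_admissible_order[OF rough adm] t by auto
    moreover have "\<alpha> < 1" using adm by (simp add: gls_admissible_def)
    ultimately have "0 < (1 - \<alpha> + H) / 2" "(1 - \<alpha> + H) / 2 < H" "1 - \<alpha> < (1 - \<alpha> + H) / 2"
      using H by auto
    then show "\<exists>\<mu>' L'. 1 - \<alpha> < \<mu>' \<and> (\<forall>s u. \<bar>g (p s) - g (p u)\<bar> \<le> L' * \<bar>s - u\<bar> powr \<mu>')"
      using g_clamp by blast
  qed blast
  obtain C2 where C2: "\<And>s t. 0 \<le> s \<Longrightarrow> s \<le> t \<Longrightarrow> t \<le> T \<Longrightarrow>
      \<bar>(LBINT u:{0..t}. \<beta> u) - (LBINT u:{0..s}. \<beta> u)\<bar> \<le> C2 * (t - s) powr \<kappa>"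
    using integral_holder[OF \<beta> \<kappa>(5)] by blast
  show ?thesis
  proof (intro exI allI impI)
    fix s t assume st: "0 \<le> s \<and> s \<le> t \<and> t \<le> T"
    have "x t - x s = ((LBINT u:{0..t}. \<beta> u) - (LBINT u:{0..s}. \<beta> u)) + (J t - J s)"
      using J(2)[of t] J(2)[of s] st by auto
    then have "\<bar>x t - x s\<bar> \<le> C2 * (t - s) powr \<kappa> + C1 * (t - s) powr \<kappa>"
      using C1[of s t] C2[of s t] st by linarith
    also have "\<dots> \<le> \<bar>C1 + C2\<bar> * (t - s) powr \<kappa>"
      unfolding distrib_right[symmetric] by (intro mult_right_mono) auto
    also have "\<dots> \<le> \<bar>C1 + C2\<bar> * (T powr (\<kappa> - \<mu>) * (t - s) powr \<mu>)"
      using st \<kappa>(3) by (intro mult_left_mono powr_le_powr_lower_exponent) auto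
    finally show "\<bar>x t - x s\<bar> \<le> (\<bar>C1 + C2\<bar> * T powr (\<kappa> - \<mu>)) * (t - s) powr \<mu>"
      by (simp add: mult_ac)
  qed
qed

theorem proposition1:
  fixes M :: "'a measure" and F :: "real \<Rightarrow> 'a measure"
    and B X :: "real \<Rightarrow> 'a \<Rightarrow> real"
    and b \<sigma> K :: "real \<Rightarrow> real \<Rightarrow> real \<Rightarrow> real"
    and \<phi> :: "real \<Rightarrow> real"
    and r T H L\<^sub>1 L\<^sub>2 L\<^sub>3 K\<^sub>1 K\<^sub>2 K\<^sub>3 \<epsilon> \<rho> :: real
  assumes "usual_filtered_prob_space M F"
    and "r > 0" and "T > 0" and "1/2 < H" and "H < 1"
    and "fractional_brownian_motion M H B"
    and "continuous_on ({0..T} \<times> UNIV \<times> UNIV) (\<lambda>(t, x, y). b t x y)"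
    and "continuous_on ({0..T} \<times> UNIV \<times> UNIV) (\<lambda>(t, x, y). \<sigma> t x y)"
    and "continuous_on ({0..T} \<times> {-r..0} \<times> UNIV) (\<lambda>(t, s, x). K t s x)"
    and "\<And>\<rho>'. 0 < \<rho>' \<Longrightarrow> \<rho>' < H \<Longrightarrow> holder_on {-r..0} (H - \<rho>') \<phi>"
    and "delay_sde_solution M H B b \<sigma> K r T \<phi> X"
    and "L\<^sub>1 > 0" and "L\<^sub>2 > 0" and "L\<^sub>3 > 0"
    and "\<And>s t x y. s \<in> {0..T} \<Longrightarrow> t \<in> {0..T} \<Longrightarrow>
           \<bar>b t x y - b s x y\<bar> + \<bar>\<sigma> t x y - \<sigma> s x y\<bar> \<le> L\<^sub>1 * \<bar>t - s\<bar>"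
    and "\<And>t x\<^sub>1 x\<^sub>2 y\<^sub>1 y\<^sub>2. t \<in> {0..T} \<Longrightarrow>
           \<bar>b t x\<^sub>1 y\<^sub>1 - b t x\<^sub>2 y\<^sub>2\<bar> + \<bar>\<sigma> t x\<^sub>1 y\<^sub>1 - \<sigma> t x\<^sub>2 y\<^sub>2\<bar>
             \<le> L\<^sub>2 * (\<bar>x\<^sub>1 - x\<^sub>2\<bar> + \<bar>y\<^sub>1 - y\<^sub>2\<bar>)"
    and "\<And>t x y. t \<in> {0..T} \<Longrightarrow> \<bar>b t x y\<bar> + \<bar>\<sigma> t x y\<bar> \<le> L\<^sub>3 * (1 + \<bar>x\<bar> + \<bar>y\<bar>)"
    and "\<And>t s x. t \<in> {0..T} \<Longrightarrow> s \<in> {-r..0} \<Longrightarrow> (\<lambda>x. K t s x) differentiable (at x)"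
    and "K\<^sub>1 > 0" and "K\<^sub>2 > 0" and "K\<^sub>3 > 0"
    and "\<And>t u s v x. t \<in> {0..T} \<Longrightarrow> u \<in> {0..T} \<Longrightarrow> s \<in> {-r..0} \<Longrightarrow> v \<in> {-r..0} \<Longrightarrow>
           \<bar>K t s x - K u v x\<bar> \<le> K\<^sub>1 * (\<bar>t - u\<bar> + \<bar>s - v\<bar>)"
    and "\<And>t s x y. t \<in> {0..T} \<Longrightarrow> s \<in> {-r..0} \<Longrightarrow> \<bar>K t s x - K t s y\<bar> \<le> K\<^sub>2 * \<bar>x - y\<bar>"
    and "\<And>t s x. t \<in> {0..T} \<Longrightarrow> s \<in> {-r..0} \<Longrightarrow> \<bar>K t s x\<bar> \<le> K\<^sub>3 * (1 + \<bar>x\<bar>)"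
    and "\<epsilon> > 0" and "0 < \<rho>" and "\<rho> < H"
  shows "\<exists>h\<^sub>0::real>0. \<exists>\<Omega>'\<in>sets M. measure M \<Omega>' > 1 - \<epsilon> \<and>
           (\<forall>\<omega>\<in>\<Omega>'. \<forall>h. 0 < h \<and> h < h\<^sub>0 \<longrightarrow>
              (\<exists>C>0. (\<forall>t\<in>{0..T}. \<bar>X t \<omega>\<bar> < C) \<and>
                (\<forall>s t. 0 \<le> s \<and> s < t \<and> t \<le> T \<longrightarrow>
                   \<bar>X t \<omega> - X s \<omega>\<bar> \<le> C * (t - s) powr (H - \<rho>))))"
proof -
  note r_pos = assms(2) and T_pos = assms(3) and H_gt = assms(4) and H_lt = assms(5)
  note fbm = assms(6) and K_cont = assms(9) and \<phi>_holder = assms(10) and sol = assms(11)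
  note time_lipschitz = assms(15) and state_lipschitz = assms(16)
  note K_time = assms(22) and K_state = assms(23)
  interpret prob_space M
    using assms(1) by (simp add: usual_filtered_prob_space_def)
  define Y where "Y \<omega> = delay_term K r (\<lambda>u. X u \<omega>)" for \<omega>
  have H0: "0 < H" using H_gt by simp
  have X_holder: "AE \<omega> in M. \<exists>\<nu>>1 - H. holder_on {0..T} \<nu> (\<lambda>t. X t \<omega>)"
    and X_init: "AE \<omega> in M. \<forall>t\<in>{-r..0}. X t \<omega> = \<phi> t"
    and X_eq: "AE \<omega> in M. \<forall>t\<in>{0..T}. \<exists>I.
        has_gls_integral (\<lambda>s. \<sigma> s (X s \<omega>) (Y \<omega> s)) (\<lambda>s. B s \<omega>) 0 t I \<and>
        X t \<omega> = X 0 \<omega> + (LBINT s:{0..t}. b s (X s \<omega>) (Y \<omega> s)) + I"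
    using sol by (simp_all add: delay_sde_solution_def Y_def)
  have "AE \<omega> in M. \<exists>C. \<forall>s t. 0 \<le> s \<and> s \<le> t \<and> t \<le> T \<longrightarrow> \<bar>X t \<omega> - X s \<omega>\<bar> \<le> C * (t - s) powr (H - \<rho>)"
    using X_holder X_init X_eq fbm_paths_holder[OF fbm H0, of T] fbm_paths_rough[OF fbm]
  proof eventually_elim
    case (elim \<omega>)
    from elim(1) obtain \<nu>\<^sub>0 where \<nu>\<^sub>0: "1 - H < \<nu>\<^sub>0" "holder_on {0..T} \<nu>\<^sub>0 (\<lambda>t. X t \<omega>)" by blast
    \<comment> \<open>The order \<open>1/2\<close> is above \<open>1 - H\<close> and available for the initial segment.\<close>
    define \<nu> where "\<nu> = min \<nu>\<^sub>0 (1/2)"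
    have \<nu>: "1 - H < \<nu>" "0 < \<nu>" "\<nu> \<le> 1" "\<nu> \<le> \<nu>\<^sub>0" "\<nu> \<le> 1/2"
      using \<nu>\<^sub>0(1) H_gt H_lt by (auto simp: \<nu>_def)
    have X1: "holder_on {0..T} \<nu> (\<lambda>t. X t \<omega>)" using \<nu>\<^sub>0(2) \<nu>(4) by (rule holder_on_lower_exponent)
    have "holder_on {-r..0} (1/2) \<phi>" using \<phi>_holder[of "H - 1/2"] H_gt by simp
    then have "holder_on {-r..0} (1/2) (\<lambda>t. X t \<omega>)" using elim(2) by (simp add: holder_on_def)
    then have X0: "holder_on {-r..0} \<nu> (\<lambda>t. X t \<omega>)" using \<nu>(5) by (rule holder_on_lower_exponent)
    have X2: "holder_on {-r..T} \<nu> (\<lambda>t. X t \<omega>)"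
      by (rule holder_on_glue[OF X0 X1]) (use \<nu>(2) r_pos T_pos in auto)
    have Y: "holder_on {0..T} \<nu> (Y \<omega>)"
      unfolding Y_def
    proof (rule delay_term_holder[OF K_cont _ K_state assms(19,20) r_pos X2 \<nu>(2,3)])
      fix t u s x assume "t \<in> {0..T}" "u \<in> {0..T}" "s \<in> {-r..0}"
      then show "\<bar>K t s x - K u s x\<bar> \<le> K\<^sub>1 * \<bar>t - u\<bar>" using K_time[of t u s s x] by simp
    qed
    have b_holder: "holder_on {0..T} \<nu> (\<lambda>s. b s (X s \<omega>) (Y \<omega> s))"
    proof (rule coefficient_holder[OF _ _ assms(12,13) X1 Y \<nu>(3)])
      show "\<bar>b t x y - b s x y\<bar> \<le> L\<^sub>1 * \<bar>t - s\<bar>" if "s \<in> {0..T}" "t \<in> {0..T}" for s t x y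
        using time_lipschitz[OF that, of x y] by linarith
      show "\<bar>b t x\<^sub>1 y\<^sub>1 - b t x\<^sub>2 y\<^sub>2\<bar> \<le> L\<^sub>2 * (\<bar>x\<^sub>1 - x\<^sub>2\<bar> + \<bar>y\<^sub>1 - y\<^sub>2\<bar>)" if "t \<in> {0..T}" for t x\<^sub>1 x\<^sub>2 y\<^sub>1 y\<^sub>2
        using state_lipschitz[OF that, of x\<^sub>1 y\<^sub>1 x\<^sub>2 y\<^sub>2] by linarith
    qed
    have \<sigma>_holder: "holder_on {0..T} \<nu> (\<lambda>s. \<sigma> s (X s \<omega>) (Y \<omega> s))"
    proof (rule coefficient_holder[OF _ _ assms(12,13) X1 Y \<nu>(3)])
      show "\<bar>\<sigma> t x y - \<sigma> s x y\<bar> \<le> L\<^sub>1 * \<bar>t - s\<bar>" if "s \<in> {0..T}" "t \<in> {0..T}" for s t x y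
        using time_lipschitz[OF that, of x y] by linarith
      show "\<bar>\<sigma> t x\<^sub>1 y\<^sub>1 - \<sigma> t x\<^sub>2 y\<^sub>2\<bar> \<le> L\<^sub>2 * (\<bar>x\<^sub>1 - x\<^sub>2\<bar> + \<bar>y\<^sub>1 - y\<^sub>2\<bar>)" if "t \<in> {0..T}" for t x\<^sub>1 x\<^sub>2 y\<^sub>1 y\<^sub>2
        using state_lipschitz[OF that, of x\<^sub>1 y\<^sub>1 x\<^sub>2 y\<^sub>2] by linarith
    qed
    show ?case
    proof (rule delay_equation_path_holder[OF H0 H_lt T_pos \<nu>(1-3) _ \<sigma>_holder])
      show "continuous_on {0..T} (\<lambda>s. b s (X s \<omega>) (Y \<omega> s))"
        using b_holder \<nu>(2) by (rule holder_on_imp_continuous_on)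
      show "holder_on {0..T} \<mu> (\<lambda>t. B t \<omega>)" if "0 < \<mu>" "\<mu> < H" for \<mu>
        using elim(4) that by blast
      show "\<not> set_integrable lborel {x<..<u} (\<lambda>y. (B x \<omega> - B y \<omega>) / (y - x) powr (1 + H))"
        if "x \<in> \<rat>" "u \<in> \<rat>" "0 < x" "x < u" for x u
        using elim(5) that by blast
      show "\<exists>I. has_gls_integral (\<lambda>s. \<sigma> s (X s \<omega>) (Y \<omega> s)) (\<lambda>t. B t \<omega>) 0 t I \<and>
          X t \<omega> = X 0 \<omega> + (LBINT s:{0..t}. b s (X s \<omega>) (Y \<omega> s)) + I" if "t \<in> {0..T}" for t
        using elim(3) that by blast
      show "0 < H - \<rho>" "H - \<rho> < H" using assms(26,27) by auto
    qed
  qed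
  then obtain N where good: "\<And>\<omega>. \<omega> \<in> space M - N \<Longrightarrow>
      \<exists>C. \<forall>s t. 0 \<le> s \<and> s \<le> t \<and> t \<le> T \<longrightarrow> \<bar>X t \<omega> - X s \<omega>\<bar> \<le> C * (t - s) powr (H - \<rho>)"
    and N: "N \<in> null_sets M"
    by (rule AE_E3) blast
  have mem: "space M - N \<in> sets M" using N by auto
  have "prob (space M - N) = 1"
    using N by (simp add: prob_compl measure_eq_0_null_sets null_setsD2)
  then have full: "1 - \<epsilon> < measure M (space M - N)" using assms(25) by simp
  have bounds: "\<exists>C>0. (\<forall>t\<in>{0..T}. \<bar>X t \<omega>\<bar> < C) \<and>
      (\<forall>s t. 0 \<le> s \<and> s < t \<and> t \<le> T \<longrightarrow> \<bar>X t \<omega> - X s \<omega>\<bar> \<le> C * (t - s) powr (H - \<rho>))"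
    if "\<omega> \<in> space M - N" for \<omega>
  proof -
    from good[OF that] obtain C where C: "\<And>s t. 0 \<le> s \<Longrightarrow> s \<le> t \<Longrightarrow> t \<le> T \<Longrightarrow>
        \<bar>X t \<omega> - X s \<omega>\<bar> \<le> C * (t - s) powr (H - \<rho>)" by blast
    define D where "D = \<bar>X 0 \<omega>\<bar> + \<bar>C\<bar> * T powr (H - \<rho>) + \<bar>C\<bar> + 1"
    have nonneg: "0 \<le> \<bar>X 0 \<omega>\<bar>" "0 \<le> \<bar>C\<bar> * T powr (H - \<rho>)" by auto
    have "0 < D" using nonneg by (simp add: D_def add_nonneg_pos)
    moreover have "\<bar>X t \<omega>\<bar> < D" if t: "t \<in> {0..T}" for t
    proof -
      have "\<bar>X t \<omega> - X 0 \<omega>\<bar> \<le> C * (t - 0) powr (H - \<rho>)" using t by (intro C) auto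
      also have "\<dots> \<le> \<bar>C\<bar> * T powr (H - \<rho>)"
        using t assms(27) by (intro mult_mono powr_mono2) auto
      finally show ?thesis unfolding D_def by linarith
    qed
    moreover have "\<bar>X t \<omega> - X s \<omega>\<bar> \<le> D * (t - s) powr (H - \<rho>)" if st: "0 \<le> s" "s < t" "t \<le> T" for s t
    proof -
      have "\<bar>X t \<omega> - X s \<omega>\<bar> \<le> C * (t - s) powr (H - \<rho>)" using st by (intro C) auto
      moreover have "C \<le> D" using nonneg abs_ge_self[of C] unfolding D_def by linarith
      then have "C * (t - s) powr (H - \<rho>) \<le> D * (t - s) powr (H - \<rho>)" by (intro mult_right_mono) auto
      ultimately show ?thesis by linarith
    qed
    ultimately show ?thesis by blast
  qed
  show ?thesis
  proof (rule exI[of _ 1], intro conjI bexI[of _ "space M - N"])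
    show "(0::real) < 1" by simp
    show "\<forall>\<omega>\<in>space M - N. \<forall>h::real. 0 < h \<and> h < 1 \<longrightarrow> (\<exists>C>0. (\<forall>t\<in>{0..T}. \<bar>X t \<omega>\<bar> < C) \<and>
      (\<forall>s t. 0 \<le> s \<and> s < t \<and> t \<le> T \<longrightarrow> \<bar>X t \<omega> - X s \<omega>\<bar> \<le> C * (t - s) powr (H - \<rho>)))"
      using bounds by blast
  qed (fact full mem)+
qed

end
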